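(* Let $d\ge1$, $\nu>0$, $\beta\in(0,1)$, $\alpha\in(0,2)$. Let $\sigma:\mathbb{R}\to\mathbb{R}$ be a locally Lipschitz function for which there is $\gamma>0$ with $\sigma(x)\ge|x|^{1+\gamma}$ for all $x\in\mathbb{R}$. Let $\dot F$ be a Gaussian noise, white in time and colored in space with spatial correlation $f$ (as described in the context), and assume that for fixed $R>0$ there is a positive number $K_f$ (depending on $R$) with $\inf_{x,y\in B(0,R)}f(x,y)\ge K_f$. For a nonnegative bounded deterministic function $u_0$ on $\mathbb{R}^d$ with $K_{u_0}:=\int_{B(0,1)}u_0(x)\,dx>0$, let $u_t(x)$ be the solution of $$\partial_t^\beta u_t(x)=-\nu(-\Delta)^{\alpha/2}u_t(x)+I^{1-\beta}[\sigma(u)\dot F(t,x)],\qquad t>0,\ x\in\mathbb{R}^d,$$ with initial condition $u_0$. Then there exist $t_0\ge0$ and a positive constant $K$ such that for all $t\ge t_0$ and $x\in\mathbb{R}^d$, $$\mathbb{E}|u_t(x)|^2=\infty\quad\text{whenever } K_{u_0}\ge K.$$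
   Context: $\partial_t^\beta$ is the Caputo derivative, $\partial_t^\beta u_t(x)=\frac{1}{\Gamma(1-\beta)}\int_0^t\frac{\partial u_r(x)}{\partial r}\frac{dr}{(t-r)^\beta}$, and $I^{\gamma'}h(t)=\frac{1}{\Gamma(\gamma')}\int_0^t(t-\tau)^{\gamma'-1}h(\tau)\,d\tau$ for $\gamma'>0$. The operator $-\nu(-\Delta)^{\alpha/2}$ is the generator of the isotropic $\alpha$-stable Lévy process $X$ with transition density $p(t,x)$ determined by $\int_{\mathbb{R}^d}e^{i\xi\cdot x}p(t,x)\,dx=e^{-t\nu|\xi|^\alpha}$. Let $D$ be a $\beta$-stable subordinator independent of $X$ ($\mathbb{E}e^{-\lambda D_r}=e^{-r\lambda^\beta}$), $E_t=\inf\{r: D_r>t\}$ its first passage time with density $f_{E_t}$, and let $G_t(x)=\int_0^\infty p(s,x)f_{E_t}(s)\,ds$ be the density of $X_{E_t}$. $B(0,R)$ is the ball of radius $R$ centered at $0$ in $\mathbb{R}^d$. The noise $\dot F$ is centered Gaussian with $\mathbb{E}[\dot F(s,x)\dot F(t,y)]=\delta_0(t-s)f(x,y)$, where $f(x,y)\le g(x-y)$ and $g$ is a locally integrable function on $\mathbb{R}^d$ with a possible singularity at $0$ satisfying $\int_{\mathbb{R}^d}\frac{\hat g(\xi)}{1+|\xi|^\alpha}\,d\xi<\infty$ ($\hat g$ is the Fourier transform of $g$). The solution is understood as the mild solution in the sense of Walsh: $u$ is adapted to the filtration generated by the noise and satisfies $$u_t(x)=\int_{\mathbb{R}^d}G_t(x-y)u_0(y)\,dy+\int_{\mathbb{R}^d}\int_0^tG_{t-s}(x-y)\sigma(u_s(y))\,F(ds\,dy).$$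 The constants $t_0$ and $K$ do not depend on $u_0$. *)

theory Defs
  imports "HOL-Probability.Probability"
begin

section \<open>The kernel\<close>

text \<open>
  The transition density of the Levy process generated by \<open>-\<nu> (-\<Delta>)\<^sup>\<alpha>\<^sup>/\<^sup>2\<close>.
  The characteristic function determines \<open>p t\<close> almost everywhere; continuity selects the usual
  version.
\<close>

definition stable_transition_density ::
  "real \<Rightarrow> real \<Rightarrow> (real \<Rightarrow> 'a::euclidean_space \<Rightarrow> real) \<Rightarrow> bool" where
  "stable_transition_density \<nu> \<alpha> p \<longleftrightarrow>
     continuous_on ({0<..} \<times> UNIV) (\<lambda>(t, x). p t x) \<and>
     (\<forall>t>0. (\<forall>x. 0 \<le> p t x) \<and> integrable lborel (p t) \<and>
        (\<forall>\<xi>. (\<integral>x. exp (\<i> * complex_of_real (\<xi> \<bullet> x)) * complex_of_real (p t x) \<partial>lborel) =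
              complex_of_real (exp (- (t * \<nu> * norm \<xi> powr \<alpha>)))))"

definition stable_subordinator ::
  "'v measure \<Rightarrow> real \<Rightarrow> (real \<Rightarrow> 'v \<Rightarrow> real) \<Rightarrow> bool" where
  "stable_subordinator N \<beta> D \<longleftrightarrow>
     prob_space N \<and>
     (\<forall>r\<ge>0. D r \<in> borel_measurable N) \<and>
     (AE \<omega> in N. D 0 \<omega> = 0 \<and> mono_on {0..} (\<lambda>r. D r \<omega>) \<and>
        (\<forall>r\<ge>0. continuous (at_right r) (\<lambda>q. D q \<omega>))) \<and>
     (\<forall>(\<tau> :: nat \<Rightarrow> real) n. 0 \<le> \<tau> 0 \<longrightarrow> mono \<tau> \<longrightarrow>
        prob_space.indep_vars N (\<lambda>_. borel) (\<lambda>i \<omega>. D (\<tau> (Suc i)) \<omega> - D (\<tau> i) \<omega>) {..<n}) \<and>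
     (\<forall>r\<ge>0. \<forall>h\<ge>0. distr N borel (\<lambda>\<omega>. D (r + h) \<omega> - D r \<omega>) = distr N borel (D h)) \<and>
     (\<forall>r\<ge>0. \<forall>l\<ge>0. (\<integral>\<omega>. exp (- (l * D r \<omega>)) \<partial>N) = exp (- (r * l powr \<beta>)))"

definition first_passage :: "(real \<Rightarrow> 'v \<Rightarrow> real) \<Rightarrow> real \<Rightarrow> 'v \<Rightarrow> real" where
  "first_passage D t \<omega> = Inf {r. 0 \<le> r \<and> t < D r \<omega>}"

definition first_passage_density ::
  "'v measure \<Rightarrow> (real \<Rightarrow> 'v \<Rightarrow> real) \<Rightarrow> (real \<Rightarrow> real \<Rightarrow> real) \<Rightarrow> bool" where
  "first_passage_density N D fE \<longleftrightarrow>
     (\<lambda>(t, s). fE t s) \<in> borel_measurable (borel \<Otimes>\<^sub>M borel) \<and>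
     (\<forall>t>0. (\<forall>s. 0 \<le> fE t s) \<and>
        distributed N lborel (first_passage D t) (\<lambda>s. ennreal (fE t s)))"

text \<open>
  \<open>G\<^sub>t\<close> may be infinite at the origin, where the Bochner integral then returns \<open>0\<close>. The kernel is
  only ever integrated in the space variable, so this value is irrelevant.
\<close>

definition time_changed_density ::
  "(real \<Rightarrow> 'a::euclidean_space \<Rightarrow> real) \<Rightarrow> (real \<Rightarrow> real \<Rightarrow> real) \<Rightarrow> real \<Rightarrow> 'a \<Rightarrow> real" where
  "time_changed_density p fE t x = (LINT s:{0<..}|lborel. p s x * fE t s)"


section \<open>The spatial correlation\<close>

primrec Ck :: "nat \<Rightarrow> ('a::euclidean_space \<Rightarrow> real) \<Rightarrow> bool" where
  "Ck 0 \<phi> \<longleftrightarrow> continuous_on UNIV \<phi>"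
| "Ck (Suc n) \<phi> \<longleftrightarrow> (\<forall>x. \<phi> differentiable (at x)) \<and>
     (\<forall>b\<in>Basis. Ck n (\<lambda>x. frechet_derivative \<phi> (at x) b))"

definition test_function :: "('a::euclidean_space \<Rightarrow> real) \<Rightarrow> bool" where
  "test_function \<phi> \<longleftrightarrow> (\<forall>n. Ck n \<phi>) \<and> (\<exists>r. \<forall>x. r < norm x \<longrightarrow> \<phi> x = 0)"

definition locally_integrable :: "('a::euclidean_space \<Rightarrow> ennreal) \<Rightarrow> bool" where
  "locally_integrable g \<longleftrightarrow> g \<in> borel_measurable borel \<and>
     (\<forall>C. compact C \<longrightarrow> (\<integral>\<^sup>+x\<in>C. g x \<partial>lborel) < \<infinity>)"

text \<open>
  A locally integrable \<open>g\<close> such as a Riesz kernel is in general not integrable, so its Fourier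
  transform is meant in the sense of distributions:
  \<open>\<integral> g \<phi> = (2\<pi>)\<^sup>-\<^sup>d \<integral> ghat(\<xi>) (\<integral> exp(-i \<xi>\<cdot>x) \<phi>(x) dx) d\<xi>\<close> for all test functions \<open>\<phi>\<close>.
  As \<open>ghat/(1+|\<xi>|\<^sup>\<alpha>)\<close> is integrable, \<open>ghat\<close> is tempered, and this identity says that \<open>g\<close> is
  its inverse Fourier transform.
\<close>

definition dalang_condition :: "real \<Rightarrow> ('a::euclidean_space \<Rightarrow> ennreal) \<Rightarrow> bool" where
  "dalang_condition \<alpha> g \<longleftrightarrow>
     (\<exists>ghat :: 'a \<Rightarrow> complex.
        integrable lborel (\<lambda>\<xi>. ghat \<xi> / complex_of_real (1 + norm \<xi> powr \<alpha>)) \<and>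
        (\<forall>\<phi>. test_function \<phi> \<longrightarrow>
           complex_of_real (\<integral>x. enn2real (g x) * \<phi> x \<partial>lborel) =
           (\<integral>\<xi>. ghat \<xi> *
              (\<integral>x. exp (- (\<i> * complex_of_real (\<xi> \<bullet> x))) * complex_of_real (\<phi> x) \<partial>lborel)
            \<partial>lborel) / complex_of_real ((2 * pi) ^ DIM('a))))"

text \<open>
  Correlations take values in \<open>[0,\<infinity>]\<close>, so that a singular kernel may be infinite on the diagonal.
\<close>

definition spatial_correlation ::
  "real \<Rightarrow> ('a::euclidean_space \<Rightarrow> 'a \<Rightarrow> ennreal) \<Rightarrow> ('a \<Rightarrow> ennreal) \<Rightarrow> bool" where
  "spatial_correlation \<alpha> f g \<longleftrightarrow>
     (\<lambda>(x, y). f x y) \<in> borel_measurable (borel \<Otimes>\<^sub>M borel) \<and>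
     (\<forall>x y. f x y \<le> g (x - y)) \<and> locally_integrable g \<and> dalang_condition \<alpha> g"


section \<open>The noise and the Walsh integral\<close>

definition bounded_borel :: "'a::euclidean_space set set" where
  "bounded_borel = {A \<in> sets borel. bounded A}"

definition centered_gaussian :: "'w measure \<Rightarrow> ('w \<Rightarrow> real) \<Rightarrow> bool" where
  "centered_gaussian M X \<longleftrightarrow>
     (AE \<omega> in M. X \<omega> = 0) \<or>
     (\<exists>s>0. distributed M lborel X (\<lambda>x. ennreal (normal_density 0 s x)))"

text \<open>
  The noise is given by its martingale measure: \<open>F t A\<close> is the noise evaluated on
  \<open>[0,t] \<times> A\<close>. Integrating \<open>\<delta>\<^sub>0(t-s) f(x,y)\<close> over \<open>[0,s] \<times> A\<close> and \<open>[0,t] \<times> B\<close> gives the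
  covariance.
\<close>

definition white_colored_noise ::
  "'w measure \<Rightarrow> ('a::euclidean_space \<Rightarrow> 'a \<Rightarrow> ennreal) \<Rightarrow>
   (real \<Rightarrow> 'a set \<Rightarrow> 'w \<Rightarrow> real) \<Rightarrow> bool" where
  "white_colored_noise M f F \<longleftrightarrow>
     prob_space M \<and>
     (\<forall>t\<ge>0. \<forall>A\<in>bounded_borel. F t A \<in> borel_measurable M) \<and>
     (\<forall>I c. finite I \<longrightarrow> I \<subseteq> {0..} \<times> bounded_borel \<longrightarrow>
        centered_gaussian M (\<lambda>\<omega>. \<Sum>(t, A)\<in>I. c (t, A) * F t A \<omega>)) \<and>
     (\<forall>s\<ge>0. \<forall>t\<ge>0. \<forall>A\<in>bounded_borel. \<forall>B\<in>bounded_borel.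
        (\<integral>\<omega>. F s A \<omega> * F t B \<omega> \<partial>M) =
        min s t * enn2real (\<integral>\<^sup>+x\<in>A. (\<integral>\<^sup>+y\<in>B. f x y \<partial>lborel) \<partial>lborel))"

definition noise_filtration ::
  "'w measure \<Rightarrow> (real \<Rightarrow> 'a::euclidean_space set \<Rightarrow> 'w \<Rightarrow> real) \<Rightarrow> real \<Rightarrow> 'w measure" where
  "noise_filtration M F t = sigma (space M)
     ({F s A -` B \<inter> space M | s A B. 0 \<le> s \<and> s \<le> t \<and> A \<in> bounded_borel \<and> B \<in> sets borel}
      \<union> null_sets M)"

text \<open>
  A list of tuples \<open>(a, b, A, X)\<close> represents the elementary integrand
  \<open>\<Sum> X(\<omega>) 1\<^bsub>(a,b]\<^esub>(s) 1\<^bsub>A\<^esub>(y)\<close>.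
\<close>

type_synonym ('a, 'w) elementary = "(real \<times> real \<times> 'a set \<times> ('w \<Rightarrow> real)) list"

definition elementary ::
  "'w measure \<Rightarrow> (real \<Rightarrow> 'a::euclidean_space set \<Rightarrow> 'w \<Rightarrow> real) \<Rightarrow>
   ('a, 'w) elementary \<Rightarrow> bool" where
  "elementary M F S \<longleftrightarrow>
     (\<forall>(a, b, A, X)\<in>set S. 0 \<le> a \<and> a \<le> b \<and> A \<in> bounded_borel \<and>
        X \<in> borel_measurable (noise_filtration M F a) \<and> (\<exists>c. \<forall>\<omega>\<in>space M. \<bar>X \<omega>\<bar> \<le> c))"

definition elementary_fun :: "('a, 'w) elementary \<Rightarrow> real \<Rightarrow> 'a \<Rightarrow> 'w \<Rightarrow> real" where
  "elementary_fun S s y \<omega> =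
     (\<Sum>(a, b, A, X)\<leftarrow>S. X \<omega> * indicator {a<..b} s * indicator A y)"

definition elementary_integral ::
  "(real \<Rightarrow> 'a set \<Rightarrow> 'w \<Rightarrow> real) \<Rightarrow> real \<Rightarrow> ('a, 'w) elementary \<Rightarrow> 'w \<Rightarrow> real" where
  "elementary_integral F t S \<omega> =
     (\<Sum>(a, b, A, X)\<leftarrow>S. X \<omega> * (F (min b t) A \<omega> - F (min a t) A \<omega>))"

definition walsh_norm_sq ::
  "'w measure \<Rightarrow> ('a::euclidean_space \<Rightarrow> 'a \<Rightarrow> ennreal) \<Rightarrow> real \<Rightarrow>
   (real \<Rightarrow> 'a \<Rightarrow> 'w \<Rightarrow> real) \<Rightarrow> ennreal" where
  "walsh_norm_sq M f t \<Phi> =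
     (\<integral>\<^sup>+\<omega>. (\<integral>\<^sup>+s\<in>{0<..<t}. (\<integral>\<^sup>+y. (\<integral>\<^sup>+z.
        ennreal (\<bar>\<Phi> s y \<omega>\<bar> * \<bar>\<Phi> s z \<omega>\<bar>) * f y z \<partial>lborel) \<partial>lborel) \<partial>lborel) \<partial>M)"

text \<open>
  \<open>Y\<close> is (a version of) \<open>\<integral>\<integral>\<^sub>0\<^sup>t \<Phi>\<^sub>s(y) F(ds dy)\<close>: the integrand lies in the closure of the
  elementary ones in Walsh's norm, and the integral is the corresponding \<open>L\<^sup>2\<close> limit.
\<close>

definition has_walsh_integral ::
  "'w measure \<Rightarrow> ('a::euclidean_space \<Rightarrow> 'a \<Rightarrow> ennreal) \<Rightarrow>
   (real \<Rightarrow> 'a set \<Rightarrow> 'w \<Rightarrow> real) \<Rightarrow> real \<Rightarrow>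
   (real \<Rightarrow> 'a \<Rightarrow> 'w \<Rightarrow> real) \<Rightarrow> ('w \<Rightarrow> real) \<Rightarrow> bool" where
  "has_walsh_integral M f F t \<Phi> Y \<longleftrightarrow>
     (\<lambda>(s, y, \<omega>). \<Phi> s y \<omega>)
        \<in> borel_measurable (restrict_space borel {0<..<t} \<Otimes>\<^sub>M borel \<Otimes>\<^sub>M M) \<and>
     Y \<in> borel_measurable M \<and>
     (\<exists>S. (\<forall>n. elementary M F (S n)) \<and>
        (\<lambda>n. walsh_norm_sq M f t (\<lambda>s y \<omega>. \<Phi> s y \<omega> - elementary_fun (S n) s y \<omega>))
           \<longlonglongrightarrow> 0 \<and>
        (\<lambda>n. \<integral>\<^sup>+\<omega>. ennreal ((Y \<omega> - elementary_integral F t (S n) \<omega>)\<^sup>2) \<partial>M) \<longlonglongrightarrow> 0)"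


section \<open>Mild solutions\<close>

text \<open>
  A random field is a mild solution on the time interval \<open>[0,T)\<close>, where \<open>T = \<infinity>\<close> is allowed. The
  stochastic Caputo equation with the fractional integral in front of the noise is understood in
  this sense.
\<close>

definition mild_solution ::
  "'w measure \<Rightarrow> ('a::euclidean_space \<Rightarrow> 'a \<Rightarrow> ennreal) \<Rightarrow>
   (real \<Rightarrow> 'a set \<Rightarrow> 'w \<Rightarrow> real) \<Rightarrow> (real \<Rightarrow> 'a \<Rightarrow> real) \<Rightarrow> (real \<Rightarrow> real) \<Rightarrow>
   ('a \<Rightarrow> real) \<Rightarrow> ereal \<Rightarrow> (real \<Rightarrow> 'a \<Rightarrow> 'w \<Rightarrow> real) \<Rightarrow> bool" where
  "mild_solution M f F G \<sigma> u0 T u \<longleftrightarrow>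
     (\<lambda>(t, x, \<omega>). u t x \<omega>)
        \<in> borel_measurable (restrict_space borel {t. 0 \<le> t \<and> ereal t < T} \<Otimes>\<^sub>M borel \<Otimes>\<^sub>M M) \<and>
     (\<forall>t x. 0 \<le> t \<longrightarrow> ereal t < T \<longrightarrow> u t x \<in> borel_measurable (noise_filtration M F t)) \<and>
     (\<forall>x. AE \<omega> in M. u 0 x \<omega> = u0 x) \<and>
     (\<forall>t x. 0 < t \<longrightarrow> ereal t < T \<longrightarrow>
        (\<exists>Y. has_walsh_integral M f F t (\<lambda>s y \<omega>. G (t - s) (x - y) * \<sigma> (u s y \<omega>)) Y \<and>
             (AE \<omega> in M. u t x \<omega> = (\<integral>y. G t (x - y) * u0 y \<partial>lborel) + Y \<omega>)))"

end

theory Submission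
  imports Defs
begin

text \<open>
  A mild solution that exists at a time \<open>t\<close> is automatically square integrable there, so it is enough
  to show that no solution with large initial mass survives up to \<open>t0\<close>. By the Walsh isometry the
  correlations \<open>J t y z = E|u t y u t z|\<close> dominate the product of the deterministic parts and, since
  \<open>\<sigma>(x) \<ge> |x|\<^sup>1\<^sup>+\<^sup>\<gamma>\<close> and \<open>f \<ge> Kf\<close> on the ball, also \<open>Kf \<integral> \<integral> \<integral> G G J\<^sup>1\<^sup>+\<^sup>\<gamma>\<close> by Jensen's inequality.
  Starting from a time at which the deterministic part is comparable to the initial mass, this
  superlinear Volterra inequality makes \<open>J\<close> blow up within one unit of time.
\<close>

section \<open>Uniqueness of Fourier transforms along linear families\<close>

text \<open>Correlations at two points are iterated instead of the second moment because the
  isometry for a spatially colored noise returns the mean of \<sigma>(u(v)) \<sigma>(u(w)) with v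
  and w different; a lower bound for all of \<open>J\<close> over the ball is the quantity that
  reproduces itself. Two obstacles shape the rest. The noise is only a Gaussian family with a
  prescribed covariance, so independence of its increments from the filtration, and with it the
  isometry, has to be derived: orthogonality to the past factorises characteristic functions, and
  Fourier uniqueness turns this into independence. Moreover Walsh's norm contains absolute values,
  while positive definiteness of \<open>f\<close> is known only through the covariance of the noise;
  the Cauchy-Schwarz type estimate needed for limits is read off from Gaussian variables for
  nonnegative step functions and extended by monotone convergence. The time unit is shared by two
  bounds: the deterministic part stays large on [t1, t1 + 1], and for time lags up to 1 the kernel
  keeps a fixed amount of mass in the ball.\<close>

lemma norm_iexp_mult [simp]: "norm (w * iexp x) = norm w"
  by (simp add: norm_mult)

lemma integrable_mult_iexp:
  fixes W :: "'b \<Rightarrow> complex"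
  assumes "integrable M W" "X \<in> borel_measurable M"
  shows "integrable M (\<lambda>\<omega>. W \<omega> * iexp (X \<omega>))"
  using assms(1) by (rule Bochner_Integration.integrable_bound) (use assms in auto)

text \<open>The positive and negative parts of \<open>W\<close> have equal total mass (frequency 0).
  Normalized to probability densities and pushed forward along \<open>X\<close>, they have the same
  characteristic function, so \<open>Levy_uniqueness\<close> identifies the two laws.\<close>

lemma fourier_unique_real_weight:
  fixes W :: "'b \<Rightarrow> real"
  assumes W: "integrable M W" and X: "X \<in> borel_measurable M"
    and zero: "\<And>l. (\<integral>\<omega>. complex_of_real (W \<omega>) * iexp (l * X \<omega>) \<partial>M) = 0"
    and B: "B \<in> sets borel"
  shows "(\<integral>\<omega>. W \<omega> * indicator B (X \<omega>) \<partial>M) = 0"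
proof -
  define P where "P = (\<lambda>\<omega>. max (W \<omega>) 0)"
  define Q where "Q = (\<lambda>\<omega>. max (- W \<omega>) 0)"
  have [measurable]: "W \<in> borel_measurable M" "X \<in> borel_measurable M" using W X by auto
  have P: "integrable M P" and Q: "integrable M Q"
    using W by (auto simp: P_def Q_def intro!: integrable_max)
  have [measurable]: "P \<in> borel_measurable M" "Q \<in> borel_measurable M" using P Q by auto
  have P0: "0 \<le> P \<omega>" and Q0: "0 \<le> Q \<omega>" and PQ: "W \<omega> = P \<omega> - Q \<omega>" for \<omega>
    by (auto simp: P_def Q_def max_def)
  have char_eq: "(\<integral>\<omega>. complex_of_real (P \<omega>) * iexp (l * X \<omega>) \<partial>M)
      = (\<integral>\<omega>. complex_of_real (Q \<omega>) * iexp (l * X \<omega>) \<partial>M)" for l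
  proof -
    have "(\<integral>\<omega>. complex_of_real (P \<omega>) * iexp (l * X \<omega>) \<partial>M)
      - (\<integral>\<omega>. complex_of_real (Q \<omega>) * iexp (l * X \<omega>) \<partial>M)
      = (\<integral>\<omega>. complex_of_real (W \<omega>) * iexp (l * X \<omega>) \<partial>M)"
      unfolding PQ of_real_diff left_diff_distrib
      by (rule Bochner_Integration.integral_diff[symmetric]; rule integrable_mult_iexp)
        (use P Q in \<open>auto intro!: integrable_of_real\<close>)
    then show ?thesis using zero[of l] by simp
  qed
  define c where "c = (\<integral>\<omega>. P \<omega> \<partial>M)"
  have cQ: "c = (\<integral>\<omega>. Q \<omega> \<partial>M)"
    using char_eq[of 0] P Q by (simp add: c_def)
  have c0: "0 \<le> c" unfolding c_def by (rule integral_nonneg_AE) (simp add: P0)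
  show ?thesis
  proof (cases "c = 0")
    \<comment> \<open>Total mass 0 cannot be normalized, but then both parts vanish almost
      everywhere.\<close>
    case True
    have "AE \<omega> in M. P \<omega> = 0" "AE \<omega> in M. Q \<omega> = 0"
      using True cQ integral_nonneg_eq_0_iff_AE[OF P] integral_nonneg_eq_0_iff_AE[OF Q] P0 Q0
      by (auto simp: c_def)
    then have "AE \<omega> in M. W \<omega> * indicator B (X \<omega>) = 0" by eventually_elim (simp add: PQ)
    then have "(\<integral>\<omega>. W \<omega> * indicator B (X \<omega>) \<partial>M) = (\<integral>\<omega>. 0 \<partial>M)"
      by (intro integral_cong_AE) (use B in measurable)
    then show ?thesis by simp
  next
    case False
    then have c: "0 < c" using c0 by simp
    define mu where "mu V = distr (density M (\<lambda>\<omega>. ennreal (V \<omega> / c))) borel X" for V :: "'b \<Rightarrow> real"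
    have mu: "real_distribution (mu V)" "char (mu V) = (\<lambda>l. (\<integral>\<omega>. complex_of_real (V \<omega>) * iexp (l * X \<omega>) \<partial>M) / c)"
        "measure (mu V) B = (\<integral>\<omega>. V \<omega> * indicator B (X \<omega>) \<partial>M) / c"
      if V: "integrable M V" "\<And>\<omega>. 0 \<le> V \<omega>" "c = (\<integral>\<omega>. V \<omega> \<partial>M)" for V
    proof -
      have [measurable]: "V \<in> borel_measurable M" using V by auto
      have "(\<integral>\<^sup>+\<omega>. ennreal (V \<omega> / c) \<partial>M) = ennreal (\<integral>\<omega>. V \<omega> / c \<partial>M)"
        by (rule nn_integral_eq_integral) (use V c in auto)
      also have "(\<integral>\<omega>. V \<omega> / c \<partial>M) = 1" using V(3) c by simp
      finally have "prob_space (density M (\<lambda>\<omega>. ennreal (V \<omega> / c)))"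
        by (intro prob_spaceI) (simp add: emeasure_density cong: nn_integral_cong)
      then have "prob_space (mu V)" unfolding mu_def
        by (rule prob_space.prob_space_distr) simp
      then show rd: "real_distribution (mu V)"
        by (auto simp: real_distribution_def real_distribution_axioms_def mu_def)
      show "char (mu V) = (\<lambda>l. (\<integral>\<omega>. complex_of_real (V \<omega>) * iexp (l * X \<omega>) \<partial>M) / c)"
      proof
        fix l
        have "char (mu V) l = (\<integral>\<omega>. (V \<omega> / c) *\<^sub>R iexp (l * X \<omega>) \<partial>M)"
          unfolding char_def mu_def
          by (subst integral_distr, simp, simp, subst integral_density) (use V c in auto)
        also have "\<dots> = (\<integral>\<omega>. complex_of_real (V \<omega>) * iexp (l * X \<omega>) / c \<partial>M)"
          by (intro Bochner_Integration.integral_cong) (auto simp: scaleR_conv_of_real)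
        finally show "char (mu V) l = (\<integral>\<omega>. complex_of_real (V \<omega>) * iexp (l * X \<omega>) \<partial>M) / c" by simp
      qed
      interpret real_distribution "mu V" by (rule rd)
      have "measure (mu V) B = (\<integral>x. indicator B x \<partial>mu V)"
        using B by simp
      also have "\<dots> = (\<integral>\<omega>. (V \<omega> / c) *\<^sub>R indicator B (X \<omega>) \<partial>M)"
        unfolding mu_def by (subst integral_distr, simp, use B in measurable, subst integral_density)
           (use V c B in auto)
      finally show "measure (mu V) B = (\<integral>\<omega>. V \<omega> * indicator B (X \<omega>) \<partial>M) / c" by simp
    qed
    have "mu P = mu Q"
      by (rule Levy_uniqueness) (use mu[OF P P0] mu[OF Q Q0] c_def cQ char_eq in simp_all)
    then have eq: "(\<integral>\<omega>. P \<omega> * indicator B (X \<omega>) \<partial>M) = (\<integral>\<omega>. Q \<omega> * indicator B (X \<omega>) \<partial>M)"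
      using mu(3)[OF P P0 c_def] mu(3)[OF Q Q0 cQ] c by simp
    have i: "integrable M (\<lambda>\<omega>. V \<omega> * indicator B (X \<omega>))" if "integrable M V" for V :: "'b \<Rightarrow> real"
      using that by (rule Bochner_Integration.integrable_bound) (use that B in \<open>auto simp: indicator_def\<close>)
    show ?thesis unfolding PQ left_diff_distrib
      by (subst Bochner_Integration.integral_diff) (use i P Q eq in auto)
  qed
qed

text \<open>The hypothesis, being imposed for all real \<open>l\<close>, is invariant under
  conjugating \<open>W\<close>, because conjugation only flips the sign of \<open>l\<close>. Hence
  it passes to the real and imaginary parts, which are combinations of \<open>W\<close> and its
  conjugate.\<close>

lemma fourier_unique_weight:
  fixes W :: "'b \<Rightarrow> complex"
  assumes W: "integrable M W" and X: "X \<in> borel_measurable M"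
    and zero: "\<And>l. (\<integral>\<omega>. W \<omega> * iexp (l * X \<omega>) \<partial>M) = 0"
    and B: "B \<in> sets borel"
  shows "(\<integral>\<omega>. W \<omega> * indicator B (X \<omega>) \<partial>M) = 0"
proof -
  have [measurable]: "W \<in> borel_measurable M" "X \<in> borel_measurable M" using W X by auto
  have i: "integrable M (\<lambda>\<omega>. W \<omega> * iexp (l * X \<omega>))" for l
    by (rule integrable_mult_iexp) (use W in auto)
  have i': "integrable M (\<lambda>\<omega>. cnj (W \<omega>) * iexp (l * X \<omega>))" for l
    by (rule integrable_mult_iexp) (use W in auto)
  have zero': "(\<integral>\<omega>. cnj (W \<omega>) * iexp (l * X \<omega>) \<partial>M) = 0" for l
  proof -
    have "(\<integral>\<omega>. cnj (W \<omega>) * iexp (l * X \<omega>) \<partial>M) = (\<integral>\<omega>. cnj (W \<omega> * iexp ((-l) * X \<omega>)) \<partial>M)"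
      by (intro Bochner_Integration.integral_cong) (auto simp: exp_cnj)
    also have "\<dots> = cnj (\<integral>\<omega>. W \<omega> * iexp ((-l) * X \<omega>) \<partial>M)"
      using integral_bounded_linear[OF bounded_linear_cnj i[of "- l"]] .
    also have "\<dots> = 0" by (subst zero) simp
    finally show ?thesis .
  qed
  have re: "(\<integral>\<omega>. complex_of_real (Re (W \<omega>)) * iexp (l * X \<omega>) \<partial>M) = 0" for l
  proof -
    have "(\<integral>\<omega>. complex_of_real (Re (W \<omega>)) * iexp (l * X \<omega>) \<partial>M)
       = (\<integral>\<omega>. (W \<omega> * iexp (l * X \<omega>) + cnj (W \<omega>) * iexp (l * X \<omega>)) / 2 \<partial>M)"
      by (intro Bochner_Integration.integral_cong refl)
        (simp add: complex_add_cnj distrib_right[symmetric])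
    then show ?thesis using i i' zero zero' by simp
  qed
  have im: "(\<integral>\<omega>. complex_of_real (Im (W \<omega>)) * iexp (l * X \<omega>) \<partial>M) = 0" for l
  proof -
    have "(\<integral>\<omega>. complex_of_real (Im (W \<omega>)) * iexp (l * X \<omega>) \<partial>M)
       = (\<integral>\<omega>. (W \<omega> * iexp (l * X \<omega>) - cnj (W \<omega>) * iexp (l * X \<omega>)) / (2 * \<i>) \<partial>M)"
    proof (intro Bochner_Integration.integral_cong refl)
      fix \<omega>
      have "W \<omega> - cnj (W \<omega>) = 2 * \<i> * complex_of_real (Im (W \<omega>))"
        by (simp add: complex_eq_iff)
      then show "complex_of_real (Im (W \<omega>)) * iexp (l * X \<omega>)
        = (W \<omega> * iexp (l * X \<omega>) - cnj (W \<omega>) * iexp (l * X \<omega>)) / (2 * \<i>)"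
        unfolding left_diff_distrib[symmetric] by simp
    qed
    then show ?thesis using i i' zero zero' by simp
  qed
  have iB: "integrable M (\<lambda>\<omega>. W \<omega> * indicator B (X \<omega>))"
    using W by (rule Bochner_Integration.integrable_bound)
      (use W B in \<open>auto simp: indicator_def norm_mult\<close>)
  have R: "Re (W \<omega> * indicator B (X \<omega>)) = Re (W \<omega>) * indicator B (X \<omega>)"
    and I: "Im (W \<omega> * indicator B (X \<omega>)) = Im (W \<omega>) * indicator B (X \<omega>)" for \<omega>
    by (auto simp: indicator_def)
  show ?thesis
  proof (rule complex_eqI)
    show "Re (\<integral>\<omega>. W \<omega> * indicator B (X \<omega>) \<partial>M) = Re 0"
      using fourier_unique_real_weight[OF integrable_Re[OF W] X re B] integral_Re[OF iB]
      unfolding R by simp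
    show "Im (\<integral>\<omega>. W \<omega> * indicator B (X \<omega>) \<partial>M) = Im 0"
      using fourier_unique_real_weight[OF integrable_Im[OF W] X im B] integral_Im[OF iB]
      unfolding I by simp
  qed
qed

text \<open>Integrability belongs to the predicate because the Bochner integral of a function that
  is not integrable is 0, which would let such weights satisfy the second clause. Weights are
  complex so that a factor exp(iZ) can be absorbed into them.\<close>

definition fourier_null :: "'b measure \<Rightarrow> ('b \<Rightarrow> real) set \<Rightarrow> ('b \<Rightarrow> complex) \<Rightarrow> bool" where
  "fourier_null M V W \<longleftrightarrow> integrable M W \<and> (\<forall>Z\<in>V. (\<integral>\<omega>. W \<omega> * iexp (Z \<omega>) \<partial>M) = 0)"

text \<open>
  The one-dimensional theorem applied to the weight \<open>W exp(iZ)\<close> shows that multiplying by the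
  indicator of \<open>X\<^sup>-\<^sup>1(B)\<close> keeps a weight in \<open>fourier_null\<close>. The events with this property form a
  sigma-algebra, so no multivariate inversion formula is needed.
\<close>

lemma fourier_null_indicator:
  fixes W :: "'b \<Rightarrow> complex"
  assumes V: "\<And>Z. Z \<in> V \<Longrightarrow> Z \<in> borel_measurable M"
    and add: "\<And>Z X l. Z \<in> V \<Longrightarrow> X \<in> V \<Longrightarrow> (\<lambda>\<omega>. Z \<omega> + l * X \<omega>) \<in> V"
    and A: "A \<in> sigma_sets (space M) {X -` B \<inter> space M | X B. X \<in> V \<and> B \<in> sets borel}"
    and W: "fourier_null M V W"
  shows "fourier_null M V (\<lambda>\<omega>. indicator A \<omega> * W \<omega>)"
proof -
  let ?n = "fourier_null M V"
  have integ: "integrable M (\<lambda>\<omega>. indicator A \<omega> * W \<omega>)" if "A \<in> sets M" "integrable M W"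
    for A and W :: "'b \<Rightarrow> complex"
    using that(2) by (rule Bochner_Integration.integrable_bound)
      (use that in \<open>auto simp: indicator_def\<close>)
  have diff: "?n (\<lambda>\<omega>. W1 \<omega> - W2 \<omega>)" if "?n W1" "?n W2" for W1 W2
    using that V unfolding fourier_null_def left_diff_distrib
    by (auto simp: Bochner_Integration.integral_diff integrable_mult_iexp)
  have cong: "?n W2" if "?n W1" "\<And>\<omega>. \<omega> \<in> space M \<Longrightarrow> W1 \<omega> = W2 \<omega>" for W1 W2
    using that unfolding fourier_null_def
    by (metis (no_types, lifting) Bochner_Integration.integrable_cong Bochner_Integration.integral_cong)
  define good where "good A \<longleftrightarrow> A \<in> sets M \<and> (\<forall>W. ?n W \<longrightarrow> ?n (\<lambda>\<omega>. indicator A \<omega> * W \<omega>))" for A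
  have zero: "?n (\<lambda>_. 0)" by (simp add: fourier_null_def)
  have compl: "good (space M - A)" if "good A" for A
    unfolding good_def
  proof (intro conjI allI impI)
    show "space M - A \<in> sets M" using that by (auto simp: good_def)
    fix W assume "?n W"
    then have "?n (\<lambda>\<omega>. W \<omega> - indicator A \<omega> * W \<omega>)" using that diff by (auto simp: good_def)
    then show "?n (\<lambda>\<omega>. indicator (space M - A) \<omega> * W \<omega>)"
      by (rule cong) (auto simp: indicator_def)
  qed
  have inter: "good (A \<inter> B)" if "good A" "good B" for A B
    unfolding good_def
  proof (intro conjI allI impI)
    show "A \<inter> B \<in> sets M" using that by (auto simp: good_def)
    fix W assume "?n W"
    then have "?n (\<lambda>\<omega>. indicator A \<omega> * (indicator B \<omega> * W \<omega>))" using that by (auto simp: good_def)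
    then show "?n (\<lambda>\<omega>. indicator (A \<inter> B) \<omega> * W \<omega>)" by (rule cong) (auto simp: indicator_def)
  qed
  have sub: "A \<subseteq> space M" if "good A" for A using that sets.sets_into_space by (auto simp: good_def)
  have union: "good (A \<union> B)" if "good A" "good B" for A B
  proof -
    have "A \<union> B = space M - ((space M - A) \<inter> (space M - B))" using sub that by blast
    then show ?thesis using that compl inter by simp
  qed
  have empty: "good {}" using zero by (simp add: good_def)
  have Union: "good (\<Union>i. A i)" if "\<And>i. good (A i)" for A :: "nat \<Rightarrow> 'b set"
    unfolding good_def
  proof (intro conjI allI impI)
    have [measurable]: "A i \<in> sets M" for i using that by (auto simp: good_def)
    show "(\<Union>i. A i) \<in> sets M" by auto
    fix W assume W: "?n W"
    have [measurable]: "W \<in> borel_measurable M" using W by (auto simp: fourier_null_def)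
    \<comment> \<open>\<open>good\<close> is closed under finite unions; the partial unions increase
      to the full one, and dominated convergence with bound \<open>norm (W \<omega>)\<close> carries
      the vanishing integrals over.\<close>
    have fin: "good (\<Union>i<n. A i)" for n
      by (induction n) (simp_all add: empty lessThan_Suc union that)
    show "?n (\<lambda>\<omega>. indicator (\<Union>i. A i) \<omega> * W \<omega>)"
      unfolding fourier_null_def
    proof (intro conjI ballI)
      show "integrable M (\<lambda>\<omega>. indicator (\<Union>i. A i) \<omega> * W \<omega>)"
        by (rule integ) (use W in \<open>auto simp: fourier_null_def\<close>)
      fix Z assume Z: "Z \<in> V"
      have [measurable]: "Z \<in> borel_measurable M" using V Z by auto
      have "(\<lambda>n. \<integral>\<omega>. indicator (\<Union>i<n. A i) \<omega> * W \<omega> * iexp (Z \<omega>) \<partial>M)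
         \<longlonglongrightarrow> (\<integral>\<omega>. indicator (\<Union>i. A i) \<omega> * W \<omega> * iexp (Z \<omega>) \<partial>M)"
      proof (rule integral_dominated_convergence[where w="\<lambda>\<omega>. norm (W \<omega>)"])
        show "integrable M (\<lambda>\<omega>. norm (W \<omega>))" using W by (auto simp: fourier_null_def)
        show "AE \<omega> in M. (\<lambda>n. indicator (\<Union>i<n. A i) \<omega> * W \<omega> * iexp (Z \<omega>))
           \<longlonglongrightarrow> indicator (\<Union>i. A i) \<omega> * W \<omega> * iexp (Z \<omega>)"
        proof (rule AE_I2)
          fix \<omega>
          have "(\<lambda>n. indicator (\<Union>i<n. A i) \<omega> :: complex) \<longlonglongrightarrow> indicator (\<Union>i. A i) \<omega>"
            by (rule LIMSEQ_indicator_UN)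
          then show "(\<lambda>n. indicator (\<Union>i<n. A i) \<omega> * W \<omega> * iexp (Z \<omega>))
             \<longlonglongrightarrow> indicator (\<Union>i. A i) \<omega> * W \<omega> * iexp (Z \<omega>)" by (intro tendsto_intros)
        qed
        show "\<And>n. AE \<omega> in M. norm (indicator (\<Union>i<n. A i) \<omega> * W \<omega> * iexp (Z \<omega>)) \<le> norm (W \<omega>)"
          by (auto simp: indicator_def)
      qed auto
      moreover have "(\<integral>\<omega>. indicator (\<Union>i<n. A i) \<omega> * W \<omega> * iexp (Z \<omega>) \<partial>M) = 0" for n
        using fin[of n] W Z by (auto simp: good_def fourier_null_def)
      ultimately show "(\<integral>\<omega>. indicator (\<Union>i. A i) \<omega> * W \<omega> * iexp (Z \<omega>) \<partial>M) = 0"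
        by (simp add: LIMSEQ_const_iff)
    qed
  qed
  have basic: "good (X -` B \<inter> space M)" if X: "X \<in> V" and B: "B \<in> sets borel" for X B
    unfolding good_def
  proof (intro conjI allI impI)
    have [measurable]: "X \<in> borel_measurable M" using V X by auto
    show "X -` B \<inter> space M \<in> sets M" using B by measurable
    fix W assume W: "?n W"
    have iW: "integrable M W" using W by (auto simp: fourier_null_def)
    have "(\<integral>\<omega>. indicator (X -` B \<inter> space M) \<omega> * W \<omega> * iexp (Z \<omega>) \<partial>M) = 0" if Z: "Z \<in> V" for Z
    proof -
      \<comment> \<open>Closure of \<open>V\<close> under \<open>Z + l * X\<close> enters here: the
        product of the two exponentials is again the exponential of a member of
        \<open>V\<close>.\<close>
      have "(\<integral>\<omega>. W \<omega> * iexp (Z \<omega>) * iexp (l * X \<omega>) \<partial>M) = 0" for l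
        using W add[OF Z X, of l] by (auto simp: fourier_null_def exp_add distrib_left mult.assoc)
      from fourier_unique_weight[OF integrable_mult_iexp[OF iW V[OF Z]] V[OF X] this B]
      have "(\<integral>\<omega>. W \<omega> * iexp (Z \<omega>) * indicator B (X \<omega>) \<partial>M) = 0" .
      moreover have "(\<integral>\<omega>. W \<omega> * iexp (Z \<omega>) * indicator B (X \<omega>) \<partial>M)
        = (\<integral>\<omega>. indicator (X -` B \<inter> space M) \<omega> * W \<omega> * iexp (Z \<omega>) \<partial>M)"
        by (intro Bochner_Integration.integral_cong) (auto simp: indicator_def)
      ultimately show ?thesis by simp
    qed
    moreover have "integrable M (\<lambda>\<omega>. indicator (X -` B \<inter> space M) \<omega> * W \<omega>)"
      by (rule integ) (use iW B in auto)
    ultimately show "?n (\<lambda>\<omega>. indicator (X -` B \<inter> space M) \<omega> * W \<omega>)"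
      by (auto simp: fourier_null_def)
  qed
  have "good A" using A
  proof induction
    case (Basic a) then show ?case using basic by blast
  qed (use empty compl Union in auto)
  then show ?thesis using W by (auto simp: good_def)
qed

text \<open>The linear functionals form a class \<open>V\<close> as in
  \<open>fourier_null_indicator\<close>, and half-spaces, which are preimages under them, generate
  the Borel sets. So \<open>h\<close> integrates to 0 over every Borel set.\<close>

lemma fourier_unique_lborel:
  fixes h :: "'a::euclidean_space \<Rightarrow> real"
  assumes h: "integrable lborel h"
    and zero: "\<And>\<xi>. (\<integral>x. complex_of_real (h x) * iexp (\<xi> \<bullet> x) \<partial>lborel) = 0"
  shows "AE x in lborel. h x = 0"
proof -
  define V where "V = range (\<lambda>\<xi> x :: 'a. \<xi> \<bullet> x)"
  have null: "fourier_null lborel V (\<lambda>x. complex_of_real (h x))"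
    using h zero by (auto simp: fourier_null_def V_def)
  let ?G = "{X -` B \<inter> space lborel | X B. X \<in> V \<and> B \<in> sets (borel :: real measure)}"
  have sub: "sets (borel :: 'a measure) \<subseteq> sigma_sets UNIV ?G"
  proof -
    have "(\<lambda>(a, i). {x::'a. a < x \<bullet> i}) ` (UNIV \<times> Basis) \<subseteq> ?G"
    proof safe
      fix a :: real and i :: 'a
      have "{x. a < x \<bullet> i} = (\<lambda>x. i \<bullet> x) -` {a<..} \<inter> space lborel" by (auto simp: inner_commute)
      moreover have "(\<lambda>x. i \<bullet> x) \<in> V" by (simp add: V_def)
      ultimately show "\<exists>X B. {x. a < x \<bullet> i} = X -` B \<inter> space lborel \<and> X \<in> V \<and> B \<in> sets borel"
        by (intro exI[of _ "\<lambda>x. i \<bullet> x"] exI[of _ "{a<..}"]) auto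
    qed
    from sigma_sets_mono'[OF this, of UNIV] show ?thesis
      by (subst borel_eq_halfspace_greater, subst sets_measure_of) simp_all
  qed
  have "set_lebesgue_integral lborel A h = 0" if A: "A \<in> sets lborel" for A
  proof -
    have "fourier_null lborel V (\<lambda>x. indicator A x * complex_of_real (h x))"
    proof (rule fourier_null_indicator[OF _ _ _ null])
      have "A \<in> sigma_sets UNIV ?G" by (rule subsetD[OF sub]) (use A in simp)
      then show "A \<in> sigma_sets (space lborel) ?G" by (simp only: space_lborel space_borel)
      show "\<And>Z X l. Z \<in> V \<Longrightarrow> X \<in> V \<Longrightarrow> (\<lambda>\<omega>. Z \<omega> + l * X \<omega>) \<in> V"
      proof -
        fix Z X :: "'a \<Rightarrow> real" and l assume "Z \<in> V" "X \<in> V"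
        then obtain a b where "Z = (\<lambda>x. a \<bullet> x)" "X = (\<lambda>x. b \<bullet> x)" by (auto simp: V_def)
        then have "(\<lambda>x. Z x + l * X x) = (\<lambda>x. (a + l *\<^sub>R b) \<bullet> x)" by (simp add: inner_add_left)
        moreover have "(\<lambda>x. (a + l *\<^sub>R b) \<bullet> x) \<in> V" unfolding V_def by (rule rangeI)
        ultimately show "(\<lambda>x. Z x + l * X x) \<in> V" by (simp only:)
      qed
      show "\<And>Z. Z \<in> V \<Longrightarrow> Z \<in> borel_measurable lborel" by (auto simp: V_def)
    qed
    \<comment> \<open>The zero functional turns the exponential into 1, leaving the plain integral
      over \<open>A\<close>.\<close>
    moreover have "(\<lambda>x. (0::'a) \<bullet> x) \<in> V" unfolding V_def by (rule rangeI)
    ultimately have "(\<integral>x. indicator A x * complex_of_real (h x) * iexp ((0::'a) \<bullet> x) \<partial>lborel) = 0"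
      unfolding fourier_null_def by blast
    then have "(\<integral>x. complex_of_real (indicator A x * h x) \<partial>lborel) = 0"
      by (simp add: of_real_indicator)
    then have "complex_of_real (\<integral>x. indicator A x * h x \<partial>lborel) = 0"
      unfolding integral_complex_of_real .
    then show ?thesis by (simp add: set_lebesgue_integral_def)
  qed
  then show ?thesis
    using sigma_finite_measure.density_zero[OF sigma_finite_lborel h] by simp
qed

section \<open>The noise\<close>

lemma centered_gaussian_moments:
  assumes "prob_space M" and X: "X \<in> borel_measurable M" and G: "centered_gaussian M X"
  shows "integrable M (\<lambda>\<omega>. (X \<omega>)\<^sup>2)" "integrable M X" "(\<integral>\<omega>. X \<omega> \<partial>M) = 0"
    "(\<integral>\<omega>. iexp (X \<omega>) \<partial>M) = complex_of_real (exp (- (\<integral>\<omega>. (X \<omega>)\<^sup>2 \<partial>M) / 2))"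
proof -
  interpret prob_space M by fact
  have "integrable M (\<lambda>\<omega>. (X \<omega>)\<^sup>2) \<and> (\<integral>\<omega>. X \<omega> \<partial>M) = 0 \<and>
    (\<integral>\<omega>. iexp (X \<omega>) \<partial>M) = complex_of_real (exp (- (\<integral>\<omega>. (X \<omega>)\<^sup>2 \<partial>M) / 2))"
  proof (cases "AE \<omega> in M. X \<omega> = 0")
    case True
    have 1: "(\<integral>\<omega>. iexp (X \<omega>) \<partial>M) = (\<integral>\<omega>. 1 \<partial>M)"
      by (rule integral_cong_AE) (use True X in auto)
    have 2: "(\<integral>\<omega>. (X \<omega>)\<^sup>2 \<partial>M) = (\<integral>\<omega>. 0 \<partial>M)" "(\<integral>\<omega>. X \<omega> \<partial>M) = (\<integral>\<omega>. 0 \<partial>M)"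
      by (rule integral_cong_AE; use True X in auto)+
    have "integrable M (\<lambda>\<omega>. (X \<omega>)\<^sup>2) \<longleftrightarrow> integrable M (\<lambda>\<omega>. 0 :: real)"
      by (rule integrable_cong_AE) (use True X in auto)
    with 1 2 show ?thesis by (simp add: prob_space)
  next
    case False
    then obtain s where s: "0 < s" and D: "distributed M lborel X (\<lambda>x. ennreal (normal_density 0 s x))"
      using G by (auto simp: centered_gaussian_def)
    have E0: "(\<integral>\<omega>. X \<omega> \<partial>M) = 0" by (rule normal_distributed_expectation[OF s D])
    have V: "(\<integral>\<omega>. (X \<omega>)\<^sup>2 \<partial>M) = s\<^sup>2"
      using normal_distributed_variance[OF s D] E0 by simp
    \<comment> \<open>A function that is not integrable has Bochner integral 0, so the nonzero
      variance proves integrability.\<close>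
    have "integrable M (\<lambda>\<omega>. (X \<omega>)\<^sup>2)"
      using V s not_integrable_integral_eq[of M "\<lambda>\<omega>. (X \<omega>)\<^sup>2"] by fastforce
    moreover have "(\<integral>\<omega>. iexp (X \<omega>) \<partial>M) = complex_of_real (exp (- s\<^sup>2 / 2))"
    proof -
      have "distributed M lborel (\<lambda>\<omega>. X \<omega> / s) (\<lambda>x. ennreal (std_normal_density x))"
        using normal_standard_normal_convert[of s X 0] s D by simp
      then have "distr M lborel (\<lambda>\<omega>. X \<omega> / s) = std_normal_distribution"
        by (simp add: distributed_distr_eq_density)
      then have "char (distr M lborel (\<lambda>\<omega>. X \<omega> / s)) s = complex_of_real (exp (- s\<^sup>2 / 2))"
        by (simp add: char_std_normal_distribution)
      moreover have "char (distr M lborel (\<lambda>\<omega>. X \<omega> / s)) s = (\<integral>\<omega>. iexp (s * (X \<omega> / s)) \<partial>M)"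
        unfolding char_def by (subst integral_distr) (use X in auto)
      ultimately show ?thesis using s by simp
    qed
    ultimately show ?thesis using E0 V by simp
  qed
  then show "integrable M (\<lambda>\<omega>. (X \<omega>)\<^sup>2)" "(\<integral>\<omega>. X \<omega> \<partial>M) = 0"
    "(\<integral>\<omega>. iexp (X \<omega>) \<partial>M) = complex_of_real (exp (- (\<integral>\<omega>. (X \<omega>)\<^sup>2 \<partial>M) / 2))" by auto
  then show "integrable M X"
    using square_integrable_imp_integrable[OF X] by simp
qed

lemma integrable_mult_of_squares:
  fixes X Y :: "'b \<Rightarrow> real"
  assumes "X \<in> borel_measurable M" "Y \<in> borel_measurable M"
    and "integrable M (\<lambda>\<omega>. (X \<omega>)\<^sup>2)" "integrable M (\<lambda>\<omega>. (Y \<omega>)\<^sup>2)"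
  shows "integrable M (\<lambda>\<omega>. X \<omega> * Y \<omega>)"
proof (rule Bochner_Integration.integrable_bound)
  show "integrable M (\<lambda>\<omega>. (X \<omega>)\<^sup>2 + (Y \<omega>)\<^sup>2)" using assms by auto
  have "\<bar>x * y\<bar> \<le> \<bar>x\<^sup>2 + y\<^sup>2\<bar>" for x y :: real
  proof -
    have "2 * \<bar>x * y\<bar> \<le> x\<^sup>2 + y\<^sup>2"
      using sum_squares_bound[of "\<bar>x\<bar>" "\<bar>y\<bar>"] by (simp add: abs_mult)
    then show ?thesis by simp
  qed
  then show "AE \<omega> in M. norm (X \<omega> * Y \<omega>) \<le> norm ((X \<omega>)\<^sup>2 + (Y \<omega>)\<^sup>2)" by simp
qed (use assms in measurable)

lemma integrable_bounded_mult:
  fixes X Y :: "'b \<Rightarrow> real"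
  assumes X: "integrable M X" and Y: "Y \<in> borel_measurable M"
    and b: "\<And>\<omega>. \<omega> \<in> space M \<Longrightarrow> \<bar>Y \<omega>\<bar> \<le> c"
  shows "integrable M (\<lambda>\<omega>. Y \<omega> * X \<omega>)"
proof (rule Bochner_Integration.integrable_bound)
  show "integrable M (\<lambda>\<omega>. c * X \<omega>)" using X by auto
  show "AE \<omega> in M. norm (Y \<omega> * X \<omega>) \<le> norm (c * X \<omega>)"
  proof (rule AE_I2)
    fix \<omega> assume "\<omega> \<in> space M"
    then have "\<bar>Y \<omega>\<bar> \<le> \<bar>c\<bar>" using b by fastforce
    then show "norm (Y \<omega> * X \<omega>) \<le> norm (c * X \<omega>)" by (simp add: abs_mult mult_right_mono)
  qed
qed (use assms in measurable)

text \<open>A substitute for the Cauchy-Schwarz inequality that is linear in the squares, so it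
  integrates term by term and keeps its meaning for infinite integrals. Completing the square gives
  1/(4k), rounded up to 1/k to make the bound symmetric under exchanging the factors together with
  \<open>k\<close> and \<open>1 / k\<close>.\<close>

lemma mult_le_weighted_squares:
  fixes a b k :: real
  assumes k: "0 < k"
  shows "a * b \<le> k * a\<^sup>2 + 1 / k * b\<^sup>2"
proof -
  have "0 \<le> k * (a - b / (2 * k))\<^sup>2" using k by simp
  also have "\<dots> = k * a\<^sup>2 - a * b + 1 / (4 * k) * b\<^sup>2"
    using k by (simp add: power2_eq_square field_simps)
  finally have "a * b \<le> k * a\<^sup>2 + 1 / (4 * k) * b\<^sup>2" by simp
  also have "1 / (4 * k) * b\<^sup>2 \<le> 1 / k * b\<^sup>2"
    using k by (intro mult_right_mono) (auto simp: field_simps)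
  finally show ?thesis by simp
qed

section \<open>Gaussian spans of the noise\<close>

locale noise =
  fixes M :: "'w measure" and f :: "'a::euclidean_space \<Rightarrow> 'a \<Rightarrow> ennreal"
    and F :: "real \<Rightarrow> 'a set \<Rightarrow> 'w \<Rightarrow> real"
  assumes noise: "white_colored_noise M f F"
begin

sublocale prob_space M using noise by (simp add: white_colored_noise_def)

text \<open>The spatial part of the covariance. \<open>enn2real\<close> would send an infinite
  double integral to 0; \<open>f_integral_eq_q\<close> excludes this for bounded sets under a
  spatial correlation.\<close>

definition q :: "'a set \<Rightarrow> 'a set \<Rightarrow> real" where
  "q A B = enn2real (\<integral>\<^sup>+x\<in>A. (\<integral>\<^sup>+y\<in>B. f x y \<partial>lborel) \<partial>lborel)"

lemma F_measurable [measurable]: "0 \<le> t \<Longrightarrow> A \<in> bounded_borel \<Longrightarrow> F t A \<in> borel_measurable M"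
  using noise by (simp add: white_colored_noise_def)

lemma F_cov:
  "0 \<le> s \<Longrightarrow> 0 \<le> t \<Longrightarrow> A \<in> bounded_borel \<Longrightarrow> B \<in> bounded_borel \<Longrightarrow>
    (\<integral>\<omega>. F s A \<omega> * F t B \<omega> \<partial>M) = min s t * q A B"
  using noise by (simp add: white_colored_noise_def q_def)

text \<open>The form in which \<open>white_colored_noise\<close> asserts Gaussianity, with the times
  restricted to \<open>S\<close>. Since the span is linear, its members are jointly
  Gaussian.\<close>

definition gspan :: "real set \<Rightarrow> ('w \<Rightarrow> real) set" where
  "gspan S = {\<lambda>\<omega>. \<Sum>(t, A)\<in>I. c (t, A) * F t A \<omega> | I c. finite I \<and> I \<subseteq> S \<times> bounded_borel}"

lemma gspan_mono: "S \<subseteq> T \<Longrightarrow> gspan S \<subseteq> gspan T"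
  unfolding gspan_def by blast

lemma gspan_F: "t \<in> S \<Longrightarrow> A \<in> bounded_borel \<Longrightarrow> F t A \<in> gspan S"
  unfolding gspan_def by (intro CollectI exI[of _ "{(t, A)}"] exI[of _ "\<lambda>_. 1"]) auto

lemma gspan_0: "(\<lambda>_. 0) \<in> gspan S"
  unfolding gspan_def by (intro CollectI exI[of _ "{}"]) auto

lemma gspan_add:
  assumes "X \<in> gspan S" "Y \<in> gspan S"
  shows "(\<lambda>\<omega>. X \<omega> + l * Y \<omega>) \<in> gspan S"
proof -
  obtain I c where I: "finite I" "I \<subseteq> S \<times> bounded_borel"
    and X: "X = (\<lambda>\<omega>. \<Sum>p\<in>I. c p * F (fst p) (snd p) \<omega>)"
    using assms(1) unfolding gspan_def by (auto simp: case_prod_unfold)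
  obtain J d where J: "finite J" "J \<subseteq> S \<times> bounded_borel"
    and Y: "Y = (\<lambda>\<omega>. \<Sum>p\<in>J. d p * F (fst p) (snd p) \<omega>)"
    using assms(2) unfolding gspan_def by (auto simp: case_prod_unfold)
  define e where "e p = (if p \<in> I then c p else 0) + l * (if p \<in> J then d p else 0)" for p
  have "X \<omega> + l * Y \<omega> = (\<Sum>p\<in>I \<union> J. e p * F (fst p) (snd p) \<omega>)" for \<omega>
  proof -
    have "X \<omega> = (\<Sum>p\<in>I \<union> J. (if p \<in> I then c p else 0) * F (fst p) (snd p) \<omega>)"
      unfolding X by (rule sum.mono_neutral_cong_left) (use I J in auto)
    moreover have "Y \<omega> = (\<Sum>p\<in>I \<union> J. (if p \<in> J then d p else 0) * F (fst p) (snd p) \<omega>)"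
      unfolding Y by (rule sum.mono_neutral_cong_left) (use I J in auto)
    ultimately show ?thesis
      by (simp add: e_def distrib_right sum.distrib sum_distrib_left mult.assoc)
  qed
  then have eq: "(\<lambda>\<omega>. X \<omega> + l * Y \<omega>) = (\<lambda>\<omega>. \<Sum>(t, A)\<in>I \<union> J. e (t, A) * F t A \<omega>)"
    by (simp add: case_prod_unfold)
  show ?thesis unfolding eq unfolding gspan_def using I J
    by (intro CollectI exI[of _ "I \<union> J"] exI[of _ e]) auto
qed

lemma gspan_gaussian: "X \<in> gspan {0..} \<Longrightarrow> centered_gaussian M X"
  using noise unfolding gspan_def white_colored_noise_def by blast

lemma gspan_measurable: "X \<in> gspan {0..} \<Longrightarrow> X \<in> borel_measurable M"
  unfolding gspan_def
proof (clarsimp simp: case_prod_unfold)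
  fix I :: "(real \<times> 'a set) set" and c assume "finite I" "I \<subseteq> {0..} \<times> bounded_borel"
  then show "(\<lambda>\<omega>. \<Sum>p\<in>I. c p * F (fst p) (snd p) \<omega>) \<in> borel_measurable M"
    by (intro borel_measurable_sum borel_measurable_times F_measurable) auto
qed

lemma gspan_moments:
  assumes "X \<in> gspan {0..}"
  shows "integrable M (\<lambda>\<omega>. (X \<omega>)\<^sup>2)" "integrable M X" "(\<integral>\<omega>. X \<omega> \<partial>M) = 0"
    "(\<integral>\<omega>. iexp (X \<omega>) \<partial>M) = complex_of_real (exp (- (\<integral>\<omega>. (X \<omega>)\<^sup>2 \<partial>M) / 2))"
  using centered_gaussian_moments[OF prob_space_axioms gspan_measurable gspan_gaussian] assms by blast+

lemma gspan_mult_integrable: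
  "X \<in> gspan {0..} \<Longrightarrow> Y \<in> gspan {0..} \<Longrightarrow> integrable M (\<lambda>\<omega>. X \<omega> * Y \<omega>)"
  by (rule integrable_mult_of_squares) (auto intro: gspan_measurable gspan_moments)

section \<open>The completed filtration and the independence of the future from it\<close>

lemma sets_noise_filtration:
  "sets (noise_filtration M F t) = sigma_sets (space M)
     ({F s A -` B \<inter> space M | s A B. 0 \<le> s \<and> s \<le> t \<and> A \<in> bounded_borel \<and> B \<in> sets borel} \<union> null_sets M)"
  unfolding noise_filtration_def by (rule sets_measure_of) (auto dest: sets.sets_into_space)

lemma space_noise_filtration [simp]: "space (noise_filtration M F t) = space M"
  unfolding noise_filtration_def by (rule space_measure_of) (auto dest: sets.sets_into_space)

lemma noise_filtration_mono: "s \<le> t \<Longrightarrow> sets (noise_filtration M F s) \<subseteq> sets (noise_filtration M F t)"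
  unfolding sets_noise_filtration by (rule sigma_sets_mono') fastforce

lemma noise_filtration_sub: "sets (noise_filtration M F t) \<subseteq> sets M"
  unfolding sets_noise_filtration by (rule sets.sigma_sets_subset) auto

lemma measurable_noise_filtration_mono:
  "s \<le> t \<Longrightarrow> X \<in> borel_measurable (noise_filtration M F s) \<Longrightarrow> X \<in> borel_measurable (noise_filtration M F t)"
  using noise_filtration_mono[of s t] by (auto simp: measurable_def)

lemma measurable_noise_filtration:
  "X \<in> borel_measurable (noise_filtration M F s) \<Longrightarrow> X \<in> borel_measurable M"
  using noise_filtration_sub[of s] by (auto simp: measurable_def)

lemma F_adapted: "0 \<le> s \<Longrightarrow> s \<le> t \<Longrightarrow> A \<in> bounded_borel \<Longrightarrow> F s A \<in> borel_measurable (noise_filtration M F t)"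
proof (rule measurableI)
  fix B :: "real set" assume "0 \<le> s" "s \<le> t" "A \<in> bounded_borel" "B \<in> sets borel"
  then show "F s A -` B \<inter> space (noise_filtration M F t) \<in> sets (noise_filtration M F t)"
    unfolding sets_noise_filtration by (simp, intro sigma_sets.Basic) blast
qed simp

text \<open>Equality to a member of the span is required only almost everywhere: the filtration
  contains all null sets, and the indicator of a null set qualifies through the member 0.\<close>

definition past :: "real \<Rightarrow> ('w \<Rightarrow> real) set" where
  "past a = {Z \<in> borel_measurable M. \<exists>Z'\<in>gspan {0..a}. AE \<omega> in M. Z \<omega> = Z' \<omega>}"

lemma filtration_sub_past:
  "sets (noise_filtration M F a) \<subseteq> sigma_sets (space M) {X -` B \<inter> space M | X B. X \<in> past a \<and> B \<in> sets borel}"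
  unfolding sets_noise_filtration
proof (rule sigma_sets_mono', safe)
  fix s and A :: "'a set" and B assume "0 \<le> s" "s \<le> a" "A \<in> bounded_borel" "B \<in> sets (borel :: real measure)"
  moreover from this have "F s A \<in> past a"
    unfolding past_def by (auto intro!: bexI[of _ "F s A"] gspan_F)
  ultimately show "\<exists>X Ba. F s A -` B \<inter> space M = X -` Ba \<inter> space M \<and> X \<in> past a \<and> Ba \<in> sets borel"
    by blast
next
  fix A assume A: "A \<in> null_sets M"
  have "AE \<omega> in M. indicator A \<omega> = (0::real)"
    using AE_not_in[OF A] by eventually_elim simp
  then have "indicator A \<in> past a"
    unfolding past_def using A gspan_0[of "{0..a}"] by (auto intro!: bexI[of _ "\<lambda>_. 0"] borel_measurable_indicator)
  moreover have "A = indicator A -` {1::real} \<inter> space M"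
    using A sets.sets_into_space by (fastforce simp: indicator_def)
  ultimately show "\<exists>X B. A = X -` B \<inter> space M \<and> X \<in> past a \<and> B \<in> sets borel"
    by (intro exI[of _ "indicator A"] exI[of _ "{1}"]) auto
qed

text \<open>The orthogonal complement of the past inside the Gaussian space; for jointly Gaussian
  variables orthogonality amounts to independence.\<close>

definition future :: "real \<Rightarrow> ('w \<Rightarrow> real) set" where
  "future a = {X \<in> gspan {0..}. \<forall>Z\<in>gspan {0..a}. (\<integral>\<omega>. Z \<omega> * X \<omega> \<partial>M) = 0}"

text \<open>For \<open>Z\<close> in the past, the variance of \<open>Z + l * X\<close> is the sum of
  the variances, so its characteristic function factorises. Hence exp(i l X) minus its mean is a
  null weight for the past, also after restriction to \<open>A\<close>; one-dimensional uniqueness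
  in \<open>l\<close>, with weight \<open>indicator A - prob A\<close>, yields the product
  formula.\<close>

lemma future_prob:
  assumes X: "X \<in> future a" and A: "A \<in> sets (noise_filtration M F a)" and B: "B \<in> sets borel"
  shows "prob (A \<inter> (X -` B \<inter> space M)) = prob A * prob (X -` B \<inter> space M)"
proof -
  have XG: "X \<in> gspan {0..}" using X by (simp add: future_def)
  have [measurable]: "X \<in> borel_measurable M" by (rule gspan_measurable[OF XG])
  have [measurable]: "A \<in> sets M" using A noise_filtration_sub by blast
  have lX: "(\<lambda>\<omega>. l * X \<omega>) \<in> gspan {0..}" for l using gspan_add[OF gspan_0 XG] by simp
  have int: "integrable M (\<lambda>\<omega>. iexp (X \<omega>))" if "X \<in> borel_measurable M" for X
    by (rule integrable_const_bound[of _ 1]) (use that in auto)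
  define \<phi> where "\<phi> l = (\<integral>\<omega>. iexp (l * X \<omega>) \<partial>M)" for l
  have null: "fourier_null M (past a) (\<lambda>\<omega>. iexp (l * X \<omega>) - \<phi> l)" for l
    unfolding fourier_null_def
  proof (intro conjI ballI)
    have iX: "integrable M (\<lambda>\<omega>. iexp (l * X \<omega>))" by (rule int) auto
    show i: "integrable M (\<lambda>\<omega>. iexp (l * X \<omega>) - \<phi> l)" using iX by simp
    fix Z assume "Z \<in> past a"
    then obtain Z' where [measurable]: "Z \<in> borel_measurable M" and Z': "Z' \<in> gspan {0..a}"
      and eq: "AE \<omega> in M. Z \<omega> = Z' \<omega>" by (auto simp: past_def)
    have Z'G: "Z' \<in> gspan {0..}" using Z' gspan_mono[of "{0..a}" "{0..}"] by auto
    have [measurable]: "Z' \<in> borel_measurable M" by (rule gspan_measurable[OF Z'G])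
    have YG: "(\<lambda>\<omega>. Z' \<omega> + l * X \<omega>) \<in> gspan {0..}" by (rule gspan_add[OF Z'G XG])
    have sq: "(\<integral>\<omega>. (Z' \<omega> + l * X \<omega>)\<^sup>2 \<partial>M) = (\<integral>\<omega>. (Z' \<omega>)\<^sup>2 \<partial>M) + (\<integral>\<omega>. (l * X \<omega>)\<^sup>2 \<partial>M)"
    proof -
      have "(\<integral>\<omega>. (Z' \<omega> + l * X \<omega>)\<^sup>2 \<partial>M)
        = (\<integral>\<omega>. (Z' \<omega>)\<^sup>2 + (l * X \<omega>)\<^sup>2 + 2 * l * (Z' \<omega> * X \<omega>) \<partial>M)"
        by (intro Bochner_Integration.integral_cong) (auto simp: power2_sum)
      also have "\<dots> = (\<integral>\<omega>. (Z' \<omega>)\<^sup>2 \<partial>M) + (\<integral>\<omega>. (l * X \<omega>)\<^sup>2 \<partial>M) + 2 * l * (\<integral>\<omega>. Z' \<omega> * X \<omega> \<partial>M)"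
        using gspan_moments(1)[OF Z'G] gspan_moments(1)[OF lX[of l]] gspan_mult_integrable[OF Z'G XG]
        by simp
      also have "(\<integral>\<omega>. Z' \<omega> * X \<omega> \<partial>M) = 0" using X Z' by (simp add: future_def)
      finally show ?thesis by simp
    qed
    have "(\<integral>\<omega>. (iexp (l * X \<omega>) - \<phi> l) * iexp (Z \<omega>) \<partial>M)
      = (\<integral>\<omega>. iexp (Z' \<omega> + l * X \<omega>) - \<phi> l * iexp (Z' \<omega>) \<partial>M)"
      by (rule integral_cong_AE) (measurable, use eq in eventually_elim,
          auto simp: left_diff_distrib exp_add distrib_left)
    also have "\<dots> = (\<integral>\<omega>. iexp (Z' \<omega> + l * X \<omega>) \<partial>M) - \<phi> l * (\<integral>\<omega>. iexp (Z' \<omega>) \<partial>M)"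
      using int[of Z'] int[of "\<lambda>\<omega>. Z' \<omega> + l * X \<omega>"] by simp
    also have "\<dots> = 0"
      unfolding \<phi>_def gspan_moments(4)[OF YG] gspan_moments(4)[OF Z'G] gspan_moments(4)[OF lX] sq
      by (simp add: exp_add[symmetric] of_real_mult[symmetric] add_divide_distrib del: of_real_mult)
    finally show "(\<integral>\<omega>. (iexp (l * X \<omega>) - \<phi> l) * iexp (Z \<omega>) \<partial>M) = 0" .
  qed
  have past_add: "(\<lambda>\<omega>. Z \<omega> + l * Y \<omega>) \<in> past a" if "Z \<in> past a" "Y \<in> past a" for Z Y l
  proof -
    from that obtain Z' Y' where *: "Z' \<in> gspan {0..a}" "Y' \<in> gspan {0..a}"
      "AE \<omega> in M. Z \<omega> = Z' \<omega>" "AE \<omega> in M. Y \<omega> = Y' \<omega>" by (auto simp: past_def)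
    from *(3,4) have "AE \<omega> in M. Z \<omega> + l * Y \<omega> = Z' \<omega> + l * Y' \<omega>" by eventually_elim simp
    then show ?thesis using gspan_add[OF *(1,2)] that by (auto simp: past_def)
  qed
  have A': "A \<in> sigma_sets (space M) {X -` B \<inter> space M | X B. X \<in> past a \<and> B \<in> sets borel}"
    using filtration_sub_past A by blast
  \<comment> \<open>Testing against the constant 0 turns the exponential of the past into 1.\<close>
  have "(\<lambda>_. 0) \<in> past a" unfolding past_def using gspan_0[of "{0..a}"]
    by (auto intro!: bexI[of _ "\<lambda>_. 0"])
  moreover have "fourier_null M (past a) (\<lambda>\<omega>. indicator A \<omega> * (iexp (l * X \<omega>) - \<phi> l))" for l
    by (rule fourier_null_indicator[OF _ _ A' null]) (use past_add in \<open>auto simp: past_def\<close>)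
  ultimately have z: "(\<integral>\<omega>. indicator A \<omega> * (iexp (l * X \<omega>) - \<phi> l) \<partial>M) = 0" for l
    unfolding fourier_null_def by (metis (no_types, lifting) Bochner_Integration.integral_cong
        exp_zero mult.right_neutral mult_zero_right of_real_0)
  have "(\<integral>\<omega>. complex_of_real (indicator A \<omega> - prob A) * iexp (l * X \<omega>) \<partial>M) = 0" for l
  proof -
    have i1: "integrable M (\<lambda>\<omega>. indicator A \<omega> * iexp (l * X \<omega>))"
      by (rule integrable_const_bound[of _ 1]) (auto simp: indicator_def)
    have i2: "integrable M (\<lambda>\<omega>. iexp (l * X \<omega>))" by (rule int) auto
    have i3: "integrable M (\<lambda>\<omega>. indicator A \<omega> :: complex)"
      by (rule integrable_const_bound[of _ 1]) (auto simp: indicator_def)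
    have i4: "(\<integral>\<omega>. indicator A \<omega> \<partial>M) = complex_of_real (prob A)"
      using integral_complex_of_real[of M "indicator A"] by (simp add: of_real_indicator)
    have "0 = (\<integral>\<omega>. indicator A \<omega> * iexp (l * X \<omega>) - indicator A \<omega> * \<phi> l \<partial>M)"
      using z[of l] by (simp add: right_diff_distrib)
    also have "\<dots> = (\<integral>\<omega>. indicator A \<omega> * iexp (l * X \<omega>) \<partial>M) - prob A * \<phi> l"
      using i1 i3 i4 by simp
    also have "\<dots> = (\<integral>\<omega>. indicator A \<omega> * iexp (l * X \<omega>) - prob A * iexp (l * X \<omega>) \<partial>M)"
      using i1 i2 by (simp add: \<phi>_def)
    also have "\<dots> = (\<integral>\<omega>. complex_of_real (indicator A \<omega> - prob A) * iexp (l * X \<omega>) \<partial>M)"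
      by (intro Bochner_Integration.integral_cong) (auto simp: left_diff_distrib of_real_indicator)
    finally show ?thesis by simp
  qed
  from fourier_unique_real_weight[OF _ _ this B]
  have "(\<integral>\<omega>. (indicator A \<omega> - prob A) * indicator B (X \<omega>) \<partial>M) = 0"
    by (auto intro!: Bochner_Integration.integrable_diff simp: emeasure_eq_measure)
  moreover have "(\<integral>\<omega>. (indicator A \<omega> - prob A) * indicator B (X \<omega>) \<partial>M)
    = (\<integral>\<omega>. indicator (A \<inter> (X -` B \<inter> space M)) \<omega> - prob A * indicator (X -` B \<inter> space M) \<omega> \<partial>M)"
    by (intro Bochner_Integration.integral_cong) (auto simp: indicator_def)
  moreover have "\<dots> = prob (A \<inter> (X -` B \<inter> space M)) - prob A * prob (X -` B \<inter> space M)"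
  proof -
    have [measurable]: "X -` B \<inter> space M \<in> sets M" using B by measurable
    show ?thesis
      by (subst Bochner_Integration.integral_diff) (auto simp: emeasure_eq_measure)
  qed
  ultimately show ?thesis by simp
qed

lemma future_indep:
  assumes X: "X \<in> future a" and V: "V \<in> borel_measurable (noise_filtration M F a)"
  shows "indep_var borel V borel X"
  unfolding indep_var_eq
proof (intro conjI indep_setI)
  have XG: "X \<in> gspan {0..}" using X by (simp add: future_def)
  show 1: "random_variable borel V" using V by (rule measurable_noise_filtration)
  show 2: "random_variable borel X" by (rule gspan_measurable[OF XG])
  let ?V = "sigma_sets (space M) {V -` A \<inter> space M |A. A \<in> sets borel}"
  let ?X = "sigma_sets (space M) {X -` A \<inter> space M |A. A \<in> sets borel}"
  have Veq: "?V \<subseteq> sets (noise_filtration M F a)"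
    using sets.sigma_sets_subset[of "{V -` A \<inter> space M |A. A \<in> sets borel}" "noise_filtration M F a"]
      measurable_sets[OF V] by auto
  then show "?V \<subseteq> events" using noise_filtration_sub by blast
  show "?X \<subseteq> events" by (rule sets.sigma_sets_subset) (use measurable_sets[OF 2] in auto)
  have Xeq: "?X = {X -` A \<inter> space M |A. A \<in> sets borel}"
    using sets_vimage_algebra2[of X "space M" borel] sets_vimage_algebra[of "space M" X borel] by auto
  fix b c assume "b \<in> ?V" "c \<in> ?X"
  then show "prob (b \<inter> c) = prob b * prob c"
    using future_prob[OF X] Veq unfolding Xeq by blast
qed

lemma future_integral:
  assumes X: "X \<in> future a" and V: "V \<in> borel_measurable (noise_filtration M F a)" "integrable M V"
  shows "integrable M (\<lambda>\<omega>. V \<omega> * X \<omega>)" "(\<integral>\<omega>. V \<omega> * X \<omega> \<partial>M) = 0"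
    "integrable M (\<lambda>\<omega>. V \<omega> * (X \<omega>)\<^sup>2)"
    "(\<integral>\<omega>. V \<omega> * (X \<omega>)\<^sup>2 \<partial>M) = (\<integral>\<omega>. V \<omega> \<partial>M) * (\<integral>\<omega>. (X \<omega>)\<^sup>2 \<partial>M)"
proof -
  have XG: "X \<in> gspan {0..}" using X by (simp add: future_def)
  have i: "indep_var borel V borel X" by (rule future_indep[OF X V(1)])
  have i2: "indep_var borel V borel (\<lambda>\<omega>. (X \<omega>)\<^sup>2)"
    using indep_var_compose[OF i, of "\<lambda>x. x" borel "\<lambda>x. x\<^sup>2" borel] by (simp add: o_def)
  note m = gspan_moments[OF XG]
  show "integrable M (\<lambda>\<omega>. V \<omega> * X \<omega>)" by (rule indep_var_integrable[OF i V(2) m(2)])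
  show "(\<integral>\<omega>. V \<omega> * X \<omega> \<partial>M) = 0" using indep_var_lebesgue_integral[OF i V(2) m(2)] m(3) by simp
  show "integrable M (\<lambda>\<omega>. V \<omega> * (X \<omega>)\<^sup>2)" by (rule indep_var_integrable[OF i2 V(2) m(1)])
  show "(\<integral>\<omega>. V \<omega> * (X \<omega>)\<^sup>2 \<partial>M) = (\<integral>\<omega>. V \<omega> \<partial>M) * (\<integral>\<omega>. (X \<omega>)\<^sup>2 \<partial>M)"
    by (rule indep_var_lebesgue_integral[OF i2 V(2) m(1)])
qed

lemma future_add: "X \<in> future a \<Longrightarrow> Y \<in> future a \<Longrightarrow> (\<lambda>\<omega>. X \<omega> + l * Y \<omega>) \<in> future a"
proof -
  assume X: "X \<in> future a" and Y: "Y \<in> future a"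
  have XG: "X \<in> gspan {0..}" and YG: "Y \<in> gspan {0..}" using X Y by (auto simp: future_def)
  have "(\<integral>\<omega>. Z \<omega> * (X \<omega> + l * Y \<omega>) \<partial>M) = 0" if Z: "Z \<in> gspan {0..a}" for Z
  proof -
    have ZG: "Z \<in> gspan {0..}" using Z gspan_mono[of "{0..a}" "{0..}"] by auto
    have "(\<integral>\<omega>. Z \<omega> * (X \<omega> + l * Y \<omega>) \<partial>M) = (\<integral>\<omega>. Z \<omega> * X \<omega> + l * (Z \<omega> * Y \<omega>) \<partial>M)"
      by (intro Bochner_Integration.integral_cong) (auto simp: algebra_simps)
    also have "\<dots> = 0" using X Y Z gspan_mult_integrable[OF ZG XG] gspan_mult_integrable[OF ZG YG]
      by (simp add: future_def)
    finally show ?thesis .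
  qed
  then show "(\<lambda>\<omega>. X \<omega> + l * Y \<omega>) \<in> future a" using gspan_add[OF XG YG] by (auto simp: future_def)
qed

text \<open>Polarization: sum and difference of \<open>X\<close> and \<open>Y\<close> are again in
  \<open>future a\<close>, so the statement for squares applies to both.\<close>

lemma future_cov:
  assumes X: "X \<in> future a" and Y: "Y \<in> future a"
    and V: "V \<in> borel_measurable (noise_filtration M F a)" "integrable M V"
  shows "integrable M (\<lambda>\<omega>. V \<omega> * (X \<omega> * Y \<omega>))"
    "(\<integral>\<omega>. V \<omega> * (X \<omega> * Y \<omega>) \<partial>M) = (\<integral>\<omega>. V \<omega> \<partial>M) * (\<integral>\<omega>. X \<omega> * Y \<omega> \<partial>M)"
proof -
  note P = future_add[OF X Y, of 1] and N = future_add[OF X Y, of "-1"]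
  have PG: "(\<lambda>\<omega>. X \<omega> + 1 * Y \<omega>) \<in> gspan {0..}" and NG: "(\<lambda>\<omega>. X \<omega> + (-1) * Y \<omega>) \<in> gspan {0..}"
    using P N by (simp_all add: future_def)
  have pol: "x * y = ((x + 1 * y)\<^sup>2 - (x + (-1) * y)\<^sup>2) / 4" for x y :: real
    by (simp add: power2_eq_square algebra_simps)
  have pol': "V \<omega> * (X \<omega> * Y \<omega>) = (V \<omega> * (X \<omega> + 1 * Y \<omega>)\<^sup>2 - V \<omega> * (X \<omega> + (-1) * Y \<omega>)\<^sup>2) / 4" for \<omega>
    by (simp add: power2_eq_square algebra_simps)
  show "integrable M (\<lambda>\<omega>. V \<omega> * (X \<omega> * Y \<omega>))"
    unfolding pol' by (intro integrable_divide_zero impI Bochner_Integration.integrable_diff future_integral(3)[OF P V] future_integral(3)[OF N V])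
  have "(\<integral>\<omega>. V \<omega> * (X \<omega> * Y \<omega>) \<partial>M) = ((\<integral>\<omega>. V \<omega> * (X \<omega> + 1 * Y \<omega>)\<^sup>2 \<partial>M) - (\<integral>\<omega>. V \<omega> * (X \<omega> + (-1) * Y \<omega>)\<^sup>2 \<partial>M)) / 4"
    unfolding pol' using future_integral(3)[OF P V] future_integral(3)[OF N V] by simp
  also have "\<dots> = (\<integral>\<omega>. V \<omega> \<partial>M) * (((\<integral>\<omega>. (X \<omega> + 1 * Y \<omega>)\<^sup>2 \<partial>M) - (\<integral>\<omega>. (X \<omega> + (-1) * Y \<omega>)\<^sup>2 \<partial>M)) / 4)"
    unfolding future_integral(4)[OF P V] future_integral(4)[OF N V] by (simp add: right_diff_distrib)
  also have "((\<integral>\<omega>. (X \<omega> + 1 * Y \<omega>)\<^sup>2 \<partial>M) - (\<integral>\<omega>. (X \<omega> + (-1) * Y \<omega>)\<^sup>2 \<partial>M)) / 4 = (\<integral>\<omega>. X \<omega> * Y \<omega> \<partial>M)"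
    using gspan_moments(1)[OF PG] gspan_moments(1)[OF NG] by (subst pol[of "X _"]) simp
  finally show "(\<integral>\<omega>. V \<omega> * (X \<omega> * Y \<omega>) \<partial>M) = (\<integral>\<omega>. V \<omega> \<partial>M) * (\<integral>\<omega>. X \<omega> * Y \<omega> \<partial>M)" .
qed

lemma increment_cov:
  assumes "0 \<le> a" "a \<le> b" "0 \<le> a'" "a' \<le> b'" and A: "A \<in> bounded_borel" and B: "B \<in> bounded_borel"
  shows "(\<integral>\<omega>. (F b A \<omega> - F a A \<omega>) * (F b' B \<omega> - F a' B \<omega>) \<partial>M)
    = (min b b' - min b a' - min a b' + min a a') * q A B"
proof -
  have i: "integrable M (\<lambda>\<omega>. F s A \<omega> * F t B \<omega>)" if "0 \<le> s" "0 \<le> t" for s t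
    by (rule gspan_mult_integrable) (use that A B gspan_F in auto)
  have "(\<integral>\<omega>. (F b A \<omega> - F a A \<omega>) * (F b' B \<omega> - F a' B \<omega>) \<partial>M)
    = (\<integral>\<omega>. F b A \<omega> * F b' B \<omega> - F b A \<omega> * F a' B \<omega> - F a A \<omega> * F b' B \<omega> + F a A \<omega> * F a' B \<omega> \<partial>M)"
    by (intro Bochner_Integration.integral_cong) (auto simp: algebra_simps)
  also have "\<dots> = (min b b' - min b a' - min a b' + min a a') * q A B"
    using assms by (simp add: i F_cov) (simp add: algebra_simps)
  finally show ?thesis .
qed

text \<open>For a noise value at time s \<le> a, both min s b and min s a equal s, so its
  covariances with the two ends of the increment cancel.\<close>

lemma increment_future:
  assumes "0 \<le> a" "a \<le> b" and A: "A \<in> bounded_borel"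
  shows "(\<lambda>\<omega>. F b A \<omega> - F a A \<omega>) \<in> future a"
proof -
  have G: "(\<lambda>\<omega>. F b A \<omega> - F a A \<omega>) \<in> gspan {0..}"
    using gspan_add[OF gspan_F[of b "{0..}" A] gspan_F[of a "{0..}" A], of "-1"] assms by simp
  have "(\<integral>\<omega>. Z \<omega> * (F b A \<omega> - F a A \<omega>) \<partial>M) = 0" if "Z \<in> gspan {0..a}" for Z
  proof -
    obtain I :: "(real \<times> 'a set) set" and c where I: "finite I" "I \<subseteq> {0..a} \<times> bounded_borel"
      and Z: "Z = (\<lambda>\<omega>. \<Sum>p\<in>I. c p * F (fst p) (snd p) \<omega>)"
      using \<open>Z \<in> gspan {0..a}\<close> unfolding gspan_def by (auto simp: case_prod_unfold)
    have p: "0 \<le> fst p" "fst p \<le> a" "snd p \<in> bounded_borel" if "p \<in> I" for p using I that by auto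
    have i: "integrable M (\<lambda>\<omega>. F (fst p) (snd p) \<omega> * (F b A \<omega> - F a A \<omega>))" if "p \<in> I" for p
      by (rule gspan_mult_integrable[OF gspan_F G]) (use p[OF that] in auto)
    have z: "(\<integral>\<omega>. F (fst p) (snd p) \<omega> * (F b A \<omega> - F a A \<omega>) \<partial>M) = 0" if "p \<in> I" for p
    proof -
      have i': "integrable M (\<lambda>\<omega>. F (fst p) (snd p) \<omega> * F t A \<omega>)" if "0 \<le> t" for t
        by (rule gspan_mult_integrable) (use p[OF \<open>p \<in> I\<close>] that A gspan_F in auto)
      show ?thesis using p[OF that] assms i' by (simp add: right_diff_distrib F_cov)
    qed
    have "(\<integral>\<omega>. Z \<omega> * (F b A \<omega> - F a A \<omega>) \<partial>M)
      = (\<integral>\<omega>. (\<Sum>p\<in>I. c p * (F (fst p) (snd p) \<omega> * (F b A \<omega> - F a A \<omega>))) \<partial>M)"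
      by (intro Bochner_Integration.integral_cong) (auto simp: Z sum_distrib_right mult.assoc)
    also have "\<dots> = (\<Sum>p\<in>I. c p * (\<integral>\<omega>. F (fst p) (snd p) \<omega> * (F b A \<omega> - F a A \<omega>) \<partial>M))"
      by (subst Bochner_Integration.integral_sum) (auto intro: i)
    also have "\<dots> = 0" using z by simp
    finally show ?thesis .
  qed
  then show ?thesis using G by (auto simp: future_def)
qed

text \<open>The increment over (a, b] is split at a'. Its part before a' is known at time a' and,
  with both weights, multiplies a centred increment independent of that past, giving 0. The part
  after a' lies in the future of both weights and contributes the covariance over the overlap times
  the mean of the weights.\<close>

lemma weighted_increment_cov_aux:
  assumes le: "0 \<le> a" "a \<le> b" "a \<le> a'" "a' \<le> b'"
    and A: "A \<in> bounded_borel" and B: "B \<in> bounded_borel"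
    and X: "X \<in> borel_measurable (noise_filtration M F a)" "\<And>\<omega>. \<omega> \<in> space M \<Longrightarrow> \<bar>X \<omega>\<bar> \<le> c"
    and Y: "Y \<in> borel_measurable (noise_filtration M F a')" "\<And>\<omega>. \<omega> \<in> space M \<Longrightarrow> \<bar>Y \<omega>\<bar> \<le> d"
  shows "integrable M (\<lambda>\<omega>. (X \<omega> * (F b A \<omega> - F a A \<omega>)) * (Y \<omega> * (F b' B \<omega> - F a' B \<omega>))) \<and>
    (\<integral>\<omega>. (X \<omega> * (F b A \<omega> - F a A \<omega>)) * (Y \<omega> * (F b' B \<omega> - F a' B \<omega>)) \<partial>M)
      = (\<integral>\<omega>. X \<omega> * Y \<omega> \<partial>M) * (max 0 (min b b' - max a a') * q A B)"
proof -
  \<comment> \<open>If b \<le> a', then \<open>?m\<close> is b and \<open>?M\<close> is a', so the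
    later part is an empty increment and one formula covers both orders.\<close>
  let ?m = "min b a'" and ?M = "max b a'"
  define V where "V \<omega> = (X \<omega> * Y \<omega>) * (F ?m A \<omega> - F a A \<omega>)" for \<omega>
  have Xm: "X \<in> borel_measurable (noise_filtration M F a')"
    using measurable_noise_filtration_mono[OF le(3) X(1)] .
  note [measurable] = measurable_noise_filtration[OF X(1)] measurable_noise_filtration[OF Y(1)]
  have XYb: "\<bar>X \<omega> * Y \<omega>\<bar> \<le> \<bar>c\<bar> * \<bar>d\<bar>" if "\<omega> \<in> space M" for \<omega>
    unfolding abs_mult using X(2)[OF that] Y(2)[OF that] by (intro mult_mono) auto
  have XYm: "(\<lambda>\<omega>. X \<omega> * Y \<omega>) \<in> borel_measurable (noise_filtration M F a')"
    using Xm Y(1) by measurable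
  have XYi: "integrable M (\<lambda>\<omega>. X \<omega> * Y \<omega>)"
    by (rule integrable_const_bound[of _ "\<bar>c\<bar> * \<bar>d\<bar>"]) (use XYb in auto)
  have Fm: "F ?m A \<in> borel_measurable (noise_filtration M F a')" "F a A \<in> borel_measurable (noise_filtration M F a')"
    using le A by (auto intro!: F_adapted)
  have Vm: "V \<in> borel_measurable (noise_filtration M F a')"
    unfolding V_def by (rule borel_measurable_times[OF XYm borel_measurable_diff[OF Fm]])
  have f1: "(\<lambda>\<omega>. F ?m A \<omega> - F a A \<omega>) \<in> future a" by (rule increment_future) (use le A in auto)
  have Vi: "integrable M V"
    unfolding V_def
  proof (rule integrable_bounded_mult[OF _ _ XYb])
    show "integrable M (\<lambda>\<omega>. F ?m A \<omega> - F a A \<omega>)" using f1 gspan_moments(2) by (auto simp: future_def)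
  qed auto
  have f2: "(\<lambda>\<omega>. F ?M A \<omega> - F a' A \<omega>) \<in> future a'" by (rule increment_future) (use le A in auto)
  have f3: "(\<lambda>\<omega>. F b' B \<omega> - F a' B \<omega>) \<in> future a'" by (rule increment_future) (use le B in auto)
  have split: "(X \<omega> * (F b A \<omega> - F a A \<omega>)) * (Y \<omega> * (F b' B \<omega> - F a' B \<omega>))
    = V \<omega> * (F b' B \<omega> - F a' B \<omega>) + (X \<omega> * Y \<omega>) * ((F ?M A \<omega> - F a' A \<omega>) * (F b' B \<omega> - F a' B \<omega>))" for \<omega>
    unfolding V_def by (cases "b \<le> a'") (simp_all add: algebra_simps)
  have cov: "(\<integral>\<omega>. (F ?M A \<omega> - F a' A \<omega>) * (F b' B \<omega> - F a' B \<omega>) \<partial>M) = max 0 (min b b' - max a a') * q A B"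
    by (subst increment_cov) (use le A B in \<open>auto simp: min_def max_def\<close>)
  show ?thesis unfolding split
    using future_integral(1,2)[OF f3 Vm Vi] future_cov[OF f2 f3 XYm XYi] cov by simp
qed

text \<open>Symmetry is read off from the covariance, where the product commutes, and not from
  pointwise symmetry of \<open>f\<close>.\<close>

lemma q_sym: "A \<in> bounded_borel \<Longrightarrow> B \<in> bounded_borel \<Longrightarrow> q A B = q B A"
  using F_cov[of 1 1 A B] F_cov[of 1 1 B A] by (simp add: mult.commute)

lemma weighted_increment_cov:
  assumes le: "0 \<le> a" "a \<le> b" "0 \<le> a'" "a' \<le> b'"
    and A: "A \<in> bounded_borel" and B: "B \<in> bounded_borel"
    and X: "X \<in> borel_measurable (noise_filtration M F a)" "\<And>\<omega>. \<omega> \<in> space M \<Longrightarrow> \<bar>X \<omega>\<bar> \<le> c"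
    and Y: "Y \<in> borel_measurable (noise_filtration M F a')" "\<And>\<omega>. \<omega> \<in> space M \<Longrightarrow> \<bar>Y \<omega>\<bar> \<le> d"
  shows "integrable M (\<lambda>\<omega>. (X \<omega> * (F b A \<omega> - F a A \<omega>)) * (Y \<omega> * (F b' B \<omega> - F a' B \<omega>))) \<and>
    (\<integral>\<omega>. (X \<omega> * (F b A \<omega> - F a A \<omega>)) * (Y \<omega> * (F b' B \<omega> - F a' B \<omega>)) \<partial>M)
      = (\<integral>\<omega>. X \<omega> * Y \<omega> \<partial>M) * (max 0 (min b b' - max a a') * q A B)"
proof (cases "a \<le> a'")
  case True
  then show ?thesis using weighted_increment_cov_aux[OF _ _ _ _ A B X Y] le by blast
next
  case False
  then show ?thesis using weighted_increment_cov_aux[OF le(3,4) _ le(2) B A Y X]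
    by (simp add: mult.commute min.commute max.commute q_sym[OF A B])
qed

end

section \<open>The Walsh isometry\<close>

lemma nn_integral_lborel_reflect:
  fixes h :: "'a::euclidean_space \<Rightarrow> ennreal"
  assumes [measurable]: "h \<in> borel_measurable borel"
  shows "(\<integral>\<^sup>+y. h (x - y) \<partial>lborel) = (\<integral>\<^sup>+y. h y \<partial>lborel)"
proof -
  have "(\<integral>\<^sup>+y. h y \<partial>lborel) = (\<integral>\<^sup>+y. h y \<partial>density (distr lborel borel (\<lambda>y. x + (-1) *\<^sub>R y)) (\<lambda>_. ennreal (\<bar>-1\<bar> ^ DIM('a))))"
    by (subst lborel_affine[of "-1" x, symmetric]) auto
  also have "\<dots> = (\<integral>\<^sup>+y. h (x - y) \<partial>lborel)"
    by (simp add: nn_integral_density nn_integral_distr)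
  finally show ?thesis by simp
qed

text \<open>Typical use: \<open>a n\<close> is a mixed term, \<open>x n\<close> the square of a
  small factor and \<open>c\<close> the square of a fixed one. First \<open>k\<close> is taken large
  to make the second summand small, then n is taken large for that \<open>k\<close>.\<close>

lemma tendsto_zero_by_weighted_bound:
  fixes a x :: "nat \<Rightarrow> ennreal"
  assumes x: "x \<longlonglongrightarrow> 0" and c: "c < \<infinity>"
    and le: "\<And>n k. 0 < k \<Longrightarrow> a n \<le> ennreal k * x n + ennreal (1 / k) * c"
  shows "a \<longlonglongrightarrow> 0"
proof (rule order_tendstoI)
  fix e :: ennreal assume "0 < e"
  obtain r where r: "c = ennreal r" "0 \<le> r" using c by (cases c) auto
  obtain d where d: "0 < d" "ennreal d < e"
  proof -
    obtain e' where "0 < e'" "e' < e" using \<open>0 < e\<close> dense by blast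
    then show ?thesis using that[of "enn2real e'"]
      by (metis enn2real_positive_iff ennreal_enn2real order_less_trans top.not_eq_extremum top_greatest leD le_less_linear)
  qed
  \<comment> \<open>Chosen to make r / k at most d / 2; the added 1 keeps \<open>k\<close> positive
    when r = 0.\<close>
  define k where "k = 2 * (r + 1) / d"
  have k: "0 < k" using r d by (simp add: k_def)
  have kc: "ennreal (1 / k) * c \<le> ennreal (d / 2)"
  proof -
    have "1 / k * r \<le> d / 2" unfolding k_def using r d by (simp add: field_simps)
    then show ?thesis using r k by (simp add: ennreal_mult[symmetric] ennreal_leI)
  qed
  have "\<forall>\<^sub>F n in sequentially. x n < ennreal (d / (2 * k))"
    using order_tendstoD(2)[OF x] d k by simp
  then show "\<forall>\<^sub>F n in sequentially. a n < e"
  proof eventually_elim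
    case (elim n)
    have "a n \<le> ennreal k * x n + ennreal (1 / k) * c" by (rule le[OF k])
    also have "\<dots> \<le> ennreal k * ennreal (d / (2 * k)) + ennreal (d / 2)"
      using elim kc by (intro add_mono mult_left_mono) auto
    also have "\<dots> = ennreal d"
      using d k by (simp add: ennreal_mult[symmetric] ennreal_plus[symmetric] del: ennreal_plus)
    finally show ?case using d by simp
  qed
qed simp

text \<open>With D1 and D2 the errors, s1 s2 - g1 g2 = D1 D2 - D1 g2 - g1 D2. The measure is general
  because the lemma serves both sides of the isometry: random variables under \<open>M\<close> and
  fields under the Walsh measure.\<close>

lemma integral_product_limit:
  fixes g1 g2 :: "'b \<Rightarrow> real" and s1 s2 :: "nat \<Rightarrow> 'b \<Rightarrow> real"
  assumes [measurable]: "g1 \<in> borel_measurable P" "g2 \<in> borel_measurable P"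
      "\<And>n. s1 n \<in> borel_measurable P" "\<And>n. s2 n \<in> borel_measurable P"
    and g: "integrable P (\<lambda>x. g1 x * g2 x)" and s: "\<And>n. integrable P (\<lambda>x. s1 n x * s2 n x)"
    and lim1: "(\<lambda>n. \<integral>\<^sup>+x. ennreal (\<bar>g1 x - s1 n x\<bar> * \<bar>g2 x\<bar>) \<partial>P) \<longlonglongrightarrow> 0"
    and lim2: "(\<lambda>n. \<integral>\<^sup>+x. ennreal (\<bar>g1 x\<bar> * \<bar>g2 x - s2 n x\<bar>) \<partial>P) \<longlonglongrightarrow> 0"
    and lim3: "(\<lambda>n. \<integral>\<^sup>+x. ennreal (\<bar>g1 x - s1 n x\<bar> * \<bar>g2 x - s2 n x\<bar>) \<partial>P) \<longlonglongrightarrow> 0"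
  shows "(\<lambda>n. \<integral>x. s1 n x * s2 n x \<partial>P) \<longlonglongrightarrow> (\<integral>x. g1 x * g2 x \<partial>P)"
proof -
  have le: "ennreal \<bar>(\<integral>x. s1 n x * s2 n x \<partial>P) - (\<integral>x. g1 x * g2 x \<partial>P)\<bar>
    \<le> (\<integral>\<^sup>+x. ennreal (\<bar>g1 x - s1 n x\<bar> * \<bar>g2 x\<bar>) \<partial>P) + (\<integral>\<^sup>+x. ennreal (\<bar>g1 x\<bar> * \<bar>g2 x - s2 n x\<bar>) \<partial>P)
      + (\<integral>\<^sup>+x. ennreal (\<bar>g1 x - s1 n x\<bar> * \<bar>g2 x - s2 n x\<bar>) \<partial>P)" for n
  proof -
    have "ennreal \<bar>(\<integral>x. s1 n x * s2 n x \<partial>P) - (\<integral>x. g1 x * g2 x \<partial>P)\<bar>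
      = ennreal (norm (\<integral>x. s1 n x * s2 n x - g1 x * g2 x \<partial>P))" using g s by simp
    also have "\<dots> \<le> (\<integral>\<^sup>+x. ennreal (norm (s1 n x * s2 n x - g1 x * g2 x)) \<partial>P)"
      by (rule integral_norm_bound_ennreal) (use g s in auto)
    also have "\<dots> \<le> (\<integral>\<^sup>+x. ennreal (\<bar>g1 x - s1 n x\<bar> * \<bar>g2 x\<bar>) + ennreal (\<bar>g1 x\<bar> * \<bar>g2 x - s2 n x\<bar>)
       + ennreal (\<bar>g1 x - s1 n x\<bar> * \<bar>g2 x - s2 n x\<bar>) \<partial>P)"
    proof (rule nn_integral_mono)
      fix x
      have "s1 n x * s2 n x - g1 x * g2 x = (g1 x - s1 n x) * (g2 x - s2 n x)
         - (g1 x - s1 n x) * g2 x - g1 x * (g2 x - s2 n x)" by (simp add: algebra_simps)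
      then have "\<bar>s1 n x * s2 n x - g1 x * g2 x\<bar> \<le> \<bar>g1 x - s1 n x\<bar> * \<bar>g2 x\<bar> + \<bar>g1 x\<bar> * \<bar>g2 x - s2 n x\<bar>
         + \<bar>g1 x - s1 n x\<bar> * \<bar>g2 x - s2 n x\<bar>" unfolding abs_mult[symmetric] by linarith
      then show "ennreal (norm (s1 n x * s2 n x - g1 x * g2 x)) \<le> ennreal (\<bar>g1 x - s1 n x\<bar> * \<bar>g2 x\<bar>)
         + ennreal (\<bar>g1 x\<bar> * \<bar>g2 x - s2 n x\<bar>) + ennreal (\<bar>g1 x - s1 n x\<bar> * \<bar>g2 x - s2 n x\<bar>)"
        by (simp add: ennreal_plus[symmetric] ennreal_leI del: ennreal_plus)
    qed
    also have "\<dots> = (\<integral>\<^sup>+x. ennreal (\<bar>g1 x - s1 n x\<bar> * \<bar>g2 x\<bar>) \<partial>P) + (\<integral>\<^sup>+x. ennreal (\<bar>g1 x\<bar> * \<bar>g2 x - s2 n x\<bar>) \<partial>P)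
      + (\<integral>\<^sup>+x. ennreal (\<bar>g1 x - s1 n x\<bar> * \<bar>g2 x - s2 n x\<bar>) \<partial>P)"
      by (simp add: nn_integral_add)
    finally show ?thesis .
  qed
  have "(\<lambda>n. ennreal \<bar>(\<integral>x. s1 n x * s2 n x \<partial>P) - (\<integral>x. g1 x * g2 x \<partial>P)\<bar>) \<longlonglongrightarrow> 0"
  proof (rule tendsto_sandwich[OF _ _ tendsto_const])
    show "\<forall>\<^sub>F n in sequentially. ennreal \<bar>(\<integral>x. s1 n x * s2 n x \<partial>P) - (\<integral>x. g1 x * g2 x \<partial>P)\<bar>
      \<le> (\<integral>\<^sup>+x. ennreal (\<bar>g1 x - s1 n x\<bar> * \<bar>g2 x\<bar>) \<partial>P) + (\<integral>\<^sup>+x. ennreal (\<bar>g1 x\<bar> * \<bar>g2 x - s2 n x\<bar>) \<partial>P)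
      + (\<integral>\<^sup>+x. ennreal (\<bar>g1 x - s1 n x\<bar> * \<bar>g2 x - s2 n x\<bar>) \<partial>P)" using le by simp
    show "(\<lambda>n. (\<integral>\<^sup>+x. ennreal (\<bar>g1 x - s1 n x\<bar> * \<bar>g2 x\<bar>) \<partial>P) + (\<integral>\<^sup>+x. ennreal (\<bar>g1 x\<bar> * \<bar>g2 x - s2 n x\<bar>) \<partial>P)
      + (\<integral>\<^sup>+x. ennreal (\<bar>g1 x - s1 n x\<bar> * \<bar>g2 x - s2 n x\<bar>) \<partial>P)) \<longlonglongrightarrow> 0"
      using tendsto_add[OF tendsto_add[OF lim1 lim2] lim3] by simp
  qed auto
  then have "(\<lambda>n. \<bar>(\<integral>x. s1 n x * s2 n x \<partial>P) - (\<integral>x. g1 x * g2 x \<partial>P)\<bar>) \<longlonglongrightarrow> 0"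
    using tendsto_ennreal_iff[of _ sequentially 0] by auto
  then show ?thesis by (simp add: tendsto_rabs_zero_iff LIM_zero_iff)
qed

section \<open>The correlation as an energy form\<close>

locale colored_noise = noise M f F
  for M :: "'w measure" and f :: "'a::euclidean_space \<Rightarrow> 'a \<Rightarrow> ennreal"
    and F :: "real \<Rightarrow> 'a set \<Rightarrow> 'w \<Rightarrow> real" +
  fixes g :: "'a \<Rightarrow> ennreal" and \<alpha> :: real
  assumes correlation: "spatial_correlation \<alpha> f g"
begin

lemma f_measurable: "(\<lambda>(x, y). f x y) \<in> borel_measurable (borel \<Otimes>\<^sub>M borel)"
  using correlation by (simp add: spatial_correlation_def)

lemma f_measurable' [measurable (raw)]:
  "h1 \<in> borel_measurable N \<Longrightarrow> h2 \<in> borel_measurable N \<Longrightarrow> (\<lambda>x. f (h1 x) (h2 x)) \<in> borel_measurable N"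
  using measurable_compose[of "\<lambda>x. (h1 x, h2 x)" N, OF _ f_measurable] by simp

lemma bounded_borelD [measurable_dest]: "A \<in> bounded_borel \<Longrightarrow> A \<in> sets borel"
  by (simp add: bounded_borel_def)

text \<open>For x in \<open>A\<close> and y in \<open>B\<close> the difference x - y stays in a ball
  of radius 2r, so the inner integral is bounded, uniformly in x, by the integral of
  \<open>g\<close> over that ball.\<close>

lemma f_integral_eq_q:
  assumes A: "A \<in> bounded_borel" and B: "B \<in> bounded_borel"
  shows "(\<integral>\<^sup>+x\<in>A. (\<integral>\<^sup>+y\<in>B. f x y \<partial>lborel) \<partial>lborel) = ennreal (q A B)"
proof -
  have g [measurable]: "g \<in> borel_measurable borel"
    and gi: "\<And>C. compact C \<Longrightarrow> (\<integral>\<^sup>+x\<in>C. g x \<partial>lborel) < \<infinity>" and fg: "\<And>x y. f x y \<le> g (x - y)"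
    using correlation by (auto simp: spatial_correlation_def locally_integrable_def)
  have [measurable]: "A \<in> sets borel" "B \<in> sets borel" using A B by (auto simp: bounded_borel_def)
  have "bounded (A \<union> B)" using A B by (simp add: bounded_borel_def)
  then obtain r where "A \<union> B \<subseteq> ball 0 r" using bounded_subset_ballD by blast
  then have r: "A \<union> B \<subseteq> cball 0 r" using ball_subset_cball by blast
  let ?C = "\<integral>\<^sup>+x\<in>cball 0 (2 * r). g x \<partial>lborel"
  have "(\<integral>\<^sup>+x\<in>A. (\<integral>\<^sup>+y\<in>B. f x y \<partial>lborel) \<partial>lborel) \<le> (\<integral>\<^sup>+x\<in>A. ?C \<partial>lborel)"
  proof (rule nn_integral_mono)
    fix x
    show "(\<integral>\<^sup>+y\<in>B. f x y \<partial>lborel) * indicator A x \<le> ?C * indicator A x"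
    proof (cases "x \<in> A")
      case True
      have "(\<integral>\<^sup>+y\<in>B. f x y \<partial>lborel) \<le> (\<integral>\<^sup>+y. g (x - y) * indicator (cball 0 (2 * r)) (x - y) \<partial>lborel)"
      proof (rule nn_integral_mono)
        fix y
        show "f x y * indicator B y \<le> g (x - y) * indicator (cball 0 (2 * r)) (x - y)"
        proof (cases "y \<in> B")
          case True
          have "norm x \<le> r" "norm y \<le> r" using r True \<open>x \<in> A\<close> by auto
          then have "norm (x - y) \<le> 2 * r" using norm_triangle_ineq4[of x y] by simp
          then show ?thesis using fg True by (simp add: dist_norm norm_minus_commute)
        qed simp
      qed
      also have "\<dots> = ?C"
        by (rule nn_integral_lborel_reflect[of "\<lambda>z. g z * indicator (cball 0 (2 * r)) z"])
          (intro borel_measurable_times_ennreal borel_measurable_indicator g, simp)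
      finally show ?thesis using True by simp
    qed simp
  qed
  also have "\<dots> = ?C * emeasure lborel A" by (simp add: nn_integral_cmult)
  also have "\<dots> < \<infinity>"
    using gi[of "cball 0 (2 * r)"] emeasure_bounded_finite[of A] A
    by (simp add: bounded_borel_def ennreal_mult_less_top)
  finally show ?thesis unfolding q_def by simp
qed

text \<open>The bilinear energy of the kernel \<open>f\<close>. Since \<open>ennreal\<close> cuts
  negative products to 0, it is meant for nonnegative functions, such as the absolute values in
  Walsh's norm.\<close>

definition qf :: "('a \<Rightarrow> real) \<Rightarrow> ('a \<Rightarrow> real) \<Rightarrow> ennreal" where
  "qf a b = (\<integral>\<^sup>+y. (\<integral>\<^sup>+z. ennreal (a y * b z) * f y z \<partial>lborel) \<partial>lborel)"

text \<open>This is how positive definiteness of \<open>f\<close> becomes available: the energy of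
  step functions is the covariance of the corresponding combinations of \<open>F 1\<close>. A step
  function is indexed by its values, so \<open>v\<close> is both index and height.\<close>

lemma qf_steps:
  fixes A B :: "real \<Rightarrow> 'a set"
  assumes U: "finite U" "finite V" "\<And>v. v \<in> U \<Longrightarrow> 0 \<le> v" "\<And>v. v \<in> V \<Longrightarrow> 0 \<le> v"
    and A: "\<And>v. v \<in> U \<Longrightarrow> A v \<in> bounded_borel" and B: "\<And>v. v \<in> V \<Longrightarrow> B v \<in> bounded_borel"
  shows "qf (\<lambda>y. \<Sum>v\<in>U. v * indicator (A v) y) (\<lambda>y. \<Sum>v\<in>V. v * indicator (B v) y)
    = ennreal (\<integral>\<omega>. (\<Sum>v\<in>U. v * F 1 (A v) \<omega>) * (\<Sum>v\<in>V. v * F 1 (B v) \<omega>) \<partial>M)"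
proof -
  have [measurable]: "v \<in> U \<Longrightarrow> A v \<in> sets borel" "v \<in> V \<Longrightarrow> B v \<in> sets borel" for v
    using A B by (auto simp: bounded_borel_def)
  have q0: "0 \<le> q A B" for A B by (simp add: q_def)
  have i: "integrable M (\<lambda>\<omega>. F 1 (A v) \<omega> * F 1 (B w) \<omega>)" if "v \<in> U" "w \<in> V" for v w
    by (rule gspan_mult_integrable) (use A B that gspan_F in auto)
  have eq: "ennreal ((\<Sum>v\<in>U. v * indicator (A v) y) * (\<Sum>v\<in>V. v * indicator (B v) z)) * f y z
    = (\<Sum>v\<in>U. \<Sum>w\<in>V. ennreal (v * w) * ((f y z * indicator (B w) z) * indicator (A v) y))" for y z
  proof -
    have "ennreal ((\<Sum>v\<in>U. v * indicator (A v) y) * (\<Sum>v\<in>V. v * indicator (B v) z))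
      = ennreal (\<Sum>v\<in>U. \<Sum>w\<in>V. (v * w) * (indicator (A v) y * indicator (B w) z))"
      by (simp add: sum_product mult_ac)
    also have "\<dots> = (\<Sum>v\<in>U. \<Sum>w\<in>V. ennreal ((v * w) * (indicator (A v) y * indicator (B w) z)))"
      using U by (subst sum_ennreal[symmetric], force intro!: sum_nonneg,
        intro sum.cong refl, subst sum_ennreal[symmetric]) auto
    also have "\<dots> = (\<Sum>v\<in>U. \<Sum>w\<in>V. ennreal (v * w) * (indicator (B w) z * indicator (A v) y))"
      by (intro sum.cong refl) (auto simp: indicator_def)
    finally have "ennreal ((\<Sum>v\<in>U. v * indicator (A v) y) * (\<Sum>v\<in>V. v * indicator (B v) z))
      = (\<Sum>v\<in>U. \<Sum>w\<in>V. ennreal (v * w) * (indicator (B w) z * indicator (A v) y))" .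
    then show ?thesis
      by (simp only:) (simp add: sum_distrib_left sum_distrib_right mult_ac)
  qed
  have "qf (\<lambda>y. \<Sum>v\<in>U. v * indicator (A v) y) (\<lambda>y. \<Sum>v\<in>V. v * indicator (B v) y)
    = (\<Sum>v\<in>U. \<Sum>w\<in>V. ennreal (v * w) * (\<integral>\<^sup>+y\<in>A v. (\<integral>\<^sup>+z\<in>B w. f y z \<partial>lborel) \<partial>lborel))"
    unfolding qf_def eq
    by (simp add: nn_integral_sum nn_integral_cmult nn_integral_multc cong: sum.cong)
  also have "\<dots> = (\<Sum>v\<in>U. \<Sum>w\<in>V. ennreal (v * w * q (A v) (B w)))"
    by (intro sum.cong refl) (simp add: f_integral_eq_q A B ennreal_mult'' q0)
  also have "\<dots> = ennreal (\<Sum>v\<in>U. \<Sum>w\<in>V. v * w * q (A v) (B w))"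
    using U q0 by (subst sum_ennreal[symmetric], force intro!: sum_nonneg mult_nonneg_nonneg,
        intro sum.cong refl, subst sum_ennreal[symmetric]) auto
  also have "(\<Sum>v\<in>U. \<Sum>w\<in>V. v * w * q (A v) (B w))
    = (\<Sum>v\<in>U. \<Sum>w\<in>V. v * w * (\<integral>\<omega>. F 1 (A v) \<omega> * F 1 (B w) \<omega> \<partial>M))"
    by (intro sum.cong refl) (simp add: F_cov A B)
  also have "\<dots> = (\<integral>\<omega>. (\<Sum>v\<in>U. \<Sum>w\<in>V. v * w * (F 1 (A v) \<omega> * F 1 (B w) \<omega>)) \<partial>M)"
    using i by (simp add: Bochner_Integration.integral_sum)
  also have "\<dots> = (\<integral>\<omega>. (\<Sum>v\<in>U. v * F 1 (A v) \<omega>) * (\<Sum>v\<in>V. v * F 1 (B v) \<omega>) \<partial>M)"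
    by (simp add: sum_product mult_ac)
  finally show ?thesis .
qed

text \<open>Through \<open>qf_steps\<close> this is the expectation of the pointwise inequality for
  two Gaussian combinations.\<close>

lemma qf_amgm_steps:
  fixes A B :: "real \<Rightarrow> 'a set"
  assumes U: "finite U" "finite V" "\<And>v. v \<in> U \<Longrightarrow> 0 \<le> v" "\<And>v. v \<in> V \<Longrightarrow> 0 \<le> v"
    and A: "\<And>v. v \<in> U \<Longrightarrow> A v \<in> bounded_borel" and B: "\<And>v. v \<in> V \<Longrightarrow> B v \<in> bounded_borel"
    and a: "a = (\<lambda>y. \<Sum>v\<in>U. v * indicator (A v) y)" and b: "b = (\<lambda>y. \<Sum>v\<in>V. v * indicator (B v) y)"
    and k: "0 < k"
  shows "qf a b \<le> ennreal k * qf a a + ennreal (1 / k) * qf b b"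
proof -
  define Z where "Z \<omega> = (\<Sum>v\<in>U. v * F 1 (A v) \<omega>)" for \<omega>
  define W where "W \<omega> = (\<Sum>v\<in>V. v * F 1 (B v) \<omega>)" for \<omega>
  have [measurable]: "Z \<in> borel_measurable M" "W \<in> borel_measurable M"
    unfolding Z_def W_def by (auto intro!: borel_measurable_sum borel_measurable_times F_measurable A B)
  have ZW: "qf a b = ennreal (\<integral>\<omega>. Z \<omega> * W \<omega> \<partial>M)"
    unfolding a b Z_def W_def by (rule qf_steps) (use U A B in auto)
  have ZZ: "qf a a = ennreal (\<integral>\<omega>. Z \<omega> * Z \<omega> \<partial>M)"
    unfolding a Z_def by (rule qf_steps) (use U A in auto)
  have WW: "qf b b = ennreal (\<integral>\<omega>. W \<omega> * W \<omega> \<partial>M)"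
    unfolding b W_def by (rule qf_steps) (use U B in auto)
  have Zi: "integrable M (\<lambda>\<omega>. Z \<omega> * Z \<omega>)" unfolding Z_def sum_product
    using U A gspan_mult_integrable[OF gspan_F gspan_F, of 1 _ 1]
    by (auto intro!: Bochner_Integration.integrable_sum simp: mult.assoc mult.left_commute[of "F _ _ _"])
  have Wi: "integrable M (\<lambda>\<omega>. W \<omega> * W \<omega>)" unfolding W_def sum_product
    using U B gspan_mult_integrable[OF gspan_F gspan_F, of 1 _ 1]
    by (auto intro!: Bochner_Integration.integrable_sum simp: mult.assoc mult.left_commute[of "F _ _ _"])
  have "(\<integral>\<omega>. Z \<omega> * W \<omega> \<partial>M) \<le> (\<integral>\<omega>. k * (Z \<omega> * Z \<omega>) + 1 / k * (W \<omega> * W \<omega>) \<partial>M)"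
  proof (rule integral_mono)
    show "integrable M (\<lambda>\<omega>. Z \<omega> * W \<omega>)"
      by (rule integrable_mult_of_squares) (use Zi Wi in \<open>auto simp: power2_eq_square\<close>)
    show "integrable M (\<lambda>\<omega>. k * (Z \<omega> * Z \<omega>) + 1 / k * (W \<omega> * W \<omega>))" using Zi Wi by auto
    fix \<omega>
    show "Z \<omega> * W \<omega> \<le> k * (Z \<omega> * Z \<omega>) + 1 / k * (W \<omega> * W \<omega>)"
      using mult_le_weighted_squares[OF k] by (simp add: power2_eq_square)
  qed
  also have "\<dots> = k * (\<integral>\<omega>. Z \<omega> * Z \<omega> \<partial>M) + 1 / k * (\<integral>\<omega>. W \<omega> * W \<omega> \<partial>M)" using Zi Wi by simp
  finally show ?thesis unfolding ZW ZZ WW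
    using k by (simp add: ennreal_mult[symmetric] ennreal_plus[symmetric] ennreal_leI
        integral_nonneg_AE del: ennreal_plus)
qed

lemma simple_bounded_steps:
  fixes a :: "'a \<Rightarrow> real"
  assumes a: "simple_function lborel a" "\<And>y. 0 \<le> a y" "\<And>y. r < norm y \<Longrightarrow> a y = 0"
  obtains U A where "finite U" "\<And>v. v \<in> U \<Longrightarrow> 0 \<le> v" "\<And>v. v \<in> U \<Longrightarrow> A v \<in> bounded_borel"
    "a = (\<lambda>y. \<Sum>v\<in>U. v * indicator (A v) y)"
proof
  \<comment> \<open>Without the value 0 every level set lies in the ball that supports
    \<open>a\<close>, hence is a legitimate argument of the noise.\<close>
  let ?U = "range a - {0}" and ?A = "\<lambda>v. a -` {v}"
  show fin: "finite ?U" using a(1) by (simp add: simple_function_def)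
  show "0 \<le> v" if "v \<in> ?U" for v using that a(2) by auto
  show "?A v \<in> bounded_borel" if "v \<in> ?U" for v
  proof -
    have "a -` {v} \<subseteq> cball 0 r" using a(3) that by (force simp: not_less[symmetric])
    then have "bounded (a -` {v})" by (rule bounded_subset[OF bounded_cball])
    moreover have "a -` {v} \<in> sets borel" using simple_functionD(2)[OF a(1), of "{v}"] by simp
    ultimately show ?thesis by (simp add: bounded_borel_def)
  qed
  show "a = (\<lambda>y. \<Sum>v\<in>?U. v * indicator (?A v) y)"
  proof
    fix y
    have "(\<Sum>v\<in>?U. v * indicator (?A v) y) = (\<Sum>v\<in>?U. if v = a y then a y else 0)"
      by (intro sum.cong) (auto simp: indicator_def)
    also have "\<dots> = a y" using fin by (simp add: sum.delta)
    finally show "a y = (\<Sum>v\<in>?U. v * indicator (?A v) y)" by simp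
  qed
qed

text \<open>The simple approximants are cut off to growing balls because the noise is given on
  bounded sets.\<close>

lemma nonneg_borel_approx:
  fixes a :: "'a \<Rightarrow> real"
  assumes "a \<in> borel_measurable borel" "\<And>y. 0 \<le> a y"
  obtains s :: "nat \<Rightarrow> 'a \<Rightarrow> real" where "\<And>n. simple_function lborel (s n)" "incseq s" "\<And>n y. 0 \<le> s n y"
    "\<And>n y. real n < norm y \<Longrightarrow> s n y = 0" "\<And>y. (\<lambda>n. s n y) \<longlonglongrightarrow> a y" "\<And>n y. s n y \<le> a y"
proof -
  obtain h where h: "\<And>i. simple_function lborel (h i)" "incseq h" "\<And>x. bdd_above (range (\<lambda>i. h i x))"
    "\<And>i x. 0 \<le> h i x" "a = (SUP i. h i)"
    using borel_measurable_implies_simple_function_sequence_real[of a lborel] assms by auto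
  have hm: "incseq (\<lambda>n. h n y)" for y using h(2) by (auto simp: incseq_def le_fun_def)
  have ay: "a y = (SUP i. h i y)" for y
    unfolding h(5) by (simp add: Sup_fun_def image_image)
  have lim: "(\<lambda>n. h n y) \<longlonglongrightarrow> a y" for y
    unfolding ay by (rule LIMSEQ_incseq_SUP[OF h(3) hm])
  define s where "s n y = h n y * indicator (cball 0 (real n)) y" for n y
  show ?thesis
  proof (rule that[of s])
    show "simple_function lborel (s n)" for n
      unfolding s_def using h(1) by (intro simple_function_mult simple_function_indicator) auto
    show "incseq s" unfolding incseq_def le_fun_def s_def
      using hm h(4) by (auto simp: incseq_def indicator_def)
    show "0 \<le> s n y" for n y using h(4) by (simp add: s_def)
    show "s n y = 0" if "real n < norm y" for n y using that by (simp add: s_def)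
    show "s n y \<le> a y" for n y
      using h(4) assms(2)[of y] incseq_le[OF hm lim, of n y] by (auto simp: s_def indicator_def)
    show "(\<lambda>n. s n y) \<longlonglongrightarrow> a y" for y
    proof -
      obtain m :: nat where m: "norm y \<le> real m" using real_arch_simple by blast
      have "\<forall>\<^sub>F n in sequentially. h n y = s n y"
        using eventually_ge_at_top[of m] by eventually_elim (use m in \<open>auto simp: s_def\<close>)
      then show ?thesis using lim by (rule Lim_transform_eventually[rotated])
    qed
  qed
qed

text \<open>Monotone convergence from step functions; nonnegativity makes the products of the
  approximants increase.\<close>

lemma qf_amgm:
  assumes a: "a \<in> borel_measurable borel" "\<And>y. 0 \<le> a y" and b: "b \<in> borel_measurable borel" "\<And>y. 0 \<le> b y"
    and k: "0 < k"
  shows "qf a b \<le> ennreal k * qf a a + ennreal (1 / k) * qf b b"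
proof -
  obtain s where s: "\<And>n. simple_function lborel (s n)" "incseq s" "\<And>n y. 0 \<le> s n y"
    "\<And>n y. real n < norm y \<Longrightarrow> s n y = 0" "\<And>y. (\<lambda>n. s n y) \<longlonglongrightarrow> a y" "\<And>n y. s n y \<le> a y"
    using nonneg_borel_approx[OF a] by blast
  obtain t where t: "\<And>n. simple_function lborel (t n)" "incseq t" "\<And>n y. 0 \<le> t n y"
    "\<And>n y. real n < norm y \<Longrightarrow> t n y = 0" "\<And>y. (\<lambda>n. t n y) \<longlonglongrightarrow> b y" "\<And>n y. t n y \<le> b y"
    using nonneg_borel_approx[OF b] by blast
  have [measurable]: "s n \<in> borel_measurable borel" "t n \<in> borel_measurable borel" for n
    using s(1) t(1) borel_measurable_simple_function[of lborel] by auto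
  note [measurable] = a(1) b(1)
  have mono: "qf c d \<le> qf c' d'" if "\<And>y. 0 \<le> c y" "\<And>y. 0 \<le> d y" "\<And>y. c y \<le> c' y" "\<And>y. d y \<le> d' y" for c d c' d'
    unfolding qf_def using that
    by (intro nn_integral_mono mult_right_mono ennreal_leI mult_mono) (auto intro: order_trans)
  have bd: "qf (s n) (t n) \<le> ennreal k * qf a a + ennreal (1 / k) * qf b b" for n
  proof -
    obtain U A where U: "finite U" "\<And>v. v \<in> U \<Longrightarrow> 0 \<le> v" "\<And>v. v \<in> U \<Longrightarrow> A v \<in> bounded_borel"
      "s n = (\<lambda>y. \<Sum>v\<in>U. v * indicator (A v) y)"
      by (rule simple_bounded_steps[OF s(1) s(3) s(4), of n n]) blast+
    obtain V B where V: "finite V" "\<And>v. v \<in> V \<Longrightarrow> 0 \<le> v" "\<And>v. v \<in> V \<Longrightarrow> B v \<in> bounded_borel"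
      "t n = (\<lambda>y. \<Sum>v\<in>V. v * indicator (B v) y)"
      by (rule simple_bounded_steps[OF t(1) t(3) t(4), of n n]) blast+
    have "qf (s n) (t n) \<le> ennreal k * qf (s n) (s n) + ennreal (1 / k) * qf (t n) (t n)"
      by (rule qf_amgm_steps[OF U(1) V(1) U(2) V(2) U(3) V(3) U(4) V(4) k])
    also have "\<dots> \<le> ennreal k * qf a a + ennreal (1 / k) * qf b b"
      by (intro add_mono mult_left_mono mono s t) auto
    finally show ?thesis .
  qed
  have pair: "qf c d = (\<integral>\<^sup>+p. ennreal (c (fst p) * d (snd p)) * f (fst p) (snd p) \<partial>(lborel \<Otimes>\<^sub>M lborel))"
    if [measurable]: "c \<in> borel_measurable borel" "d \<in> borel_measurable borel" for c d
    unfolding qf_def by (subst lborel.nn_integral_fst[symmetric]) auto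
  have "(\<lambda>n. qf (s n) (t n)) \<longlonglongrightarrow> qf a b"
    unfolding pair[OF a(1) b(1)] pair[OF \<open>\<And>n. s n \<in> borel_measurable borel\<close> \<open>\<And>n. t n \<in> borel_measurable borel\<close>]
  proof (rule nn_integral_LIMSEQ)
    show "incseq (\<lambda>n p. ennreal (s n (fst p) * t n (snd p)) * f (fst p) (snd p))"
      using s(2,3) t(2,3) unfolding incseq_def le_fun_def
      by (auto intro!: mult_right_mono ennreal_leI mult_mono)
    show "\<And>n. (\<lambda>p. ennreal (s n (fst p) * t n (snd p)) * f (fst p) (snd p)) \<in> borel_measurable (lborel \<Otimes>\<^sub>M lborel)"
      by measurable
    fix p
    \<comment> \<open>Since \<open>f\<close> may be infinite, multiplication by it need not be
      continuous; the limit is therefore written as a supremum, which commutes with the factor in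
      [0, \<infinity>].\<close>
    have "(\<lambda>n. ennreal (s n (fst p) * t n (snd p))) \<longlonglongrightarrow> ennreal (a (fst p) * b (snd p))"
      by (intro tendsto_ennrealI tendsto_mult s t)
    moreover have "incseq (\<lambda>n. ennreal (s n (fst p) * t n (snd p)))"
      using s(2,3) t(2,3) unfolding incseq_def le_fun_def by (auto intro!: ennreal_leI mult_mono)
    ultimately have sup: "ennreal (a (fst p) * b (snd p)) = (SUP n. ennreal (s n (fst p) * t n (snd p)))"
      using LIMSEQ_SUP LIMSEQ_unique by blast
    have "incseq (\<lambda>n. ennreal (s n (fst p) * t n (snd p)) * f (fst p) (snd p))"
      using s(2,3) t(2,3) unfolding incseq_def le_fun_def by (auto intro!: mult_right_mono ennreal_leI mult_mono)
    from LIMSEQ_SUP[OF this] show "(\<lambda>n. ennreal (s n (fst p) * t n (snd p)) * f (fst p) (snd p))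
       \<longlonglongrightarrow> ennreal (a (fst p) * b (snd p)) * f (fst p) (snd p)"
      unfolding sup SUP_mult_right_ennreal .
  qed
  then show ?thesis by (rule LIMSEQ_le_const2) (use bd in auto)
qed

text \<open>Chance, time and two space points, weighted by \<open>f\<close>. Walsh's norm is the
  integral of an absolute product against this measure, so signed products can be handled by Bochner
  integration.\<close>

definition walsh_measure :: "real \<Rightarrow> ('w \<times> real \<times> 'a \<times> 'a) measure" where
  "walsh_measure t = density (M \<Otimes>\<^sub>M lborel \<Otimes>\<^sub>M lborel \<Otimes>\<^sub>M lborel)
     (\<lambda>(\<omega>, s, y, z). indicator {0<..<t} s * f y z)"

lemma sets_walsh_measure [measurable_cong]:
  "sets (walsh_measure t) = sets (M \<Otimes>\<^sub>M borel \<Otimes>\<^sub>M borel \<Otimes>\<^sub>M borel)"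
  unfolding walsh_measure_def by (simp cong: sets_pair_measure_cong)

lemma nn_integral_walsh_measure:
  assumes [measurable]: "h \<in> borel_measurable (M \<Otimes>\<^sub>M borel \<Otimes>\<^sub>M borel \<Otimes>\<^sub>M borel)"
  shows "(\<integral>\<^sup>+p. h p \<partial>walsh_measure t)
    = (\<integral>\<^sup>+\<omega>. (\<integral>\<^sup>+s\<in>{0<..<t}. (\<integral>\<^sup>+y. (\<integral>\<^sup>+z. h (\<omega>, s, y, z) * f y z \<partial>lborel) \<partial>lborel) \<partial>lborel) \<partial>M)"
proof -
  have sf2: "sigma_finite_measure (lborel \<Otimes>\<^sub>M lborel :: ('a \<times> 'a) measure)"
    unfolding lborel_prod by (rule sigma_finite_lborel)
  have sf3: "sigma_finite_measure (lborel \<Otimes>\<^sub>M lborel \<Otimes>\<^sub>M lborel :: (real \<times> 'a \<times> 'a) measure)"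
    unfolding lborel_prod by (rule sigma_finite_lborel)
  have "(\<integral>\<^sup>+p. h p \<partial>walsh_measure t)
    = (\<integral>\<^sup>+p. (case p of (\<omega>, s, y, z) \<Rightarrow> indicator {0<..<t} s * f y z) * h p \<partial>(M \<Otimes>\<^sub>M lborel \<Otimes>\<^sub>M lborel \<Otimes>\<^sub>M lborel))"
    unfolding walsh_measure_def by (rule nn_integral_density) auto
  also have "\<dots> = (\<integral>\<^sup>+\<omega>. (\<integral>\<^sup>+s. (\<integral>\<^sup>+y. (\<integral>\<^sup>+z. indicator {0<..<t} s * f y z * h (\<omega>, s, y, z)
       \<partial>lborel) \<partial>lborel) \<partial>lborel) \<partial>M)"
    by (simp add: sigma_finite_measure.nn_integral_fst[OF sf3, symmetric]
        sigma_finite_measure.nn_integral_fst[OF sf2, symmetric] lborel.nn_integral_fst[symmetric] cong: nn_integral_cong)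
  also have "\<dots> = (\<integral>\<^sup>+\<omega>. (\<integral>\<^sup>+s\<in>{0<..<t}. (\<integral>\<^sup>+y. (\<integral>\<^sup>+z. h (\<omega>, s, y, z) * f y z \<partial>lborel) \<partial>lborel) \<partial>lborel) \<partial>M)"
    by (intro nn_integral_cong) (auto simp: indicator_def mult.commute)
  finally show ?thesis .
qed

text \<open>Joint measurability is asked on the whole time axis; integrands given only on (0, t) are
  first extended by 0.\<close>

definition random_field :: "(real \<Rightarrow> 'a \<Rightarrow> 'w \<Rightarrow> real) \<Rightarrow> bool" where
  "random_field \<Phi> \<longleftrightarrow> (\<lambda>(s, y, \<omega>). \<Phi> s y \<omega>) \<in> borel_measurable (borel \<Otimes>\<^sub>M borel \<Otimes>\<^sub>M M)"

lemma random_field_measurable: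
  assumes "random_field \<Phi>" "h1 \<in> borel_measurable N" "h2 \<in> borel_measurable N" "h3 \<in> measurable N M"
  shows "(\<lambda>x. \<Phi> (h1 x) (h2 x) (h3 x)) \<in> borel_measurable N"
  using measurable_compose[of "\<lambda>x. (h1 x, h2 x, h3 x)" N, OF _ assms(1)[unfolded random_field_def]] assms by simp

definition left :: "(real \<Rightarrow> 'a \<Rightarrow> 'w \<Rightarrow> real) \<Rightarrow> 'w \<times> real \<times> 'a \<times> 'a \<Rightarrow> real" where
  "left \<Phi> = (\<lambda>(\<omega>, s, y, z). \<Phi> s y \<omega>)"

definition right :: "(real \<Rightarrow> 'a \<Rightarrow> 'w \<Rightarrow> real) \<Rightarrow> 'w \<times> real \<times> 'a \<times> 'a \<Rightarrow> real" where
  "right \<Phi> = (\<lambda>(\<omega>, s, y, z). \<Phi> s z \<omega>)"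

lemma left_right_measurable [measurable (raw)]:
  assumes "random_field \<Phi>"
  shows "left \<Phi> \<in> borel_measurable (walsh_measure t)" "right \<Phi> \<in> borel_measurable (walsh_measure t)"
    "left \<Phi> \<in> borel_measurable (M \<Otimes>\<^sub>M borel \<Otimes>\<^sub>M borel \<Otimes>\<^sub>M borel)"
    "right \<Phi> \<in> borel_measurable (M \<Otimes>\<^sub>M borel \<Otimes>\<^sub>M borel \<Otimes>\<^sub>M borel)"
proof -
  show "left \<Phi> \<in> borel_measurable (M \<Otimes>\<^sub>M borel \<Otimes>\<^sub>M borel \<Otimes>\<^sub>M borel)"
    unfolding left_def case_prod_unfold by (rule random_field_measurable[OF assms]) measurable
  show "right \<Phi> \<in> borel_measurable (M \<Otimes>\<^sub>M borel \<Otimes>\<^sub>M borel \<Otimes>\<^sub>M borel)"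
    unfolding right_def case_prod_unfold by (rule random_field_measurable[OF assms]) measurable
  then show "left \<Phi> \<in> borel_measurable (walsh_measure t)" "right \<Phi> \<in> borel_measurable (walsh_measure t)"
    using \<open>left \<Phi> \<in> _\<close> by (simp_all cong: measurable_cong_sets add: sets_walsh_measure)
qed

text \<open>The polarized form of \<open>walsh_norm_sq\<close>; different arguments occur in the
  mixed terms of the limits.\<close>

definition wq :: "real \<Rightarrow> (real \<Rightarrow> 'a \<Rightarrow> 'w \<Rightarrow> real) \<Rightarrow> (real \<Rightarrow> 'a \<Rightarrow> 'w \<Rightarrow> real) \<Rightarrow> ennreal" where
  "wq t \<Phi> \<Psi> = (\<integral>\<^sup>+p. ennreal (\<bar>left \<Phi> p\<bar> * \<bar>right \<Psi> p\<bar>) \<partial>walsh_measure t)"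

lemma wq_eq:
  assumes [measurable]: "random_field \<Phi>" "random_field \<Psi>"
  shows "wq t \<Phi> \<Psi> = (\<integral>\<^sup>+\<omega>. (\<integral>\<^sup>+s\<in>{0<..<t}. qf (\<lambda>y. \<bar>\<Phi> s y \<omega>\<bar>) (\<lambda>y. \<bar>\<Psi> s y \<omega>\<bar>) \<partial>lborel) \<partial>M)"
proof -
  have "(\<lambda>p. ennreal (\<bar>left \<Phi> p\<bar> * \<bar>right \<Psi> p\<bar>)) \<in> borel_measurable (M \<Otimes>\<^sub>M borel \<Otimes>\<^sub>M borel \<Otimes>\<^sub>M borel)"
    by measurable
  from nn_integral_walsh_measure[OF this] show ?thesis
    unfolding wq_def qf_def by (simp add: left_def right_def)
qed

lemma walsh_norm_sq_eq: "random_field \<Phi> \<Longrightarrow> walsh_norm_sq M f t \<Phi> = wq t \<Phi> \<Phi>"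
  by (simp add: walsh_norm_sq_def wq_eq qf_def)

text \<open>\<open>qf_amgm\<close> at fixed time and chance, then integrated; most of the proof is
  the measurability needed to split the integral of the sum.\<close>

lemma wq_amgm:
  assumes \<Phi>: "random_field \<Phi>" and \<Psi>: "random_field \<Psi>" and k: "0 < k"
  shows "wq t \<Phi> \<Psi> \<le> ennreal k * wq t \<Phi> \<Phi> + ennreal (1 / k) * wq t \<Psi> \<Psi>"
proof -
  define A where "A \<Phi> \<Psi> s \<omega> = qf (\<lambda>y. \<bar>\<Phi> s y \<omega>\<bar>) (\<lambda>y. \<bar>\<Psi> s y \<omega>\<bar>)"
    for \<Phi> \<Psi> :: "real \<Rightarrow> 'a \<Rightarrow> 'w \<Rightarrow> real" and s \<omega>
  have Am: "(\<lambda>(\<omega>, s). A \<Phi> \<Psi> s \<omega>) \<in> borel_measurable (M \<Otimes>\<^sub>M borel)" if "random_field \<Phi>" "random_field \<Psi>" for \<Phi> \<Psi>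
  proof -
    have [measurable]: "(\<lambda>p. \<Phi> (snd (fst (fst p))) (snd (fst p)) (fst (fst (fst p))))
        \<in> borel_measurable (((M \<Otimes>\<^sub>M borel) \<Otimes>\<^sub>M borel) \<Otimes>\<^sub>M borel)"
      by (rule random_field_measurable[OF that(1)]) measurable
    have [measurable]: "(\<lambda>p. \<Psi> (snd (fst (fst p))) (snd p) (fst (fst (fst p))))
        \<in> borel_measurable (((M \<Otimes>\<^sub>M borel) \<Otimes>\<^sub>M borel) \<Otimes>\<^sub>M borel)"
      by (rule random_field_measurable[OF that(2)]) measurable
    have 1: "(\<lambda>(p, z). ennreal (\<bar>\<Phi> (snd (fst p)) (snd p) (fst (fst p))\<bar> * \<bar>\<Psi> (snd (fst p)) z (fst (fst p))\<bar>) * f (snd p) z)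
       \<in> borel_measurable (((M \<Otimes>\<^sub>M borel) \<Otimes>\<^sub>M borel) \<Otimes>\<^sub>M lborel)"
      unfolding case_prod_unfold by measurable
    have 2: "(\<lambda>(p, y). \<integral>\<^sup>+z. ennreal (\<bar>\<Phi> (snd p) y (fst p)\<bar> * \<bar>\<Psi> (snd p) z (fst p)\<bar>) * f y z \<partial>lborel)
       \<in> borel_measurable ((M \<Otimes>\<^sub>M borel) \<Otimes>\<^sub>M lborel)"
      using lborel.borel_measurable_nn_integral[OF 1] by (simp add: case_prod_unfold cong: measurable_cong_sets)
    show ?thesis
      using lborel.borel_measurable_nn_integral[OF 2] by (simp add: A_def qf_def case_prod_unfold)
  qed
  have m1: "(\<lambda>s. A \<Phi> \<Phi> s \<omega> * indicator {0<..<t} s) \<in> borel_measurable lborel" if "random_field \<Phi>" "\<omega> \<in> space M" for \<Phi> \<omega>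
    using measurable_compose[OF measurable_Pair1'[OF that(2)] Am[OF that(1,1)]] by simp
  have m2: "(\<lambda>\<omega>. \<integral>\<^sup>+s\<in>{0<..<t}. A \<Phi> \<Phi> s \<omega> \<partial>lborel) \<in> borel_measurable M" if "random_field \<Phi>" for \<Phi>
  proof (rule lborel.borel_measurable_nn_integral)
    show "(\<lambda>(\<omega>, s). A \<Phi> \<Phi> s \<omega> * indicator {0<..<t} s) \<in> borel_measurable (M \<Otimes>\<^sub>M lborel)"
      using Am[OF that that] unfolding case_prod_unfold by measurable
  qed
  have "wq t \<Phi> \<Psi> = (\<integral>\<^sup>+\<omega>. (\<integral>\<^sup>+s\<in>{0<..<t}. A \<Phi> \<Psi> s \<omega> \<partial>lborel) \<partial>M)"
    unfolding wq_eq[OF \<Phi> \<Psi>] A_def ..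
  also have "\<dots> \<le> (\<integral>\<^sup>+\<omega>. (\<integral>\<^sup>+s. ennreal k * (A \<Phi> \<Phi> s \<omega> * indicator {0<..<t} s)
      + ennreal (1 / k) * (A \<Psi> \<Psi> s \<omega> * indicator {0<..<t} s) \<partial>lborel) \<partial>M)"
  proof (intro nn_integral_mono)
    fix \<omega> s assume \<omega>: "\<omega> \<in> space M"
    have m: "(\<lambda>y. \<bar>\<Phi> s y \<omega>\<bar>) \<in> borel_measurable borel" if "random_field \<Phi>" for \<Phi>
      using random_field_measurable[OF that, of "\<lambda>_. s" borel "\<lambda>y. y" "\<lambda>_. \<omega>"] \<omega> by simp
    have "A \<Phi> \<Psi> s \<omega> \<le> ennreal k * A \<Phi> \<Phi> s \<omega> + ennreal (1 / k) * A \<Psi> \<Psi> s \<omega>"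
      unfolding A_def by (rule qf_amgm) (use m \<Phi> \<Psi> k in auto)
    then show "A \<Phi> \<Psi> s \<omega> * indicator {0<..<t} s \<le> ennreal k * (A \<Phi> \<Phi> s \<omega> * indicator {0<..<t} s)
      + ennreal (1 / k) * (A \<Psi> \<Psi> s \<omega> * indicator {0<..<t} s)"
      by (auto simp: indicator_def)
  qed
  also have "\<dots> = ennreal k * (\<integral>\<^sup>+\<omega>. (\<integral>\<^sup>+s\<in>{0<..<t}. A \<Phi> \<Phi> s \<omega> \<partial>lborel) \<partial>M)
      + ennreal (1 / k) * (\<integral>\<^sup>+\<omega>. (\<integral>\<^sup>+s\<in>{0<..<t}. A \<Psi> \<Psi> s \<omega> \<partial>lborel) \<partial>M)"
    using m1 m2 \<Phi> \<Psi> by (simp add: nn_integral_add nn_integral_cmult cong: nn_integral_cong_simp)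
  also have "\<dots> = ennreal k * wq t \<Phi> \<Phi> + ennreal (1 / k) * wq t \<Psi> \<Psi>"
    unfolding wq_eq[OF \<Phi> \<Phi>] wq_eq[OF \<Psi> \<Psi>] A_def ..
  finally show ?thesis .
qed

lemma random_field_diff: "random_field \<Phi> \<Longrightarrow> random_field \<Psi> \<Longrightarrow> random_field (\<lambda>s y \<omega>. \<Phi> s y \<omega> - \<Psi> s y \<omega>)"
  by (auto simp: random_field_def case_prod_unfold)

text \<open>Each of the two mixed terms costs one copy of both squares by \<open>wq_amgm\<close>
  with weight 1, which yields the factor 3, rounded up to 4.\<close>

lemma wq_triangle:
  assumes \<Phi>: "random_field \<Phi>" and \<Psi>: "random_field \<Psi>"
  shows "wq t \<Phi> \<Phi> \<le> 4 * wq t (\<lambda>s y \<omega>. \<Phi> s y \<omega> - \<Psi> s y \<omega>) (\<lambda>s y \<omega>. \<Phi> s y \<omega> - \<Psi> s y \<omega>) + 4 * wq t \<Psi> \<Psi>"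
proof -
  define \<Delta> where "\<Delta> = (\<lambda>s y \<omega>. \<Phi> s y \<omega> - \<Psi> s y \<omega>)"
  have \<Delta>: "random_field \<Delta>" unfolding \<Delta>_def by (rule random_field_diff[OF \<Phi> \<Psi>])
  note [measurable] = \<Phi> \<Psi> \<Delta>
  have "wq t \<Phi> \<Phi> \<le> (\<integral>\<^sup>+p. (ennreal (\<bar>left \<Delta> p\<bar> * \<bar>right \<Delta> p\<bar>) + ennreal (\<bar>left \<Delta> p\<bar> * \<bar>right \<Psi> p\<bar>))
    + (ennreal (\<bar>left \<Psi> p\<bar> * \<bar>right \<Delta> p\<bar>) + ennreal (\<bar>left \<Psi> p\<bar> * \<bar>right \<Psi> p\<bar>)) \<partial>walsh_measure t)"
    unfolding wq_def
  proof (rule nn_integral_mono)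
    fix p
    have "\<bar>left \<Phi> p\<bar> \<le> \<bar>left \<Delta> p\<bar> + \<bar>left \<Psi> p\<bar>" "\<bar>right \<Phi> p\<bar> \<le> \<bar>right \<Delta> p\<bar> + \<bar>right \<Psi> p\<bar>"
      by (auto simp: \<Delta>_def left_def right_def case_prod_unfold)
    then have "\<bar>left \<Phi> p\<bar> * \<bar>right \<Phi> p\<bar> \<le> (\<bar>left \<Delta> p\<bar> + \<bar>left \<Psi> p\<bar>) * (\<bar>right \<Delta> p\<bar> + \<bar>right \<Psi> p\<bar>)"
      by (intro mult_mono) auto
    then show "ennreal (\<bar>left \<Phi> p\<bar> * \<bar>right \<Phi> p\<bar>)
       \<le> (ennreal (\<bar>left \<Delta> p\<bar> * \<bar>right \<Delta> p\<bar>) + ennreal (\<bar>left \<Delta> p\<bar> * \<bar>right \<Psi> p\<bar>))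
         + (ennreal (\<bar>left \<Psi> p\<bar> * \<bar>right \<Delta> p\<bar>) + ennreal (\<bar>left \<Psi> p\<bar> * \<bar>right \<Psi> p\<bar>))"
      by (simp add: ennreal_plus[symmetric] ennreal_leI algebra_simps del: ennreal_plus)
  qed
  also have "\<dots> = (wq t \<Delta> \<Delta> + wq t \<Delta> \<Psi>) + (wq t \<Psi> \<Delta> + wq t \<Psi> \<Psi>)"
    unfolding wq_def by (simp add: nn_integral_add)
  also have "\<dots> \<le> (wq t \<Delta> \<Delta> + (wq t \<Delta> \<Delta> + wq t \<Psi> \<Psi>)) + ((wq t \<Psi> \<Psi> + wq t \<Delta> \<Delta>) + wq t \<Psi> \<Psi>)"
    using wq_amgm[OF \<Delta> \<Psi>, of 1 t] wq_amgm[OF \<Psi> \<Delta>, of 1 t] by (intro add_mono order_refl) simp_all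
  also have "\<dots> = 3 * wq t \<Delta> \<Delta> + 3 * wq t \<Psi> \<Psi>"
  proof -
    have "3 * x = x + x + x" for x :: ennreal
    proof -
      have "3 * x = (1 + (1 + 1)) * x" by simp
      then show ?thesis by (simp only: distrib_right mult_1 add.assoc)
    qed
    from this[of "wq t \<Delta> \<Delta>"] this[of "wq t \<Psi> \<Psi>"] show ?thesis
      by (simp only: ac_simps)
  qed
  also have "\<dots> \<le> 4 * wq t \<Delta> \<Delta> + 4 * wq t \<Psi> \<Psi>"
    by (intro add_mono mult_right_mono) auto
  finally show ?thesis unfolding \<Delta>_def .
qed

lemma wq_tendsto_0:
  assumes "\<And>n. random_field (\<Phi> n)" "random_field \<Psi>" and lim: "(\<lambda>n. wq t (\<Phi> n) (\<Phi> n)) \<longlonglongrightarrow> 0" and fin: "wq t \<Psi> \<Psi> < \<infinity>"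
  shows "(\<lambda>n. wq t (\<Phi> n) \<Psi>) \<longlonglongrightarrow> 0" "(\<lambda>n. wq t \<Psi> (\<Phi> n)) \<longlonglongrightarrow> 0"
proof -
  show "(\<lambda>n. wq t (\<Phi> n) \<Psi>) \<longlonglongrightarrow> 0"
    by (rule tendsto_zero_by_weighted_bound[OF lim fin wq_amgm]) (use assms in auto)
  show "(\<lambda>n. wq t \<Psi> (\<Phi> n)) \<longlonglongrightarrow> 0"
  proof (rule tendsto_zero_by_weighted_bound[OF lim fin])
    fix n and k :: real assume "0 < k"
    \<comment> \<open>The vanishing factor now stands second, so the weight is inverted.\<close>
    then show "wq t \<Psi> (\<Phi> n) \<le> ennreal k * wq t (\<Phi> n) (\<Phi> n) + ennreal (1 / k) * wq t \<Psi> \<Psi>"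
      using wq_amgm[of \<Psi> "\<Phi> n" "1 / k" t] assms by (simp add: add.commute)
  qed
qed

lemma wq_tendsto_0_0:
  assumes "\<And>n. random_field (\<Phi> n)" "\<And>n. random_field (\<Psi> n)"
    and lim: "(\<lambda>n. wq t (\<Phi> n) (\<Phi> n)) \<longlonglongrightarrow> 0" "(\<lambda>n. wq t (\<Psi> n) (\<Psi> n)) \<longlonglongrightarrow> 0"
  shows "(\<lambda>n. wq t (\<Phi> n) (\<Psi> n)) \<longlonglongrightarrow> 0"
proof (rule tendsto_sandwich[OF _ _ tendsto_const])
  show "\<forall>\<^sub>F n in sequentially. wq t (\<Phi> n) (\<Psi> n) \<le> wq t (\<Phi> n) (\<Phi> n) + wq t (\<Psi> n) (\<Psi> n)"
    using wq_amgm[OF assms(1,2), of 1] by simp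
  show "(\<lambda>n. wq t (\<Phi> n) (\<Phi> n) + wq t (\<Psi> n) (\<Psi> n)) \<longlonglongrightarrow> 0"
    using tendsto_add[OF lim] by simp
qed simp

lemma walsh_measure_rectangle_nonneg:
  assumes V: "integrable M V" "\<And>\<omega>. 0 \<le> V \<omega>" and J: "J \<in> sets borel"
    and A: "A \<in> bounded_borel" and B: "B \<in> bounded_borel"
  shows "has_bochner_integral (walsh_measure t)
      (\<lambda>(\<omega>, s, y, z). V \<omega> * indicator J s * (indicator A y * indicator B z))
      ((\<integral>\<omega>. V \<omega> \<partial>M) * (measure lborel (J \<inter> {0<..<t}) * q A B))"
proof (rule has_bochner_integral_nn_integral)
  have [measurable]: "V \<in> borel_measurable M" "A \<in> sets borel" "B \<in> sets borel"
    using V A B by (auto simp: bounded_borel_def)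
  note [measurable] = J
  show "(\<lambda>(\<omega>, s, y, z). V \<omega> * indicator J s * (indicator A y * indicator B z)) \<in> borel_measurable (walsh_measure t)"
    by measurable
  have q0: "0 \<le> q A B" by (simp add: q_def)
  have fin: "emeasure lborel (J \<inter> {0<..<t}) = ennreal (measure lborel (J \<inter> {0<..<t}))"
  proof (rule emeasure_eq_ennreal_measure)
    have "emeasure lborel (J \<inter> {0<..<t}) \<le> emeasure lborel {0<..<t}" by (rule emeasure_mono) auto
    also have "\<dots> < top" by (cases "0 \<le> t") auto
    finally show "emeasure lborel (J \<inter> {0<..<t}) \<noteq> top" by simp
  qed
  have "(\<integral>\<^sup>+p. ennreal (case p of (\<omega>, s, y, z) \<Rightarrow> V \<omega> * indicator J s * (indicator A y * indicator B z)) \<partial>walsh_measure t)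
    = (\<integral>\<^sup>+\<omega>. (\<integral>\<^sup>+s\<in>{0<..<t}. (\<integral>\<^sup>+y. (\<integral>\<^sup>+z. ennreal (V \<omega> * indicator J s * (indicator A y * indicator B z))
        * f y z \<partial>lborel) \<partial>lborel) \<partial>lborel) \<partial>M)"
    by (subst nn_integral_walsh_measure) auto
  also have "\<dots> = (\<integral>\<^sup>+\<omega>. (\<integral>\<^sup>+s. (ennreal (V \<omega>) * indicator (J \<inter> {0<..<t}) s) * (\<integral>\<^sup>+y. (\<integral>\<^sup>+z. f y z * indicator B z \<partial>lborel)
         * indicator A y \<partial>lborel) \<partial>lborel) \<partial>M)"
  proof (intro nn_integral_cong)
    fix \<omega> s
    have eq: "ennreal (V \<omega> * indicator J s * (indicator A y * indicator B z)) * f y z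
      = (ennreal (V \<omega>) * indicator J s) * ((f y z * indicator B z) * indicator A y)" for y z
      by (auto simp: indicator_def)
    show "(\<integral>\<^sup>+y. (\<integral>\<^sup>+z. ennreal (V \<omega> * indicator J s * (indicator A y * indicator B z))
        * f y z \<partial>lborel) \<partial>lborel) * indicator {0<..<t} s
       = (ennreal (V \<omega>) * indicator (J \<inter> {0<..<t}) s) * (\<integral>\<^sup>+y. (\<integral>\<^sup>+z. f y z * indicator B z \<partial>lborel)
         * indicator A y \<partial>lborel)"
      unfolding eq by (simp add: nn_integral_cmult nn_integral_multc) (auto simp: indicator_def)
  qed
  also have "\<dots> = (\<integral>\<^sup>+\<omega>. ennreal (V \<omega>) * (emeasure lborel (J \<inter> {0<..<t}) * ennreal (q A B)) \<partial>M)"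
    unfolding f_integral_eq_q[OF A B]
    by (simp add: nn_integral_cmult nn_integral_multc mult.assoc)
  also have "\<dots> = (\<integral>\<^sup>+\<omega>. ennreal (V \<omega>) \<partial>M) * (emeasure lborel (J \<inter> {0<..<t}) * ennreal (q A B))"
    by (rule nn_integral_multc) simp
  also have "(\<integral>\<^sup>+\<omega>. ennreal (V \<omega>) \<partial>M) = ennreal (\<integral>\<omega>. V \<omega> \<partial>M)"
    by (rule nn_integral_eq_integral) (use V in auto)
  also have "ennreal (\<integral>\<omega>. V \<omega> \<partial>M) * (emeasure lborel (J \<inter> {0<..<t}) * ennreal (q A B))
    = ennreal ((\<integral>\<omega>. V \<omega> \<partial>M) * (measure lborel (J \<inter> {0<..<t}) * q A B))"
    unfolding fin by (simp add: ennreal_mult[symmetric] q0 V integral_nonneg_AE)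
  finally show "(\<integral>\<^sup>+p. ennreal (case p of (\<omega>, s, y, z) \<Rightarrow> V \<omega> * indicator J s * (indicator A y * indicator B z)) \<partial>walsh_measure t)
    = ennreal ((\<integral>\<omega>. V \<omega> \<partial>M) * (measure lborel (J \<inter> {0<..<t}) * q A B))" .
  show "0 \<le> (\<integral>\<omega>. V \<omega> \<partial>M) * (measure lborel (J \<inter> {0<..<t}) * q A B)"
    using q0 V by (intro mult_nonneg_nonneg integral_nonneg_AE) auto
qed (use V in auto)

lemma walsh_measure_rectangle:
  assumes V: "integrable M V" and J: "J \<in> sets borel"
    and A: "A \<in> bounded_borel" and B: "B \<in> bounded_borel"
  shows "has_bochner_integral (walsh_measure t)
      (\<lambda>(\<omega>, s, y, z). V \<omega> * indicator J s * (indicator A y * indicator B z))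
      ((\<integral>\<omega>. V \<omega> \<partial>M) * (measure lborel (J \<inter> {0<..<t}) * q A B))"
proof -
  define P where "P = (\<lambda>\<omega>. max (V \<omega>) 0)"
  define N where "N = (\<lambda>\<omega>. max (- V \<omega>) 0)"
  have P: "integrable M P" "\<And>\<omega>. 0 \<le> P \<omega>" and N: "integrable M N" "\<And>\<omega>. 0 \<le> N \<omega>"
    using V by (auto simp: P_def N_def)
  have PN: "V \<omega> = P \<omega> - N \<omega>" for \<omega> by (simp add: P_def N_def)
  have VPN: "(\<integral>\<omega>. V \<omega> \<partial>M) = (\<integral>\<omega>. P \<omega> \<partial>M) - (\<integral>\<omega>. N \<omega> \<partial>M)"
    unfolding PN using P N by simp
  have "(\<lambda>(\<omega>, s, y, z). V \<omega> * indicator J s * (indicator A y * indicator B z))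
    = (\<lambda>p. (case p of (\<omega>, s, y, z) \<Rightarrow> P \<omega> * indicator J s * (indicator A y * indicator B z))
         - (case p of (\<omega>, s, y, z) \<Rightarrow> N \<omega> * indicator J s * (indicator A y * indicator B z)))"
    by (auto simp: PN algebra_simps)
  then show ?thesis unfolding VPN left_diff_distrib
    using has_bochner_integral_diff[OF walsh_measure_rectangle_nonneg[OF P J A B] walsh_measure_rectangle_nonneg[OF N J A B], of t]
    by simp
qed

section \<open>The isometry for elementary integrands\<close>

definition cell_fun :: "real \<times> real \<times> 'a set \<times> ('w \<Rightarrow> real) \<Rightarrow> real \<Rightarrow> 'a \<Rightarrow> 'w \<Rightarrow> real" where
  "cell_fun e s y \<omega> = (case e of (a, b, A, X) \<Rightarrow> X \<omega> * indicator {a<..b} s * indicator A y)"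

definition cell_integral :: "real \<Rightarrow> real \<times> real \<times> 'a set \<times> ('w \<Rightarrow> real) \<Rightarrow> 'w \<Rightarrow> real" where
  "cell_integral t e \<omega> = (case e of (a, b, A, X) \<Rightarrow> X \<omega> * (F (min b t) A \<omega> - F (min a t) A \<omega>))"

text \<open>The sum runs over positions of the list, since an elementary integrand may list the same
  tuple twice.\<close>

lemma elementary_fun_cells: "elementary_fun S s y \<omega> = (\<Sum>i<length S. cell_fun (S ! i) s y \<omega>)"
  unfolding elementary_fun_def cell_fun_def by (simp add: sum_list_sum_nth atLeast0LessThan)

lemma elementary_integral_cells: "elementary_integral F t S \<omega> = (\<Sum>i<length S. cell_integral t (S ! i) \<omega>)"
  unfolding elementary_integral_def cell_integral_def by (simp add: sum_list_sum_nth atLeast0LessThan)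

text \<open>The half-open intersection lies between the open and the closed interval with endpoints
  \<open>max a a'\<close> and the smallest of b, b' and t, and these two have the same
  length.\<close>

lemma measure_interval_inter:
  assumes "0 \<le> a" "0 \<le> a'" "0 \<le> t"
  shows "measure lborel (({a<..b} \<inter> {a'<..b'}) \<inter> {0<..<t}) = max 0 (min (min b t) (min b' t) - max a a')"
proof -
  let ?l = "max a a'" and ?u = "min (min b t) (min b' t)"
  let ?S = "({a<..b} \<inter> {a'<..b'}) \<inter> {0<..<t}"
  have "emeasure lborel {?l<..<?u} \<le> emeasure lborel ?S"
    using assms by (intro emeasure_mono) auto
  moreover have "emeasure lborel ?S \<le> emeasure lborel {?l..?u}"
    by (intro emeasure_mono) auto
  ultimately have "emeasure lborel ?S = ennreal (max 0 (?u - ?l))"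
    by (cases "?l \<le> ?u") (auto simp: max_def split: if_splits)
  then show ?thesis by (rule measure_eq_emeasure_eq_ennreal[rotated]) simp
qed

text \<open>Both sides equal the mean of the product of the weights times the length of the common
  time interval up to \<open>t\<close> times \<open>q A A'\<close>: one by
  \<open>walsh_measure_rectangle\<close>, the other by
  \<open>weighted_increment_cov\<close>.\<close>

lemma cell_isometry:
  assumes e: "elementary M F [e]" and e': "elementary M F [e']" and t: "0 \<le> t"
  shows "has_bochner_integral (walsh_measure t) (\<lambda>(\<omega>, s, y, z). cell_fun e s y \<omega> * cell_fun e' s z \<omega>)
      (\<integral>\<omega>. cell_integral t e \<omega> * cell_integral t e' \<omega> \<partial>M)"
    and "integrable M (\<lambda>\<omega>. cell_integral t e \<omega> * cell_integral t e' \<omega>)"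
proof -
  obtain a b A X where E: "e = (a, b, A, X)" by (cases e)
  obtain a' b' A' X' where E': "e' = (a', b', A', X')" by (cases e')
  obtain c c' where ab: "0 \<le> a" "a \<le> b" "0 \<le> a'" "a' \<le> b'" and A: "A \<in> bounded_borel" "A' \<in> bounded_borel"
    and X: "X \<in> borel_measurable (noise_filtration M F a)" "\<And>\<omega>. \<omega> \<in> space M \<Longrightarrow> \<bar>X \<omega>\<bar> \<le> c"
    and X': "X' \<in> borel_measurable (noise_filtration M F a')" "\<And>\<omega>. \<omega> \<in> space M \<Longrightarrow> \<bar>X' \<omega>\<bar> \<le> c'"
    using e e' by (auto simp: elementary_def E E')
  note [measurable] = measurable_noise_filtration[OF X(1)] measurable_noise_filtration[OF X'(1)]
  have XX: "integrable M (\<lambda>\<omega>. X \<omega> * X' \<omega>)"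
  proof (rule integrable_bounded_mult[OF _ _ X(2)])
    show "integrable M X'" by (rule integrable_const_bound[of _ c']) (use X' in auto)
  qed auto
  let ?J = "{a<..b} \<inter> {a'<..b'}"
  have 1: "has_bochner_integral (walsh_measure t) (\<lambda>(\<omega>, s, y, z). cell_fun e s y \<omega> * cell_fun e' s z \<omega>)
      ((\<integral>\<omega>. X \<omega> * X' \<omega> \<partial>M) * (measure lborel (?J \<inter> {0<..<t}) * q A A'))"
  proof -
    have "(\<lambda>(\<omega>, s, y, z). cell_fun e s y \<omega> * cell_fun e' s z \<omega>)
      = (\<lambda>(\<omega>, s, y, z). (X \<omega> * X' \<omega>) * indicator ?J s * (indicator A y * indicator A' z))"
      unfolding cell_fun_def E E' by (auto simp: indicator_def fun_eq_iff)
    then show ?thesis using walsh_measure_rectangle[OF XX _ A, of ?J t] by simp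
  qed
  have 2: "integrable M (\<lambda>\<omega>. cell_integral t e \<omega> * cell_integral t e' \<omega>) \<and>
    (\<integral>\<omega>. cell_integral t e \<omega> * cell_integral t e' \<omega> \<partial>M)
      = (\<integral>\<omega>. X \<omega> * X' \<omega> \<partial>M) * (measure lborel (?J \<inter> {0<..<t}) * q A A')"
  proof (cases "a \<le> t \<and> a' \<le> t")
    case True
    then have m: "min a t = a" "min a' t = a'" by auto
    show ?thesis
      unfolding measure_interval_inter[OF ab(1,3) t] unfolding cell_integral_def E E' using m
      using weighted_increment_cov[OF ab(1) _ ab(3) _ A X X', of "min b t" "min b' t"] ab True by simp
  next
    \<comment> \<open>A cell that starts after \<open>t\<close> has integral 0 by the clipping at
      \<open>t\<close>, and its time interval does not meet (0, t).\<close>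
    case False
    then have "cell_integral t e = (\<lambda>_. 0) \<or> cell_integral t e' = (\<lambda>_. 0)"
      unfolding cell_integral_def E E' using ab by (auto simp: min_def)
    moreover have "measure lborel (?J \<inter> {0<..<t}) = 0"
      unfolding measure_interval_inter[OF ab(1,3) t] using False ab by (auto simp: max_def)
    ultimately show ?thesis by auto
  qed
  show "integrable M (\<lambda>\<omega>. cell_integral t e \<omega> * cell_integral t e' \<omega>)" using 2 by blast
  show "has_bochner_integral (walsh_measure t) (\<lambda>(\<omega>, s, y, z). cell_fun e s y \<omega> * cell_fun e' s z \<omega>)
      (\<integral>\<omega>. cell_integral t e \<omega> * cell_integral t e' \<omega> \<partial>M)" using 1 2 by simp
qed

lemma elementary_nth: "elementary M F S \<Longrightarrow> i < length S \<Longrightarrow> elementary M F [S ! i]"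
  by (auto simp: elementary_def)

text \<open>Stated with two integrands because correlations of the solution at two different points
  are needed, not only second moments.\<close>

lemma elementary_isometry:
  assumes S: "elementary M F S" and S': "elementary M F S'" and t: "0 \<le> t"
  shows "has_bochner_integral (walsh_measure t)
      (\<lambda>p. left (elementary_fun S) p * right (elementary_fun S') p)
      (\<integral>\<omega>. elementary_integral F t S \<omega> * elementary_integral F t S' \<omega> \<partial>M)"
    and "integrable M (\<lambda>\<omega>. elementary_integral F t S \<omega> * elementary_integral F t S' \<omega>)"
proof -
  let ?c = "\<lambda>i j \<omega>. cell_integral t (S ! i) \<omega> * cell_integral t (S' ! j) \<omega>"
  have i: "integrable M (?c i j)" if "i < length S" "j < length S'" for i j
    by (rule cell_isometry(2)[OF elementary_nth[OF S that(1)] elementary_nth[OF S' that(2)] t])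
  have eq: "elementary_integral F t S \<omega> * elementary_integral F t S' \<omega> = (\<Sum>i<length S. \<Sum>j<length S'. ?c i j \<omega>)" for \<omega>
    by (simp add: elementary_integral_cells sum_product)
  show "integrable M (\<lambda>\<omega>. elementary_integral F t S \<omega> * elementary_integral F t S' \<omega>)"
    unfolding eq by (intro Bochner_Integration.integrable_sum i) auto
  have "(\<integral>\<omega>. elementary_integral F t S \<omega> * elementary_integral F t S' \<omega> \<partial>M)
    = (\<Sum>i<length S. \<Sum>j<length S'. \<integral>\<omega>. ?c i j \<omega> \<partial>M)"
    unfolding eq by (subst Bochner_Integration.integral_sum, intro Bochner_Integration.integrable_sum i, simp, simp,
      intro sum.cong refl, subst Bochner_Integration.integral_sum, rule i, auto)
  moreover have "has_bochner_integral (walsh_measure t)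
      (\<lambda>p. \<Sum>i<length S. \<Sum>j<length S'. case p of (\<omega>, s, y, z) \<Rightarrow> cell_fun (S ! i) s y \<omega> * cell_fun (S' ! j) s z \<omega>)
      (\<Sum>i<length S. \<Sum>j<length S'. \<integral>\<omega>. ?c i j \<omega> \<partial>M)"
    by (intro has_bochner_integral_sum cell_isometry(1) elementary_nth[OF S] elementary_nth[OF S'] t) auto
  moreover have "(\<lambda>p. left (elementary_fun S) p * right (elementary_fun S') p)
    = (\<lambda>p. \<Sum>i<length S. \<Sum>j<length S'. case p of (\<omega>, s, y, z) \<Rightarrow> cell_fun (S ! i) s y \<omega> * cell_fun (S' ! j) s z \<omega>)"
    by (auto simp: left_def right_def elementary_fun_cells sum_product fun_eq_iff)
  ultimately show "has_bochner_integral (walsh_measure t)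
      (\<lambda>p. left (elementary_fun S) p * right (elementary_fun S') p)
      (\<integral>\<omega>. elementary_integral F t S \<omega> * elementary_integral F t S' \<omega> \<partial>M)" by simp
qed

lemma random_field_elementary_fun:
  assumes "elementary M F S"
  shows "random_field (elementary_fun S)"
  unfolding random_field_def elementary_fun_cells case_prod_unfold
proof (rule borel_measurable_sum)
  fix i assume "i \<in> {..<length S}"
  then have e: "elementary M F [S ! i]" using elementary_nth[OF assms] by auto
  obtain a b A X where E: "S ! i = (a, b, A, X)" by (cases "S ! i")
  have [measurable]: "A \<in> sets borel" "X \<in> borel_measurable M"
    using e measurable_noise_filtration by (auto simp: E elementary_def bounded_borel_def)
  show "(\<lambda>p. cell_fun (S ! i) (fst p) (fst (snd p)) (snd (snd p))) \<in> borel_measurable (borel \<Otimes>\<^sub>M borel \<Otimes>\<^sub>M M)"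
    unfolding cell_fun_def E prod.case by measurable
qed

text \<open>Each cell multiplies an increment after its start time by a weight known at that time,
  hence is centred.\<close>

lemma elementary_integral_mean:
  assumes S: "elementary M F S" and t: "0 \<le> t"
  shows "integrable M (elementary_integral F t S)" "(\<integral>\<omega>. elementary_integral F t S \<omega> \<partial>M) = 0"
    "elementary_integral F t S \<in> borel_measurable M"
proof -
  have *: "integrable M (cell_integral t (S ! i)) \<and> (\<integral>\<omega>. cell_integral t (S ! i) \<omega> \<partial>M) = 0" if i: "i < length S" for i
  proof -
    obtain a b A X where E: "S ! i = (a, b, A, X)" by (cases "S ! i")
    obtain c where ab: "0 \<le> a" "a \<le> b" and A: "A \<in> bounded_borel"
      and X: "X \<in> borel_measurable (noise_filtration M F a)" "\<And>\<omega>. \<omega> \<in> space M \<Longrightarrow> \<bar>X \<omega>\<bar> \<le> c"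
      using elementary_nth[OF S i] by (auto simp: elementary_def E)
    have Xi: "integrable M X"
      by (rule integrable_const_bound[of _ c]) (use X measurable_noise_filtration in auto)
    show ?thesis
    proof (cases "a \<le> t")
      case True
      then show ?thesis unfolding cell_integral_def E
        using future_integral(1,2)[OF increment_future[OF ab(1) _ A] X(1) Xi, of "min b t"] ab by simp
    next
      case False
      then show ?thesis unfolding cell_integral_def E using ab by (simp add: min_def)
    qed
  qed
  then have i: "integrable M (cell_integral t (S ! i))" "(\<integral>\<omega>. cell_integral t (S ! i) \<omega> \<partial>M) = 0"
    if "i < length S" for i using that by blast+
  have eq: "elementary_integral F t S = (\<lambda>\<omega>. \<Sum>i<length S. cell_integral t (S ! i) \<omega>)"
    by (simp add: elementary_integral_cells fun_eq_iff)
  show 1: "integrable M (elementary_integral F t S)"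
    unfolding eq by (intro Bochner_Integration.integrable_sum i) auto
  then show "elementary_integral F t S \<in> borel_measurable M" by simp
  show "(\<integral>\<omega>. elementary_integral F t S \<omega> \<partial>M) = 0"
    unfolding eq by (subst Bochner_Integration.integral_sum) (auto simp: i)
qed

end

text \<open>Measurability of integrands and solutions is given only on a restricted time space; this
  moves it to the full product space, where the Fubini arguments take place.\<close>

lemma borel_measurable_extend_by_zero:
  fixes h :: "'s::topological_space \<times> 'b \<Rightarrow> real"
  assumes h: "h \<in> borel_measurable (restrict_space borel S \<Otimes>\<^sub>M N)" and S: "S \<in> sets borel"
  shows "(\<lambda>p. indicator S (fst p) * h p) \<in> borel_measurable (borel \<Otimes>\<^sub>M N)"
proof -
  let ?O = "S \<times> space N"
  have O: "?O \<inter> space (borel \<Otimes>\<^sub>M N) \<in> sets (borel \<Otimes>\<^sub>M N)" using S by (simp add: space_pair_measure Int_absorb2)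
  have "(\<lambda>p. (fst p, snd p)) \<in> measurable (restrict_space (borel \<Otimes>\<^sub>M N) ?O) (restrict_space borel S \<Otimes>\<^sub>M N)"
  proof (rule measurable_Pair)
    show "fst \<in> measurable (restrict_space (borel \<Otimes>\<^sub>M N) ?O) (restrict_space borel S)"
      by (rule measurable_restrict_space2) (auto simp: space_restrict_space intro: measurable_restrict_space1)
    show "snd \<in> measurable (restrict_space (borel \<Otimes>\<^sub>M N) ?O) N"
      by (rule measurable_restrict_space1) simp
  qed
  from measurable_compose[OF this h] have "h \<in> borel_measurable (restrict_space (borel \<Otimes>\<^sub>M N) ?O)" by simp
  then have "(\<lambda>p. indicator ?O p *\<^sub>R h p) \<in> borel_measurable (borel \<Otimes>\<^sub>M N)"
    using borel_measurable_restrict_space_iff[OF O, of h] by simp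
  then show ?thesis
    by (rule measurable_cong[THEN iffD1, rotated]) (auto simp: space_pair_measure indicator_def)
qed

section \<open>The isometry for general integrands\<close>

context colored_noise
begin

text \<open>Both sides of the elementary isometry converge, the expectations by L2 convergence of
  the integrals and the field products by convergence in Walsh's norm, each through
  \<open>integral_product_limit\<close>. Uniqueness of limits gives the covariance formula.\<close>

lemma walsh_integral_covariance_field:
  assumes \<Phi>: "random_field \<Phi>" and Y: "Y \<in> borel_measurable M" and S: "\<And>n. elementary M F (S n)"
    and limS: "(\<lambda>n. walsh_norm_sq M f t (\<lambda>s y \<omega>. \<Phi> s y \<omega> - elementary_fun (S n) s y \<omega>)) \<longlonglongrightarrow> 0"
    and limY: "(\<lambda>n. \<integral>\<^sup>+\<omega>. ennreal ((Y \<omega> - elementary_integral F t (S n) \<omega>)\<^sup>2) \<partial>M) \<longlonglongrightarrow> 0"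
    and \<Phi>': "random_field \<Phi>'" and Y': "Y' \<in> borel_measurable M" and S': "\<And>n. elementary M F (S' n)"
    and limS': "(\<lambda>n. walsh_norm_sq M f t (\<lambda>s y \<omega>. \<Phi>' s y \<omega> - elementary_fun (S' n) s y \<omega>)) \<longlonglongrightarrow> 0"
    and limY': "(\<lambda>n. \<integral>\<^sup>+\<omega>. ennreal ((Y' \<omega> - elementary_integral F t (S' n) \<omega>)\<^sup>2) \<partial>M) \<longlonglongrightarrow> 0"
    and t: "0 \<le> t"
  shows "integrable M (\<lambda>\<omega>. (Y \<omega>)\<^sup>2)" "(\<integral>\<omega>. Y \<omega> \<partial>M) = 0"
    "integrable (walsh_measure t) (\<lambda>p. left \<Phi> p * right \<Phi>' p)"
    "(\<integral>\<omega>. Y \<omega> * Y' \<omega> \<partial>M) = (\<integral>p. left \<Phi> p * right \<Phi>' p \<partial>walsh_measure t)"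
proof -
  note [measurable] = \<Phi> \<Phi>' Y Y' random_field_elementary_fun[OF S] random_field_elementary_fun[OF S']
    elementary_integral_mean(3)[OF S t] elementary_integral_mean(3)[OF S' t]
  have L2: "integrable M (\<lambda>\<omega>. (Y \<omega>)\<^sup>2)"
    if [measurable]: "Y \<in> borel_measurable M" and S: "\<And>n. elementary M F (S n)"
      and lim: "(\<lambda>n. \<integral>\<^sup>+\<omega>. ennreal ((Y \<omega> - elementary_integral F t (S n) \<omega>)\<^sup>2) \<partial>M) \<longlonglongrightarrow> 0" for Y S
  proof -
    \<comment> \<open>One approximant at squared distance below 1 already transfers square
      integrability.\<close>
    obtain n where n: "(\<integral>\<^sup>+\<omega>. ennreal ((Y \<omega> - elementary_integral F t (S n) \<omega>)\<^sup>2) \<partial>M) < 1"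
      using eventually_happens[OF order_tendstoD(2)[OF lim, of 1]] by auto
    note [measurable] = elementary_integral_mean(3)[OF S t]
    have "(\<integral>\<^sup>+\<omega>. ennreal ((elementary_integral F t (S n) \<omega>)\<^sup>2) \<partial>M) < \<infinity>"
      using elementary_isometry(2)[OF S S t, of n n] by (simp add: power2_eq_square integrable_iff_bounded)
    then have i: "integrable M (\<lambda>\<omega>. 2 * (Y \<omega> - elementary_integral F t (S n) \<omega>)\<^sup>2 + 2 * (elementary_integral F t (S n) \<omega>)\<^sup>2)"
      using order_less_trans[OF n, of \<infinity>]
      by (intro Bochner_Integration.integrable_add Bochner_Integration.integrable_mult_right) (auto simp: integrable_iff_bounded)
    have "x\<^sup>2 \<le> 2 * (x - e)\<^sup>2 + 2 * e\<^sup>2" for x e :: real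
      using zero_le_power2[of "x - 2 * e"] by (simp add: power2_eq_square algebra_simps)
    then show ?thesis by (intro Bochner_Integration.integrable_bound[OF i]) auto
  qed
  show Y2: "integrable M (\<lambda>\<omega>. (Y \<omega>)\<^sup>2)" by (rule L2[OF Y S limY])
  have Y2': "integrable M (\<lambda>\<omega>. (Y' \<omega>)\<^sup>2)" by (rule L2[OF Y' S' limY'])
  have amgm: "(\<integral>\<^sup>+\<omega>. ennreal (\<bar>A \<omega>\<bar> * \<bar>B \<omega>\<bar>) \<partial>M)
      \<le> ennreal k * (\<integral>\<^sup>+\<omega>. ennreal ((A \<omega>)\<^sup>2) \<partial>M) + ennreal (1 / k) * (\<integral>\<^sup>+\<omega>. ennreal ((B \<omega>)\<^sup>2) \<partial>M)"
    if [measurable]: "A \<in> borel_measurable M" "B \<in> borel_measurable M" and k: "0 < k" for A B :: "'w \<Rightarrow> real" and k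
  proof -
    have "\<bar>a\<bar> * \<bar>b\<bar> \<le> k * a\<^sup>2 + 1 / k * b\<^sup>2" for a b :: real
      using mult_le_weighted_squares[OF k, of "\<bar>a\<bar>" "\<bar>b\<bar>"] by simp
    then have "ennreal (\<bar>a\<bar> * \<bar>b\<bar>) \<le> ennreal k * ennreal (a\<^sup>2) + ennreal (1 / k) * ennreal (b\<^sup>2)" for a b :: real
      using k by (simp add: ennreal_mult[symmetric] ennreal_plus[symmetric] ennreal_leI del: ennreal_plus)
    then have "(\<integral>\<^sup>+\<omega>. ennreal (\<bar>A \<omega>\<bar> * \<bar>B \<omega>\<bar>) \<partial>M)
      \<le> (\<integral>\<^sup>+\<omega>. ennreal k * ennreal ((A \<omega>)\<^sup>2) + ennreal (1 / k) * ennreal ((B \<omega>)\<^sup>2) \<partial>M)"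
      by (intro nn_integral_mono) auto
    then show ?thesis by (simp add: nn_integral_add nn_integral_cmult)
  qed
  have lim_right: "(\<lambda>n. \<integral>\<^sup>+\<omega>. ennreal (\<bar>A n \<omega>\<bar> * \<bar>B \<omega>\<bar>) \<partial>M) \<longlonglongrightarrow> 0"
    if "\<And>n. A n \<in> borel_measurable M" "B \<in> borel_measurable M"
      "(\<lambda>n. \<integral>\<^sup>+\<omega>. ennreal ((A n \<omega>)\<^sup>2) \<partial>M) \<longlonglongrightarrow> 0" "integrable M (\<lambda>\<omega>. (B \<omega>)\<^sup>2)" for A B
    by (rule tendsto_zero_by_weighted_bound[OF that(3) _ amgm[OF that(1,2)]])
      (use that(4) in \<open>auto simp: integrable_iff_bounded\<close>)
  let ?D = "\<lambda>n \<omega>. Y \<omega> - elementary_integral F t (S n) \<omega>" and ?D' = "\<lambda>n \<omega>. Y' \<omega> - elementary_integral F t (S' n) \<omega>"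
  have E: "(\<lambda>n. \<integral>\<omega>. elementary_integral F t (S n) \<omega> * elementary_integral F t (S' n) \<omega> \<partial>M)
     \<longlonglongrightarrow> (\<integral>\<omega>. Y \<omega> * Y' \<omega> \<partial>M)"
  proof (rule integral_product_limit)
    show "integrable M (\<lambda>x. Y x * Y' x)" by (rule integrable_mult_of_squares[OF Y Y' Y2 Y2'])
    show "integrable M (\<lambda>x. elementary_integral F t (S n) x * elementary_integral F t (S' n) x)" for n
      by (rule elementary_isometry(2)[OF S S' t])
    show "(\<lambda>n. \<integral>\<^sup>+x. ennreal (\<bar>?D n x\<bar> * \<bar>Y' x\<bar>) \<partial>M) \<longlonglongrightarrow> 0"
      by (rule lim_right[OF _ Y' limY Y2']) measurable
    show "(\<lambda>n. \<integral>\<^sup>+x. ennreal (\<bar>Y x\<bar> * \<bar>?D' n x\<bar>) \<partial>M) \<longlonglongrightarrow> 0"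
      by (subst mult.commute, rule lim_right[OF _ Y limY' Y2]) measurable
    show "(\<lambda>n. \<integral>\<^sup>+x. ennreal (\<bar>?D n x\<bar> * \<bar>?D' n x\<bar>) \<partial>M) \<longlonglongrightarrow> 0"
    proof (rule tendsto_sandwich[OF _ _ tendsto_const])
      show "\<forall>\<^sub>F n in sequentially. (\<integral>\<^sup>+x. ennreal (\<bar>?D n x\<bar> * \<bar>?D' n x\<bar>) \<partial>M)
        \<le> (\<integral>\<^sup>+x. ennreal ((?D n x)\<^sup>2) \<partial>M) + (\<integral>\<^sup>+x. ennreal ((?D' n x)\<^sup>2) \<partial>M)"
        using amgm[of "?D n" "?D' n" 1 for n] by simp
      show "(\<lambda>n. (\<integral>\<^sup>+x. ennreal ((?D n x)\<^sup>2) \<partial>M) + (\<integral>\<^sup>+x. ennreal ((?D' n x)\<^sup>2) \<partial>M)) \<longlonglongrightarrow> 0"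
        using tendsto_add[OF limY limY'] by simp
    qed simp
  qed measurable
  \<comment> \<open>The mean is treated as a product with the constant 1, which approximates
    itself.\<close>
  have "(\<lambda>n. \<integral>\<omega>. elementary_integral F t (S n) \<omega> * 1 \<partial>M) \<longlonglongrightarrow> (\<integral>\<omega>. Y \<omega> * 1 \<partial>M)"
  proof (rule integral_product_limit)
    show "integrable M (\<lambda>x. Y x * 1)" using square_integrable_imp_integrable[OF Y Y2] by simp
    show "integrable M (\<lambda>x. elementary_integral F t (S n) x * 1)" for n
      using elementary_integral_mean(1)[OF S t] by simp
    show "(\<lambda>n. \<integral>\<^sup>+x. ennreal (\<bar>?D n x\<bar> * \<bar>1\<bar>) \<partial>M) \<longlonglongrightarrow> 0"
      by (rule lim_right[OF _ _ limY]) auto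
  qed auto
  then show "(\<integral>\<omega>. Y \<omega> \<partial>M) = 0"
    using elementary_integral_mean(2)[OF S t] by (simp add: LIMSEQ_const_iff)

  \<comment> \<open>An elementary field has finite norm by its own isometry, and
    \<open>wq_triangle\<close> transfers this to a field that it approximates.\<close>
  have fin: "wq t \<Phi> \<Phi> < \<infinity>"
    if \<Phi>: "random_field \<Phi>" and S: "\<And>n. elementary M F (S n)"
      and lim: "(\<lambda>n. walsh_norm_sq M f t (\<lambda>s y \<omega>. \<Phi> s y \<omega> - elementary_fun (S n) s y \<omega>)) \<longlonglongrightarrow> 0" for \<Phi> S
  proof -
    note fS = random_field_elementary_fun[OF S]
    obtain n where n: "wq t (\<lambda>s y \<omega>. \<Phi> s y \<omega> - elementary_fun (S n) s y \<omega>) (\<lambda>s y \<omega>. \<Phi> s y \<omega> - elementary_fun (S n) s y \<omega>) < 1"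
      using eventually_happens[OF order_tendstoD(2)[OF lim, of 1]]
      by (auto simp: walsh_norm_sq_eq[OF random_field_diff[OF \<Phi> fS]])
    have "wq t (elementary_fun (S n)) (elementary_fun (S n)) < \<infinity>"
      using has_bochner_integral_integrable[OF integrable.intros[OF elementary_isometry(1)[OF S S t, of n n]]]
        elementary_isometry(1)[OF S S t, of n n]
      by (auto simp: wq_def abs_mult has_bochner_integral_iff integrable_iff_bounded)
    moreover note order_less_trans[OF n, of \<infinity>]
    ultimately show ?thesis
      by (intro le_less_trans[OF wq_triangle[OF \<Phi> fS, of t n]])
        (simp add: ennreal_mult_eq_top_iff less_top[symmetric])
  qed
  note f1 = fin[OF \<Phi> S limS] and f2 = fin[OF \<Phi>' S' limS']
  let ?d = "\<lambda>n s y \<omega>. \<Phi> s y \<omega> - elementary_fun (S n) s y \<omega>" and ?d' = "\<lambda>n s y \<omega>. \<Phi>' s y \<omega> - elementary_fun (S' n) s y \<omega>"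
  have fd: "random_field (?d n)" and fd': "random_field (?d' n)" for n
    using random_field_diff[OF \<Phi> random_field_elementary_fun[OF S]] random_field_diff[OF \<Phi>' random_field_elementary_fun[OF S']] by auto
  have l: "(\<lambda>n. wq t (?d n) (?d n)) \<longlonglongrightarrow> 0" and l': "(\<lambda>n. wq t (?d' n) (?d' n)) \<longlonglongrightarrow> 0"
    using limS limS' by (simp_all add: walsh_norm_sq_eq[OF fd] walsh_norm_sq_eq[OF fd'])
  have ld: "left (?d n) p = left \<Phi> p - left (elementary_fun (S n)) p"
    "right (?d' n) p = right \<Phi>' p - right (elementary_fun (S' n)) p" for n p
    by (auto simp: left_def right_def case_prod_unfold)
  show iW: "integrable (walsh_measure t) (\<lambda>p. left \<Phi> p * right \<Phi>' p)"
  proof -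
    have "wq t \<Phi> \<Phi>' < \<infinity>"
      using wq_amgm[OF \<Phi> \<Phi>', of 1 t] f1 f2 by (auto intro: le_less_trans)
    then show ?thesis by (auto simp: integrable_iff_bounded wq_def abs_mult)
  qed
  have "(\<lambda>n. \<integral>p. left (elementary_fun (S n)) p * right (elementary_fun (S' n)) p \<partial>walsh_measure t)
     \<longlonglongrightarrow> (\<integral>p. left \<Phi> p * right \<Phi>' p \<partial>walsh_measure t)"
  proof (rule integral_product_limit[OF _ _ _ _ iW])
    show "integrable (walsh_measure t) (\<lambda>p. left (elementary_fun (S n)) p * right (elementary_fun (S' n)) p)" for n
      using elementary_isometry(1)[OF S S' t] by (auto simp: has_bochner_integral_iff)
    show "(\<lambda>n. \<integral>\<^sup>+x. ennreal (\<bar>left \<Phi> x - left (elementary_fun (S n)) x\<bar> * \<bar>right \<Phi>' x\<bar>) \<partial>walsh_measure t) \<longlonglongrightarrow> 0"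
      using wq_tendsto_0(1)[OF fd \<Phi>' l f2] by (simp add: wq_def ld)
    show "(\<lambda>n. \<integral>\<^sup>+x. ennreal (\<bar>left \<Phi> x\<bar> * \<bar>right \<Phi>' x - right (elementary_fun (S' n)) x\<bar>) \<partial>walsh_measure t) \<longlonglongrightarrow> 0"
      using wq_tendsto_0(2)[OF fd' \<Phi> l' f1] by (simp add: wq_def ld)
    show "(\<lambda>n. \<integral>\<^sup>+x. ennreal (\<bar>left \<Phi> x - left (elementary_fun (S n)) x\<bar> * \<bar>right \<Phi>' x - right (elementary_fun (S' n)) x\<bar>) \<partial>walsh_measure t) \<longlonglongrightarrow> 0"
      using wq_tendsto_0_0[OF fd fd' l l'] by (simp add: wq_def ld)
  qed measurable
  moreover have "(\<integral>p. left (elementary_fun (S n)) p * right (elementary_fun (S' n)) p \<partial>walsh_measure t)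
    = (\<integral>\<omega>. elementary_integral F t (S n) \<omega> * elementary_integral F t (S' n) \<omega> \<partial>M)" for n
    using elementary_isometry(1)[OF S S' t] by (rule has_bochner_integral_integral_eq)
  ultimately show "(\<integral>\<omega>. Y \<omega> * Y' \<omega> \<partial>M) = (\<integral>p. left \<Phi> p * right \<Phi>' p \<partial>walsh_measure t)"
    using E LIMSEQ_unique by simp
qed

text \<open>For nonnegative integrands the signed integral over the Walsh measure becomes an
  iterated integral in [0, \<infinity>]. Extending the integrands by 0 outside (0, t) alters neither
  Walsh's norm nor the result.\<close>

lemma walsh_integral_covariance:
  assumes t: "0 < t" and W: "has_walsh_integral M f F t \<Phi> Y" and W': "has_walsh_integral M f F t \<Phi>' Y'"
    and nonneg: "\<And>s y \<omega>. 0 < s \<Longrightarrow> s < t \<Longrightarrow> 0 \<le> \<Phi> s y \<omega>" "\<And>s y \<omega>. 0 < s \<Longrightarrow> s < t \<Longrightarrow> 0 \<le> \<Phi>' s y \<omega>"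
  shows "Y \<in> borel_measurable M" "integrable M (\<lambda>\<omega>. (Y \<omega>)\<^sup>2)" "(\<integral>\<omega>. Y \<omega> \<partial>M) = 0"
    "0 \<le> (\<integral>\<omega>. Y \<omega> * Y' \<omega> \<partial>M)"
    "ennreal (\<integral>\<omega>. Y \<omega> * Y' \<omega> \<partial>M) = (\<integral>\<^sup>+\<omega>. (\<integral>\<^sup>+s\<in>{0<..<t}. (\<integral>\<^sup>+y. (\<integral>\<^sup>+z.
        ennreal (\<Phi> s y \<omega> * \<Phi>' s z \<omega>) * f y z \<partial>lborel) \<partial>lborel) \<partial>lborel) \<partial>M)"
proof -
  define ext where "ext \<Phi> s y \<omega> = indicator {0<..<t} s * \<Phi> s y \<omega>" for \<Phi> :: "real \<Rightarrow> 'a \<Rightarrow> 'w \<Rightarrow> real" and s y \<omega>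
  have fe: "random_field (ext \<Phi>)"
    if "(\<lambda>(s, y, \<omega>). \<Phi> s y \<omega>) \<in> borel_measurable (restrict_space borel {0<..<t} \<Otimes>\<^sub>M borel \<Otimes>\<^sub>M M)" for \<Phi>
    using borel_measurable_extend_by_zero[OF that] unfolding random_field_def ext_def by (simp add: case_prod_unfold)
  have norm_ext: "walsh_norm_sq M f t (\<lambda>s y \<omega>. \<Phi> s y \<omega> - E s y \<omega>) = walsh_norm_sq M f t (\<lambda>s y \<omega>. ext \<Phi> s y \<omega> - E s y \<omega>)" for \<Phi> E
    unfolding walsh_norm_sq_def by (intro nn_integral_cong) (auto simp: ext_def indicator_def)
  obtain S where S: "(\<lambda>(s, y, \<omega>). \<Phi> s y \<omega>) \<in> borel_measurable (restrict_space borel {0<..<t} \<Otimes>\<^sub>M borel \<Otimes>\<^sub>M M)"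
    "Y \<in> borel_measurable M" "\<And>n. elementary M F (S n)"
    "(\<lambda>n. walsh_norm_sq M f t (\<lambda>s y \<omega>. ext \<Phi> s y \<omega> - elementary_fun (S n) s y \<omega>)) \<longlonglongrightarrow> 0"
    "(\<lambda>n. \<integral>\<^sup>+\<omega>. ennreal ((Y \<omega> - elementary_integral F t (S n) \<omega>)\<^sup>2) \<partial>M) \<longlonglongrightarrow> 0"
    using W unfolding has_walsh_integral_def norm_ext[of \<Phi>] by blast
  obtain S' where S': "(\<lambda>(s, y, \<omega>). \<Phi>' s y \<omega>) \<in> borel_measurable (restrict_space borel {0<..<t} \<Otimes>\<^sub>M borel \<Otimes>\<^sub>M M)"
    "Y' \<in> borel_measurable M" "\<And>n. elementary M F (S' n)"
    "(\<lambda>n. walsh_norm_sq M f t (\<lambda>s y \<omega>. ext \<Phi>' s y \<omega> - elementary_fun (S' n) s y \<omega>)) \<longlonglongrightarrow> 0"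
    "(\<lambda>n. \<integral>\<^sup>+\<omega>. ennreal ((Y' \<omega> - elementary_integral F t (S' n) \<omega>)\<^sup>2) \<partial>M) \<longlonglongrightarrow> 0"
    using W' unfolding has_walsh_integral_def norm_ext[of \<Phi>'] by blast
  note f = fe[OF S(1)] and f' = fe[OF S'(1)]
  note cov = walsh_integral_covariance_field[OF f S(2-5) f' S'(2-5) less_imp_le[OF t]]
  show "Y \<in> borel_measurable M" by (rule S(2))
  show "integrable M (\<lambda>\<omega>. (Y \<omega>)\<^sup>2)" "(\<integral>\<omega>. Y \<omega> \<partial>M) = 0" by (rule cov(1) cov(2))+
  have n: "0 \<le> left (ext \<Phi>) p * right (ext \<Phi>') p" for p
    using nonneg by (auto simp: left_def right_def ext_def indicator_def case_prod_unfold)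
  show "0 \<le> (\<integral>\<omega>. Y \<omega> * Y' \<omega> \<partial>M)" unfolding cov(4) using n by (intro integral_nonneg_AE) auto
  have m: "(\<lambda>p. ennreal (left (ext \<Phi>) p * right (ext \<Phi>') p)) \<in> borel_measurable (M \<Otimes>\<^sub>M borel \<Otimes>\<^sub>M borel \<Otimes>\<^sub>M borel)"
    using f f' by measurable
  have "ennreal (\<integral>\<omega>. Y \<omega> * Y' \<omega> \<partial>M) = (\<integral>\<^sup>+p. ennreal (left (ext \<Phi>) p * right (ext \<Phi>') p) \<partial>walsh_measure t)"
    unfolding cov(4) by (rule nn_integral_eq_integral[symmetric]) (use cov(3) n in auto)
  also have "\<dots> = (\<integral>\<^sup>+\<omega>. (\<integral>\<^sup>+s\<in>{0<..<t}. (\<integral>\<^sup>+y. (\<integral>\<^sup>+z.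
        ennreal (\<Phi> s y \<omega> * \<Phi>' s z \<omega>) * f y z \<partial>lborel) \<partial>lborel) \<partial>lborel) \<partial>M)"
    unfolding nn_integral_walsh_measure[OF m]
    by (intro nn_integral_cong) (auto simp: left_def right_def ext_def indicator_def)
  finally show "ennreal (\<integral>\<omega>. Y \<omega> * Y' \<omega> \<partial>M) = (\<integral>\<^sup>+\<omega>. (\<integral>\<^sup>+s\<in>{0<..<t}. (\<integral>\<^sup>+y. (\<integral>\<^sup>+z.
        ennreal (\<Phi> s y \<omega> * \<Phi>' s z \<omega>) * f y z \<partial>lborel) \<partial>lborel) \<partial>lborel) \<partial>M)" .
qed

end

section \<open>The stable density\<close>

lemma lborel_affine_integral:
  fixes h :: "'a::euclidean_space \<Rightarrow> 'b::{banach, second_countable_topology}"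
  assumes c: "c \<noteq> 0" and h: "integrable lborel h"
  shows "integrable lborel (\<lambda>x. h (a + c *\<^sub>R x))"
    "(\<integral>x. h x \<partial>lborel) = \<bar>c\<bar> ^ DIM('a) *\<^sub>R (\<integral>x. h (a + c *\<^sub>R x) \<partial>lborel)"
proof -
  let ?L = "density (distr lborel borel (\<lambda>x. a + c *\<^sub>R x)) (\<lambda>_. ennreal (\<bar>c\<bar> ^ DIM('a)))"
  have L: "lborel = ?L" by (rule lborel_affine[OF c])
  have [measurable]: "h \<in> borel_measurable borel" using h by simp
  have "integrable ?L h" using h by (subst L[symmetric])
  then have "integrable lborel (\<lambda>x. \<bar>c\<bar> ^ DIM('a) *\<^sub>R h (a + c *\<^sub>R x))"
    by (simp add: integrable_density integrable_distr_eq)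
  from Bochner_Integration.integrable_scaleR_right[OF this, of "inverse (\<bar>c\<bar> ^ DIM('a))"]
  show "integrable lborel (\<lambda>x. h (a + c *\<^sub>R x))" using c by simp
  have "(\<integral>x. h x \<partial>lborel) = (\<integral>x. h x \<partial>?L)" by (subst L) rule
  also have "\<dots> = \<bar>c\<bar> ^ DIM('a) *\<^sub>R (\<integral>x. h (a + c *\<^sub>R x) \<partial>lborel)"
    by (simp add: integral_density integral_distr)
  finally show "(\<integral>x. h x \<partial>lborel) = \<bar>c\<bar> ^ DIM('a) *\<^sub>R (\<integral>x. h (a + c *\<^sub>R x) \<partial>lborel)" .
qed

text \<open>A nonempty open set is never Lebesgue null, so an open failure set of measure 0 is
  empty.\<close>

lemma AE_lborel_open_imp:
  fixes U :: "'a::euclidean_space set"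
  assumes "open {x. \<not> P x}" "AE x in lborel. P x"
  shows "P x"
proof -
  let ?N = "{x. \<not> P x}"
  have "?N \<in> null_sets lborel"
    using assms by (subst AE_iff_null_sets) auto
  then have "?N \<in> null_sets lebesgue" by (rule null_sets_completionI)
  then have "negligible ?N" by (simp add: negligible_iff_null_sets)
  then have "?N = {}" using open_not_negligible assms(1) by blast
  then show ?thesis by blast
qed

lemma continuous_fourier_unique:
  fixes h1 h2 :: "'a::euclidean_space \<Rightarrow> real"
  assumes c: "continuous_on UNIV h1" "continuous_on UNIV h2" and i: "integrable lborel h1" "integrable lborel h2"
    and eq: "\<And>\<xi>. (\<integral>x. complex_of_real (h1 x) * iexp (\<xi> \<bullet> x) \<partial>lborel) = (\<integral>x. complex_of_real (h2 x) * iexp (\<xi> \<bullet> x) \<partial>lborel)"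
  shows "h1 x = h2 x"
proof -
  have "AE x in lborel. h1 x - h2 x = 0"
  proof (rule fourier_unique_lborel)
    show "integrable lborel (\<lambda>x. h1 x - h2 x)" using i by simp
    fix \<xi> :: 'a
    have "integrable lborel (\<lambda>x. complex_of_real (h x) * iexp (\<xi> \<bullet> x))" if "integrable lborel h" for h
      by (rule integrable_mult_iexp) (use that in auto)
    then show "(\<integral>x. complex_of_real (h1 x - h2 x) * iexp (\<xi> \<bullet> x) \<partial>lborel) = 0"
      using i eq[of \<xi>] by (simp add: left_diff_distrib)
  qed
  moreover have "{x. \<not> h1 x - h2 x = 0} = {x. h1 x \<noteq> h2 x}" by auto
  then have "open {x. \<not> h1 x - h2 x = 0}" using open_Collect_neq[OF c] by simp
  ultimately have "h1 x - h2 x = 0" by (rule AE_lborel_open_imp[rotated])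
  then show ?thesis by simp
qed

section \<open>Symmetry, scaling and positivity of the density\<close>

locale stable_density =
  fixes \<nu> \<alpha> :: real and p :: "real \<Rightarrow> 'a::euclidean_space \<Rightarrow> real"
  assumes \<nu>: "0 < \<nu>" and \<alpha>: "0 < \<alpha>" and density: "stable_transition_density \<nu> \<alpha> p"
begin

lemma p_continuous: "0 < t \<Longrightarrow> continuous_on UNIV (p t)"
proof -
  assume t: "0 < t"
  have "continuous_on ({0<..} \<times> UNIV) (\<lambda>(t, x). p t x)"
    using density by (simp add: stable_transition_density_def)
  then have "continuous_on UNIV (\<lambda>x. (\<lambda>(t, x). p t x) (t, x))"
    by (rule continuous_on_compose2) (use t in \<open>auto intro!: continuous_intros\<close>)
  then show ?thesis by simp
qed

lemma p_nonneg: "0 < t \<Longrightarrow> 0 \<le> p t x"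
  and p_integrable: "0 < t \<Longrightarrow> integrable lborel (p t)"
  using density by (auto simp: stable_transition_density_def)

lemma p_measurable: "0 < t \<Longrightarrow> p t \<in> borel_measurable borel"
  using p_integrable by auto

lemma p_fourier:
  "0 < t \<Longrightarrow> (\<integral>x. complex_of_real (p t x) * iexp (\<xi> \<bullet> x) \<partial>lborel) = complex_of_real (exp (- (t * \<nu> * norm \<xi> powr \<alpha>)))"
  using density by (auto simp: stable_transition_density_def mult.commute)

lemma p_integral: "0 < t \<Longrightarrow> (\<integral>x. p t x \<partial>lborel) = 1"
proof -
  assume t: "0 < t"
  have "complex_of_real (\<integral>x. p t x \<partial>lborel) = 1"
    using p_fourier[OF t, of 0] by (simp del: of_real_eq_1_iff)
  then show ?thesis by simp
qed

lemma p_nn_integral: "0 < t \<Longrightarrow> (\<integral>\<^sup>+x. ennreal (p t x) \<partial>lborel) = 1"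
  by (subst nn_integral_eq_integral) (auto simp: p_integrable p_nonneg p_integral)

text \<open>The characteristic function is even, and continuity makes it determine the density at
  every point.\<close>

lemma p_symmetric:
  assumes t: "0 < t"
  shows "p t (- x) = p t x"
proof (rule continuous_fourier_unique[where ?h1.0 = "\<lambda>x. p t (- x)"])
  show "continuous_on UNIV (\<lambda>x. p t (- x))"
    by (rule continuous_on_compose2[OF p_continuous[OF t]]) (auto intro!: continuous_intros)
  show "continuous_on UNIV (p t)" "integrable lborel (p t)" using t p_continuous p_integrable by auto
  show "integrable lborel (\<lambda>x. p t (- x))"
    using lborel_affine_integral(1)[OF _ p_integrable[OF t], of "-1" 0] by simp
  fix \<xi> :: 'a
  have i: "integrable lborel (\<lambda>x. complex_of_real (p t x) * iexp (- \<xi> \<bullet> x))"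
    by (rule integrable_mult_iexp) (use p_integrable[OF t] in auto)
  have "(\<integral>x. complex_of_real (p t (- x)) * iexp (\<xi> \<bullet> x) \<partial>lborel) = (\<integral>x. complex_of_real (p t x) * iexp (- \<xi> \<bullet> x) \<partial>lborel)"
    using lborel_affine_integral(2)[OF _ i, of "-1" 0] by simp
  also have "\<dots> = (\<integral>x. complex_of_real (p t x) * iexp (\<xi> \<bullet> x) \<partial>lborel)"
    using p_fourier[OF t, of "- \<xi>"] p_fourier[OF t, of \<xi>] by simp
  finally show "(\<integral>x. complex_of_real (p t (- x)) * iexp (\<xi> \<bullet> x) \<partial>lborel)
    = (\<integral>x. complex_of_real (p t x) * iexp (\<xi> \<bullet> x) \<partial>lborel)" .
qed

text \<open>\<open>c\<close> is chosen with \<open>c powr \<alpha> = s / t\<close>, which matches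
  the exponents of the two characteristic functions.\<close>

lemma p_scaling:
  assumes t: "0 < t" and s: "0 < s"
  defines "c \<equiv> (s / t) powr (1 / \<alpha>)"
  shows "p t x = c ^ DIM('a) * p s (c *\<^sub>R x)"
proof (rule continuous_fourier_unique[where ?h2.0 = "\<lambda>x. c ^ DIM('a) * p s (c *\<^sub>R x)"])
  have c: "0 < c" using t s by (simp add: c_def)
  have ca: "c powr \<alpha> = s / t" unfolding c_def using \<alpha> t s by (simp add: powr_powr)
  show "continuous_on UNIV (p t)" "integrable lborel (p t)" using t p_continuous p_integrable by auto
  show "continuous_on UNIV (\<lambda>x. c ^ DIM('a) * p s (c *\<^sub>R x))"
    by (intro continuous_intros continuous_on_compose2[OF p_continuous[OF s]]) auto
  show "integrable lborel (\<lambda>x. c ^ DIM('a) * p s (c *\<^sub>R x))"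
    using lborel_affine_integral(1)[OF _ p_integrable[OF s], of c 0] c by simp
  fix \<xi> :: 'a
  have i: "integrable lborel (\<lambda>x. complex_of_real (p s x) * iexp (((1 / c) *\<^sub>R \<xi>) \<bullet> x))"
    by (rule integrable_mult_iexp) (use p_integrable[OF s] in auto)
  have "(\<integral>x. complex_of_real (c ^ DIM('a) * p s (c *\<^sub>R x)) * iexp (\<xi> \<bullet> x) \<partial>lborel)
    = c ^ DIM('a) *\<^sub>R (\<integral>x. complex_of_real (p s (0 + c *\<^sub>R x)) * iexp (((1 / c) *\<^sub>R \<xi>) \<bullet> (0 + c *\<^sub>R x)) \<partial>lborel)"
    using c by (simp add: scaleR_conv_of_real mult.assoc)
  also have "\<dots> = (\<integral>x. complex_of_real (p s x) * iexp (((1 / c) *\<^sub>R \<xi>) \<bullet> x) \<partial>lborel)"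
    using lborel_affine_integral(2)[OF _ i, of c 0] c by simp
  also have "\<dots> = complex_of_real (exp (- (s * \<nu> * norm ((1 / c) *\<^sub>R \<xi>) powr \<alpha>)))" by (rule p_fourier[OF s])
  also have "s * \<nu> * norm ((1 / c) *\<^sub>R \<xi>) powr \<alpha> = t * \<nu> * norm \<xi> powr \<alpha>"
    using c ca t s by (simp add: powr_divide)
  finally show "(\<integral>x. complex_of_real (p t x) * iexp (\<xi> \<bullet> x) \<partial>lborel)
    = (\<integral>x. complex_of_real (c ^ DIM('a) * p s (c *\<^sub>R x)) * iexp (\<xi> \<bullet> x) \<partial>lborel)"
    using p_fourier[OF t, of \<xi>] by simp
qed

text \<open>The characteristic function at time 2 is the square of the one at time 1. The identity
  is kept almost everywhere, which avoids proving continuity of the convolution.\<close>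

lemma p_convolution:
  "AE x in lborel. integrable lborel (\<lambda>y. p 1 (x - y) * p 1 y) \<and> p 2 x = (\<integral>y. p 1 (x - y) * p 1 y \<partial>lborel)"
proof -
  have [measurable]: "p 1 \<in> borel_measurable borel" by (rule p_measurable) simp
  have tr: "integrable lborel (\<lambda>x. h (x - y))" "(\<integral>x. h (x - y) \<partial>lborel) = (\<integral>x. h x \<partial>lborel)"
    if "integrable lborel h" for h :: "'a \<Rightarrow> 'c::{banach, second_countable_topology}" and y
    using lborel_affine_integral[OF _ that, of 1 "- y"] by (simp_all add: add.commute)
  have int: "integrable (lborel \<Otimes>\<^sub>M lborel) (\<lambda>(x, y). p 1 (x - y) * p 1 y)"
  proof (rule integrableI_nonneg)
    show "AE z in lborel \<Otimes>\<^sub>M lborel. 0 \<le> (case z of (x, y) \<Rightarrow> p 1 (x - y) * p 1 y)"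
      by (auto simp: p_nonneg)
    have "(\<integral>\<^sup>+z. ennreal (case z of (x, y) \<Rightarrow> p 1 (x - y) * p 1 y) \<partial>(lborel \<Otimes>\<^sub>M lborel))
      = (\<integral>\<^sup>+y. (\<integral>\<^sup>+x. ennreal (p 1 (x - y) * p 1 y) \<partial>lborel) \<partial>lborel)"
      by (subst lborel_pair.nn_integral_snd[symmetric]) auto
    also have "\<dots> = (\<integral>\<^sup>+y. ennreal (p 1 y) \<partial>lborel)"
    proof (rule nn_integral_cong)
      fix y
      have "(\<integral>\<^sup>+x. ennreal (p 1 (x - y) * p 1 y) \<partial>lborel) = (\<integral>\<^sup>+x. ennreal (p 1 (x - y)) \<partial>lborel) * ennreal (p 1 y)"
        by (subst nn_integral_multc[symmetric]) (auto simp: ennreal_mult p_nonneg)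
      also have "(\<integral>\<^sup>+x. ennreal (p 1 (x - y)) \<partial>lborel) = 1"
        by (subst nn_integral_eq_integral) (auto simp: tr p_integrable p_integral p_nonneg)
      finally show "(\<integral>\<^sup>+x. ennreal (p 1 (x - y) * p 1 y) \<partial>lborel) = ennreal (p 1 y)" by simp
    qed
    also have "\<dots> < \<infinity>" by (simp add: p_nn_integral)
    finally show "(\<integral>\<^sup>+z. ennreal (case z of (x, y) \<Rightarrow> p 1 (x - y) * p 1 y) \<partial>(lborel \<Otimes>\<^sub>M lborel)) < \<infinity>" .
  qed measurable
  define q where "q x = (\<integral>y. p 1 (x - y) * p 1 y \<partial>lborel)" for x
  have qi: "integrable lborel q" using lborel_pair.integrable_fst'[OF int] by (simp add: q_def [abs_def])
  have four: "(\<integral>x. complex_of_real (q x) * iexp (\<xi> \<bullet> x) \<partial>lborel) = complex_of_real (exp (- (2 * \<nu> * norm \<xi> powr \<alpha>)))" for \<xi>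
  proof -
    let ?\<phi> = "complex_of_real (exp (- (1 * \<nu> * norm \<xi> powr \<alpha>)))"
    have ci: "integrable (lborel \<Otimes>\<^sub>M lborel) (\<lambda>(x, y). complex_of_real (p 1 (x - y) * p 1 y) * iexp (\<xi> \<bullet> x))"
      unfolding case_prod_unfold
      by (rule integrable_mult_iexp) (use int in \<open>auto simp: case_prod_unfold intro!: integrable_of_real simp del: of_real_mult\<close>)
    have pe: "integrable lborel (\<lambda>x. complex_of_real (p 1 x) * iexp (\<xi> \<bullet> x))"
      by (rule integrable_mult_iexp) (use p_integrable in auto)
    have "(\<integral>x. complex_of_real (q x) * iexp (\<xi> \<bullet> x) \<partial>lborel)
      = (\<integral>x. (\<integral>y. complex_of_real (p 1 (x - y) * p 1 y) * iexp (\<xi> \<bullet> x) \<partial>lborel) \<partial>lborel)"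
      unfolding q_def integral_mult_left_zero integral_complex_of_real ..
    also have "\<dots> = (\<integral>y. (\<integral>x. complex_of_real (p 1 (x - y) * p 1 y) * iexp (\<xi> \<bullet> x) \<partial>lborel) \<partial>lborel)"
      by (rule lborel_pair.Fubini_integral[OF ci, symmetric])
    also have "\<dots> = (\<integral>y. (complex_of_real (p 1 y) * iexp (\<xi> \<bullet> y)) * ?\<phi> \<partial>lborel)"
    proof (rule Bochner_Integration.integral_cong[OF refl])
      fix y
      have "(\<integral>x. complex_of_real (p 1 (x - y) * p 1 y) * iexp (\<xi> \<bullet> x) \<partial>lborel)
        = (\<integral>x. (complex_of_real (p 1 y) * iexp (\<xi> \<bullet> y)) * (complex_of_real (p 1 (x - y)) * iexp (\<xi> \<bullet> (x - y))) \<partial>lborel)"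
        by (intro Bochner_Integration.integral_cong refl)
          (simp add: inner_diff_right exp_diff right_diff_distrib)
      also have "\<dots> = (complex_of_real (p 1 y) * iexp (\<xi> \<bullet> y)) * (\<integral>x. complex_of_real (p 1 (x - y)) * iexp (\<xi> \<bullet> (x - y)) \<partial>lborel)"
        by simp
      also have "(\<integral>x. complex_of_real (p 1 (x - y)) * iexp (\<xi> \<bullet> (x - y)) \<partial>lborel) = ?\<phi>"
        unfolding tr(2)[OF pe] by (rule p_fourier) simp
      finally show "(\<integral>x. complex_of_real (p 1 (x - y) * p 1 y) * iexp (\<xi> \<bullet> x) \<partial>lborel)
        = (complex_of_real (p 1 y) * iexp (\<xi> \<bullet> y)) * ?\<phi>" .
    qed
    also have "\<dots> = ?\<phi> * ?\<phi>"
      unfolding integral_mult_left_zero by (subst p_fourier) auto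
    finally show ?thesis by (simp add: exp_add[symmetric] of_real_mult[symmetric] del: of_real_mult)
  qed
  have "AE x in lborel. p 2 x - q x = 0"
  proof (rule fourier_unique_lborel)
    show "integrable lborel (\<lambda>x. p 2 x - q x)" using qi p_integrable by simp
    fix \<xi> :: 'a
    have "integrable lborel (\<lambda>x. complex_of_real (h x) * iexp (\<xi> \<bullet> x))" if "integrable lborel h" for h
      by (rule integrable_mult_iexp) (use that in auto)
    then show "(\<integral>x. complex_of_real (p 2 x - q x) * iexp (\<xi> \<bullet> x) \<partial>lborel) = 0"
      using p_integrable[of 2] qi p_fourier[of 2 \<xi>] four[of \<xi>] by (simp add: left_diff_distrib)
  qed
  moreover have "AE x in lborel. integrable lborel (\<lambda>y. p 1 (x - y) * p 1 y)"
    using lborel_pair.AE_integrable_fst'[OF int] by simp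
  ultimately show ?thesis by eventually_elim (simp add: q_def)
qed

text \<open>
  \<open>p 1\<close> is bounded below on a ball around some point \<open>z\<close> and, by symmetry, around \<open>-z\<close>;
  convolving, \<open>p 2\<close> is bounded below around \<open>0\<close>, and scaling transfers this to all times.
\<close>

lemma p_positive_near_0:
  obtains \<kappa> \<delta> where "0 < \<kappa>" "0 < \<delta>" "\<And>x. norm x < \<delta> \<Longrightarrow> \<kappa> \<le> p 2 x"
proof -
  obtain z where z: "0 < p 1 z"
  proof (rule ccontr)
    assume *: "\<not> thesis"
    have "p 1 x = 0" for x
      using p_nonneg[of 1 x] * that[of x] by (cases "0 < p 1 x") auto
    then have "(\<integral>x. p 1 x \<partial>lborel) = 0" by simp
    then show False using p_integral[of 1] by simp
  qed
  define c where "c = p 1 z / 2"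
  have c: "0 < c" using z by (simp add: c_def)
  have "continuous (at z) (p 1)"
    using p_continuous[of 1] by (simp add: continuous_on_eq_continuous_at)
  then obtain \<eta> where \<eta>: "0 < \<eta>" "\<And>x. dist x z < \<eta> \<Longrightarrow> dist (p 1 x) (p 1 z) < c"
    using c unfolding continuous_at_eps_delta by blast
  have low: "c \<le> p 1 x" if "dist x z < \<eta>" for x
    using \<eta>(2)[OF that] by (simp add: dist_real_def c_def abs_if split: if_splits)
  \<comment> \<open>For x near 0 and y near -z, both y (by symmetry) and x - y are within reach of
    the bound \<open>c\<close>, so the convolution is at least c squared times the volume of the
    ball of such y.\<close>
  define \<kappa> where "\<kappa> = c * c * measure lborel (ball (- z) (\<eta> / 2))"
  have \<kappa>: "0 < \<kappa>" unfolding \<kappa>_def using c \<eta>(1) by (simp add: content_ball_pos)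
  have "AE x in lborel. norm x < \<eta> / 2 \<longrightarrow> \<kappa> \<le> p 2 x"
    using p_convolution
  proof eventually_elim
    case (elim x)
    show ?case
    proof
      assume x: "norm x < \<eta> / 2"
      have fin: "emeasure lborel (ball (- z) (\<eta> / 2)) < \<infinity>" by (rule emeasure_bounded_finite) simp
      have "\<kappa> = (\<integral>y. c * c * indicator (ball (- z) (\<eta> / 2)) y \<partial>lborel)"
        using fin by (simp add: \<kappa>_def)
      also have "\<dots> \<le> (\<integral>y. p 1 (x - y) * p 1 y \<partial>lborel)"
      proof (rule integral_mono)
        show "integrable lborel (\<lambda>y. c * c * indicator (ball (- z) (\<eta> / 2)) y)" using fin by simp
        show "integrable lborel (\<lambda>y. p 1 (x - y) * p 1 y)" using elim by simp
        fix y
        show "c * c * indicator (ball (- z) (\<eta> / 2)) y \<le> p 1 (x - y) * p 1 y"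
        proof (cases "y \<in> ball (- z) (\<eta> / 2)")
          case True
          then have y: "norm (z + y) < \<eta> / 2"
            using norm_minus_cancel[of "z + y"] by (simp add: dist_norm)
          then have "dist (- y) z < \<eta>"
            using \<eta>(1) norm_minus_cancel[of "z + y"] by (simp add: dist_norm algebra_simps)
          moreover have "dist (x - y) z < \<eta>"
            using norm_triangle_ineq4[of x "z + y"] x y by (simp add: dist_norm algebra_simps)
          ultimately have "c \<le> p 1 y" "c \<le> p 1 (x - y)" using low[of "- y"] low[of "x - y"] p_symmetric[of 1 y] by auto
          then show ?thesis using True c by (simp add: mult_mono)
        qed (simp add: p_nonneg)
      qed
      finally show "\<kappa> \<le> p 2 x" using elim by simp
    qed
  qed
  \<comment> \<open>Continuity of \<open>p 2\<close> makes the failure set open, which upgrades the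
    bound from almost every to every point.\<close>
  moreover have "open {x. \<not> (norm x < \<eta> / 2 \<longrightarrow> \<kappa> \<le> p 2 x)}"
  proof -
    have "{x. \<not> (norm x < \<eta> / 2 \<longrightarrow> \<kappa> \<le> p 2 x)} = {x. norm x < \<eta> / 2} \<inter> {x. p 2 x < \<kappa>}" by auto
    then show ?thesis using p_continuous[of 2] by (auto intro!: open_Int open_Collect_less continuous_intros)
  qed
  ultimately have "norm x < \<eta> / 2 \<longrightarrow> \<kappa> \<le> p 2 x" for x
    by (rule AE_lborel_open_imp[where P = "\<lambda>x. norm x < \<eta> / 2 \<longrightarrow> \<kappa> \<le> p 2 x", rotated])
  then show ?thesis using that[OF \<kappa>, of "\<eta> / 2"] \<eta>(1) by simp
qed

text \<open>The inverse of the spatial scale at time \<open>r\<close>, normalized to 1 at time 2,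
  where the lower bound near 0 is available.\<close>

definition rate :: "real \<Rightarrow> real" where
  "rate r = (2 / r) powr (1 / \<alpha>)"

lemma rate_pos: "0 < r \<Longrightarrow> 0 < rate r"
  by (simp add: rate_def)

lemma rate_antimono: "0 < r \<Longrightarrow> r \<le> r' \<Longrightarrow> rate r' \<le> rate r"
  unfolding rate_def using \<alpha> by (intro powr_mono2) (auto simp: frac_le)

lemma p_lower:
  obtains \<kappa> \<delta> where "0 < \<kappa>" "0 < \<delta>"
    "\<And>r x. 0 < r \<Longrightarrow> rate r * norm x < \<delta> \<Longrightarrow> \<kappa> * rate r ^ DIM('a) \<le> p r x"
proof -
  obtain \<kappa> \<delta> where k: "0 < \<kappa>" "0 < \<delta>" "\<And>x. norm x < \<delta> \<Longrightarrow> \<kappa> \<le> p 2 x" using p_positive_near_0 by blast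
  have "\<kappa> * rate r ^ DIM('a) \<le> p r x" if "0 < r" "rate r * norm x < \<delta>" for r x
  proof -
    have "\<kappa> \<le> p 2 (rate r *\<^sub>R x)" using that rate_pos[OF that(1)] by (intro k(3)) simp
    then show ?thesis
      using p_scaling[OF that(1), of 2 x] rate_pos[OF that(1)]
      by (simp add: rate_def[symmetric] mult.commute mult_left_mono)
  qed
  with k that show ?thesis by blast
qed

text \<open>For late times the density has spread beyond radius \<open>\<rho>\<close>, so the bound
  near the origin covers the whole ball; on a bounded time window the smallest \<open>rate\<close>,
  at \<open>r2\<close>, gives a uniform constant.\<close>

lemma p_lower_large_time:
  assumes \<rho>: "0 \<le> \<rho>"
  obtains r1 where "0 < r1" "\<And>r2. r1 \<le> r2 \<Longrightarrow> \<exists>c>0. \<forall>r\<in>{r1..r2}. \<forall>x. norm x \<le> \<rho> \<longrightarrow> c \<le> p r x"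
proof -
  obtain \<kappa> \<delta> where k: "0 < \<kappa>" "0 < \<delta>"
    "\<And>r x. 0 < r \<Longrightarrow> rate r * norm x < \<delta> \<Longrightarrow> \<kappa> * rate r ^ DIM('a) \<le> p r x" using p_lower by blast
  \<comment> \<open>Solves \<open>rate r1 = \<delta> / (\<rho> + 1)\<close>; the added 1 gives a
    strict inequality at radius \<open>\<rho>\<close> and avoids division by 0.\<close>
  define r1 where "r1 = 2 * ((\<rho> + 1) / \<delta>) powr \<alpha>"
  have r1: "0 < r1" using \<rho> k by (simp add: r1_def)
  have "2 / r1 = (\<delta> / (\<rho> + 1)) powr \<alpha>"
    using \<rho> k by (simp add: r1_def powr_divide)
  then have rr: "rate r1 = \<delta> / (\<rho> + 1)" using \<rho> k \<alpha> by (simp add: rate_def powr_powr)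
  show ?thesis
  proof (rule that[OF r1], rule exI, intro conjI ballI allI impI)
    fix r2 assume r2: "r1 \<le> r2"
    show "0 < \<kappa> * rate r2 ^ DIM('a)" using k r1 r2 rate_pos by simp
    fix r x assume r: "r \<in> {r1..r2}" and x: "norm (x :: 'a) \<le> \<rho>"
    have r0: "0 < r" using r r1 by simp
    have "rate r * norm x \<le> rate r1 * \<rho>"
      using r r1 x rate_antimono[of r1 r] rate_pos[OF r1] by (intro mult_mono) auto
    also have "\<dots> < \<delta>" unfolding rr using \<rho> k by (simp add: field_simps)
    finally have "\<kappa> * rate r ^ DIM('a) \<le> p r x" by (rule k(3)[OF r0])
    moreover have "\<kappa> * rate r2 ^ DIM('a) \<le> \<kappa> * rate r ^ DIM('a)"
      using k r r0 r1 rate_antimono[of r r2] rate_pos[of r2] by (intro mult_left_mono power_mono) auto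
    ultimately show "\<kappa> * rate r2 ^ DIM('a) \<le> p r x" by simp
  qed
qed

text \<open>
  For \<open>y\<close> in the ball of radius \<open>R\<close>, the ball of radius \<open>a/2\<close> around \<open>(1 - a/(2R)) y\<close> stays
  inside and lies within distance \<open>a\<close> of \<open>y\<close>; here \<open>a\<close> is of the order of the spatial scale
  \<open>r powr (1/\<alpha>)\<close> of \<open>p r\<close>.
\<close>

lemma p_ball_lower:
  assumes R: "0 < R" and r3: "0 < r3"
  obtains c where "0 < c" "\<And>r y. 0 < r \<Longrightarrow> r \<le> r3 \<Longrightarrow> y \<in> ball 0 R \<Longrightarrow>
    ennreal c \<le> (\<integral>\<^sup>+w\<in>ball 0 R. ennreal (p r (y - w)) \<partial>lborel)"
proof -
  obtain \<kappa> \<delta> where k: "0 < \<kappa>" "0 < \<delta>"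
    "\<And>r x. 0 < r \<Longrightarrow> rate r * norm x < \<delta> \<Longrightarrow> \<kappa> * rate r ^ DIM('a) \<le> p r x" using p_lower by blast
  \<comment> \<open>A lower bound, uniform in r \<le> \<open>r3\<close>, for
    \<open>rate r * a\<close> with the radius \<open>a\<close> used below.\<close>
  define m where "m = min \<delta> (R * rate r3)"
  have m: "0 < m" using k R rate_pos[OF r3] by (simp add: m_def)
  define V where "V = unit_ball_vol (real DIM('a))"
  have V: "0 < V" by (simp add: V_def)
  show ?thesis
  proof (rule that)
    show "0 < \<kappa> * V * (m / 2) ^ DIM('a)" using k m V by simp
    fix r and y :: 'a assume r: "0 < r" "r \<le> r3" and y: "y \<in> ball 0 R"
    note rp = rate_pos[OF r(1)]
    \<comment> \<open>At most \<open>\<delta> / rate r\<close> so that \<open>p_lower\<close>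
      applies within distance \<open>a\<close>, and at most \<open>R\<close> so that the shifted
      ball fits in.\<close>
    define a where "a = min (\<delta> / rate r) R"
    have a: "0 < a" "a \<le> R" "rate r * a \<le> \<delta>" using k R rp by (auto simp: a_def min_def field_simps)
    have am: "m \<le> rate r * a"
      using rate_antimono[OF r] rp R by (auto simp: a_def m_def min_def field_simps mult_left_mono
        intro: order_trans)
    define y' where "y' = (1 - a / (2 * R)) *\<^sub>R y"
    have ny: "norm y' \<le> R - a / 2"
    proof -
      have "norm y' \<le> (1 - a / (2 * R)) * R"
        unfolding y'_def norm_scaleR using y a R by (intro mult_mono) (auto simp: field_simps)
      also have "\<dots> = R - a / 2" using R by (simp add: field_simps)
      finally show ?thesis .
    qed
    have dy: "norm (y - y') \<le> a / 2"
    proof -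
      have "y - y' = (a / (2 * R)) *\<^sub>R y" by (simp add: y'_def algebra_simps)
      then have "norm (y - y') = a / (2 * R) * norm y" using a R by simp
      also have "\<dots> \<le> a / (2 * R) * R" using y a R by (intro mult_left_mono) auto
      finally show ?thesis using R by simp
    qed
    \<comment> \<open>The factor \<open>rate r ^ DIM('a)\<close> in the density compensates the
      volume of the ball, which is why the constant does not depend on r.\<close>
    have "ennreal (\<kappa> * V * (m / 2) ^ DIM('a)) \<le> ennreal (\<kappa> * rate r ^ DIM('a) * (V * (a / 2) ^ DIM('a)))"
    proof (rule ennreal_leI)
      have "(m / 2) ^ DIM('a) \<le> (rate r * (a / 2)) ^ DIM('a)" using m am by (intro power_mono) auto
      then have "\<kappa> * V * (m / 2) ^ DIM('a) \<le> \<kappa> * V * (rate r * (a / 2)) ^ DIM('a)"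
        using k V by (intro mult_left_mono) auto
      also have "\<dots> = \<kappa> * rate r ^ DIM('a) * (V * (a / 2) ^ DIM('a))"
        unfolding power_mult_distrib by (simp only: mult_ac)
      finally show "\<kappa> * V * (m / 2) ^ DIM('a) \<le> \<kappa> * rate r ^ DIM('a) * (V * (a / 2) ^ DIM('a))" .
    qed
    also have "\<dots> = ennreal (\<kappa> * rate r ^ DIM('a)) * emeasure lborel (ball y' (a / 2))"
      using a k rp V by (simp add: emeasure_ball V_def ennreal_mult[symmetric])
    also have "\<dots> = (\<integral>\<^sup>+w. ennreal (\<kappa> * rate r ^ DIM('a)) * indicator (ball y' (a / 2)) w \<partial>lborel)"
      by (simp add: nn_integral_cmult_indicator)
    also have "\<dots> \<le> (\<integral>\<^sup>+w\<in>ball 0 R. ennreal (p r (y - w)) \<partial>lborel)"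
    proof (rule nn_integral_mono)
      fix w
      show "ennreal (\<kappa> * rate r ^ DIM('a)) * indicator (ball y' (a / 2)) w \<le> ennreal (p r (y - w)) * indicator (ball 0 R) w"
      proof (cases "w \<in> ball y' (a / 2)")
        case True
        then have d: "norm (y' - w) < a / 2" by (simp add: dist_norm)
        have "norm w < R" using norm_triangle_ineq4[of y' "y' - w"] d ny by simp
        moreover have "norm (y - w) < a" using norm_triangle_ineq[of "y - y'" "y' - w"] d dy by simp
        then have "rate r * norm (y - w) < rate r * a" using rp by simp
        then have "\<kappa> * rate r ^ DIM('a) \<le> p r (y - w)" using a by (intro k(3) r) simp
        ultimately show ?thesis using True by (simp add: ennreal_leI)
      qed simp
    qed
    finally show "ennreal (\<kappa> * V * (m / 2) ^ DIM('a)) \<le> (\<integral>\<^sup>+w\<in>ball 0 R. ennreal (p r (y - w)) \<partial>lborel)" .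
  qed
qed

end

section \<open>The time-changed kernel\<close>

locale inverse_subordinator =
  fixes N :: "'v measure" and \<beta> :: real and D :: "real \<Rightarrow> 'v \<Rightarrow> real" and fE :: "real \<Rightarrow> real \<Rightarrow> real"
  assumes subordinator: "stable_subordinator N \<beta> D" and passage: "first_passage_density N D fE"
begin

sublocale N: prob_space N using subordinator by (simp add: stable_subordinator_def)

lemma D_measurable [measurable]: "0 \<le> r \<Longrightarrow> D r \<in> borel_measurable N"
  using subordinator by (simp add: stable_subordinator_def)

text \<open>Exponential Markov inequality with Laplace variable 1, where
  \<open>l powr \<beta>\<close> is 1 for every \<open>\<beta>\<close>.\<close>

lemma D_tail:
  assumes r: "0 \<le> r"
  shows "N.prob {\<omega> \<in> space N. D r \<omega> \<le> t} \<le> exp (t - r)"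
proof -
  note [measurable] = D_measurable[OF r]
  have E: "(\<integral>\<omega>. exp (- D r \<omega>) \<partial>N) = exp (- r)"
  proof -
    have "\<forall>l\<ge>0. (\<integral>\<omega>. exp (- (l * D r \<omega>)) \<partial>N) = exp (- (r * l powr \<beta>))"
      using subordinator r by (simp add: stable_subordinator_def)
    from this[rule_format, of 1] show ?thesis by simp
  qed
  have i: "integrable N (\<lambda>\<omega>. exp (- D r \<omega>))"
    using E not_integrable_integral_eq[of N "\<lambda>\<omega>. exp (- D r \<omega>)"] by fastforce
  have "N.prob {\<omega> \<in> space N. D r \<omega> \<le> t} = (\<integral>\<omega>. indicator {\<omega> \<in> space N. D r \<omega> \<le> t} \<omega> \<partial>N)" by simp
  also have "\<dots> \<le> (\<integral>\<omega>. exp t * exp (- D r \<omega>) \<partial>N)"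
  proof (rule integral_mono)
    show "integrable N (indicator {\<omega> \<in> space N. D r \<omega> \<le> t} :: 'v \<Rightarrow> real)"
      by (simp add: N.emeasure_eq_measure)
    show "indicator {\<omega> \<in> space N. D r \<omega> \<le> t} \<omega> \<le> exp t * exp (- D r \<omega>)" for \<omega>
      by (auto simp: indicator_def mult_exp_exp)
  qed (use i in auto)
  also have "\<dots> = exp t * exp (- r)" unfolding E[symmetric] by (rule integral_mult_right_zero)
  also have "\<dots> = exp (t - r)" by (simp add: mult_exp_exp)
  finally show ?thesis .
qed

text \<open>Ensures that the infimum in \<open>first_passage\<close> is almost surely taken over a
  nonempty set, without which its value would carry no meaning. The tail bounds along integer times
  tend to 0.\<close>

lemma D_unbounded: "AE \<omega> in N. \<exists>r\<ge>0. t < D r \<omega>"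
proof -
  have "(\<lambda>n. exp t * exp (- 1) ^ n) \<longlonglongrightarrow> exp t * 0"
    by (intro tendsto_intros LIMSEQ_realpow_zero) auto
  then have "(\<lambda>n. exp (t - real n)) \<longlonglongrightarrow> 0"
    by (simp add: exp_of_nat_mult[symmetric] mult_exp_exp)
  moreover have "N.prob {\<omega> \<in> space N. \<forall>n. D (real n) \<omega> \<le> t} \<le> exp (t - real n)" for n
  proof -
    have "N.prob {\<omega> \<in> space N. \<forall>n. D (real n) \<omega> \<le> t} \<le> N.prob {\<omega> \<in> space N. D (real n) \<omega> \<le> t}"
      by (rule N.finite_measure_mono) auto
    also have "\<dots> \<le> exp (t - real n)" by (rule D_tail) simp
    finally show ?thesis .
  qed
  ultimately have "N.prob {\<omega> \<in> space N. \<forall>n. D (real n) \<omega> \<le> t} \<le> 0"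
    by (intro LIMSEQ_le_const) auto
  then have "N.prob {\<omega> \<in> space N. \<forall>n. D (real n) \<omega> \<le> t} = 0"
    using measure_nonneg[of N] by (simp add: order_antisym)
  moreover have "{\<omega> \<in> space N. \<forall>n. D (real n) \<omega> \<le> t} \<in> N.events" by measurable
  ultimately have "{\<omega> \<in> space N. \<forall>n. D (real n) \<omega> \<le> t} \<in> null_sets N"
    by (simp add: null_sets_def N.emeasure_eq_measure)
  then have "AE \<omega> in N. \<not> (\<forall>n. D (real n) \<omega> \<le> t)" by (rule AE_I') auto
  then show ?thesis by eventually_elim (metis not_le of_nat_0_le_iff)
qed

lemma passage_measurable: "0 < t \<Longrightarrow> first_passage D t \<in> borel_measurable N"
  and fE_nonneg: "0 < t \<Longrightarrow> 0 \<le> fE t s"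
  using passage by (auto simp: first_passage_density_def distributed_def)

lemma fE_measurable2: "(\<lambda>(t, s). fE t s) \<in> borel_measurable (borel \<Otimes>\<^sub>M borel)"
  using passage by (simp add: first_passage_density_def)

lemma fE_measurable2' [measurable (raw)]:
  "h1 \<in> borel_measurable L \<Longrightarrow> h2 \<in> borel_measurable L \<Longrightarrow> (\<lambda>x. fE (h1 x) (h2 x)) \<in> borel_measurable L"
  using measurable_compose[of "\<lambda>x. (h1 x, h2 x)" L, OF _ fE_measurable2] by simp

lemma fE_integral_set:
  assumes t: "0 < t" and S: "S \<in> sets borel"
  shows "(\<integral>\<^sup>+s\<in>S. ennreal (fE t s) \<partial>lborel) = ennreal (N.prob {\<omega> \<in> space N. first_passage D t \<omega> \<in> S})"
proof -
  have d: "distributed N lborel (first_passage D t) (\<lambda>s. ennreal (fE t s))"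
    using passage t by (simp add: first_passage_density_def)
  have "emeasure N (first_passage D t -` S \<inter> space N) = (\<integral>\<^sup>+s\<in>S. ennreal (fE t s) \<partial>lborel)"
    using distributed_emeasure[OF d] S by simp
  moreover have "first_passage D t -` S \<inter> space N = {\<omega> \<in> space N. first_passage D t \<omega> \<in> S}" by auto
  ultimately show ?thesis by (simp add: N.emeasure_eq_measure)
qed

lemma passage_le: "0 \<le> r \<Longrightarrow> t < D r \<omega> \<Longrightarrow> first_passage D t \<omega> \<le> r"
  unfolding first_passage_def by (rule cInf_lower) (auto intro!: bdd_belowI[of _ 0])

lemma passage_late:
  assumes t: "0 < t" and r: "0 \<le> r"
  shows "N.prob {\<omega> \<in> space N. r < first_passage D t \<omega>} \<le> exp (t - r)"
proof -
  note [measurable] = passage_measurable[OF t] D_measurable[OF r]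
  have "N.prob {\<omega> \<in> space N. r < first_passage D t \<omega>} \<le> N.prob {\<omega> \<in> space N. D r \<omega> \<le> t}"
    by (rule N.finite_measure_mono) (use passage_le[OF r] in \<open>force simp: not_less[symmetric]\<close>, measurable)
  also have "\<dots> \<le> exp (t - r)" by (rule D_tail[OF r])
  finally show ?thesis .
qed

text \<open>Passage before r means that some earlier value exceeds t, and monotonicity carries this
  to time r; extracting that value from the infimum uses \<open>D_unbounded\<close>.\<close>

lemma passage_early:
  assumes t: "0 < t" and r: "0 \<le> r"
  shows "N.prob {\<omega> \<in> space N. first_passage D t \<omega> < r} \<le> N.prob {\<omega> \<in> space N. t < D r \<omega>}"
proof (rule N.finite_measure_mono_AE)
  note [measurable] = passage_measurable[OF t] D_measurable[OF r]
  have "AE \<omega> in N. mono_on {0..} (\<lambda>r. D r \<omega>)"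
    using subordinator by (auto simp: stable_subordinator_def)
  with D_unbounded[of t]
  show "AE \<omega> in N. \<omega> \<in> {\<omega> \<in> space N. first_passage D t \<omega> < r} \<longrightarrow> \<omega> \<in> {\<omega> \<in> space N. t < D r \<omega>}"
  proof eventually_elim
    case (elim \<omega>)
    show ?case
    proof safe
      assume "first_passage D t \<omega> < r"
      moreover have "{r. 0 \<le> r \<and> t < D r \<omega>} \<noteq> {}" using elim by auto
      ultimately have "\<exists>r'\<in>{r. 0 \<le> r \<and> t < D r \<omega>}. r' < r"
        unfolding first_passage_def by (intro cInf_lessD)
      then obtain r' where "0 \<le> r'" "t < D r' \<omega>" "r' < r" by auto
      moreover from this have "D r' \<omega> \<le> D r \<omega>" using elim r by (intro mono_onD[of "{0..}" "\<lambda>r. D r \<omega>"]) auto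
      ultimately show "t < D r \<omega>" by simp
    qed
  qed
  show "{\<omega> \<in> space N. t < D r \<omega>} \<in> N.events" by measurable
qed

text \<open>The infimum is almost surely nonnegative, and the value 0 has no mass because the law
  has a Lebesgue density.\<close>

lemma passage_nonneg:
  assumes t: "0 < t"
  shows "N.prob {\<omega> \<in> space N. first_passage D t \<omega> \<le> 0} = 0"
proof -
  note [measurable] = passage_measurable[OF t]
  have z: "N.prob {\<omega> \<in> space N. first_passage D t \<omega> \<in> {0}} = 0"
  proof -
    have "(\<integral>\<^sup>+s\<in>{0}. ennreal (fE t s) \<partial>lborel) = (\<integral>\<^sup>+s. 0 \<partial>(lborel :: real measure))"
      by (rule nn_integral_cong_AE, use AE_lborel_singleton[of "0 :: real"] in eventually_elim) (auto simp: indicator_def)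
    then show ?thesis using fE_integral_set[OF t, of "{0}"] by simp
  qed
  have "N.prob {\<omega> \<in> space N. first_passage D t \<omega> \<le> 0} \<le> N.prob {\<omega> \<in> space N. first_passage D t \<omega> \<in> {0}}"
  proof (rule N.finite_measure_mono_AE)
    show "AE \<omega> in N. \<omega> \<in> {\<omega> \<in> space N. first_passage D t \<omega> \<le> 0} \<longrightarrow> \<omega> \<in> {\<omega> \<in> space N. first_passage D t \<omega> \<in> {0}}"
      using D_unbounded[of t]
    proof eventually_elim
      case (elim \<omega>)
      then have "0 \<le> first_passage D t \<omega>"
        unfolding first_passage_def by (intro cInf_greatest) auto
      then show ?case by auto
    qed
    show "{\<omega> \<in> space N. first_passage D t \<omega> \<in> {0}} \<in> N.events" by measurable
  qed
  then show ?thesis using z measure_nonneg[of N "{\<omega> \<in> space N. first_passage D t \<omega> \<le> 0}"] by linarith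
qed

lemma exp_minus_2_le: "exp (- 2 :: real) \<le> 1 / 4"
proof -
  have "2 \<le> exp (1 :: real)" using exp_ge_add_one_self[of 1] by simp
  then have "2 * 2 \<le> exp (1 :: real) * exp 1" by (intro mult_mono) auto
  then have "4 \<le> exp (2 :: real)" by (simp add: mult_exp_exp)
  then show ?thesis by (simp add: exp_minus field_simps)
qed

text \<open>By \<open>passage_late\<close> the mass above 3 is at most exp(t - 3) \<le> exp(-2)
  \<le> 1/4 when t \<le> 1. This leaves 3/4, of which 1/2 is kept.\<close>

lemma fE_mass_short_time:
  assumes t: "0 < t" "t \<le> 1"
  shows "ennreal (1 / 2) \<le> (\<integral>\<^sup>+s\<in>{0<..3}. ennreal (fE t s) \<partial>lborel)"
proof -
  note [measurable] = passage_measurable[OF t(1)]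
  let ?E = "first_passage D t"
  have "exp (t - 3) \<le> exp (- 2)" using t by simp
  then have late: "N.prob {\<omega> \<in> space N. 3 < ?E \<omega>} \<le> 1 / 4"
    using passage_late[OF t(1), of 3] exp_minus_2_le by linarith
  have "1 = N.prob (space N)" by (simp add: N.prob_space)
  also have "space N = {\<omega> \<in> space N. ?E \<omega> \<in> {0<..3}} \<union> ({\<omega> \<in> space N. ?E \<omega> \<le> 0} \<union> {\<omega> \<in> space N. 3 < ?E \<omega>})" by auto
  also have "N.prob \<dots> \<le> N.prob {\<omega> \<in> space N. ?E \<omega> \<in> {0<..3}} + N.prob ({\<omega> \<in> space N. ?E \<omega> \<le> 0} \<union> {\<omega> \<in> space N. 3 < ?E \<omega>})"
    by (rule measure_Un_le) measurable
  also have "N.prob ({\<omega> \<in> space N. ?E \<omega> \<le> 0} \<union> {\<omega> \<in> space N. 3 < ?E \<omega>}) \<le> N.prob {\<omega> \<in> space N. ?E \<omega> \<le> 0} + N.prob {\<omega> \<in> space N. 3 < ?E \<omega>}"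
    by (rule measure_Un_le) measurable
  finally have "1 / 2 \<le> N.prob {\<omega> \<in> space N. ?E \<omega> \<in> {0<..3}}" using passage_nonneg[OF t(1)] late by simp
  then show ?thesis by (subst fE_integral_set[OF t(1)]) (simp, rule ennreal_leI)
qed

text \<open>\<open>t1\<close> is so large that \<open>D r1\<close> exceeds it with probability below
  1/4, which controls passage before \<open>r1\<close>; \<open>r2\<close> exceeds the last time t1 +
  1 by at least 2, so later passage has probability at most exp(-2).\<close>

lemma fE_mass_window:
  assumes r1: "0 < r1"
  obtains t1 r2 where "0 < t1" "r1 \<le> r2"
    "\<And>t. t1 \<le> t \<Longrightarrow> t \<le> t1 + 1 \<Longrightarrow> ennreal (1 / 2) \<le> (\<integral>\<^sup>+s\<in>{r1..r2}. ennreal (fE t s) \<partial>lborel)"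
proof -
  note [measurable] = D_measurable[OF less_imp_le[OF r1]]
  have "(\<lambda>n. N.prob {\<omega> \<in> space N. real n < D r1 \<omega>}) \<longlonglongrightarrow> N.prob (\<Inter>n. {\<omega> \<in> space N. real n < D r1 \<omega>})"
    by (rule N.finite_Lim_measure_decseq) (auto simp: decseq_def)
  moreover have "(\<Inter>n. {\<omega> \<in> space N. real n < D r1 \<omega>}) = {}"
  proof (rule equals0I)
    fix \<omega> assume *: "\<omega> \<in> (\<Inter>n. {\<omega> \<in> space N. real n < D r1 \<omega>})"
    obtain n :: nat where "D r1 \<omega> \<le> real n" using real_arch_simple by blast
    then show False using * by (auto simp: not_less[symmetric])
  qed
  ultimately have "(\<lambda>n. N.prob {\<omega> \<in> space N. real n < D r1 \<omega>}) \<longlonglongrightarrow> 0" by simp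
  from order_tendstoD(2)[OF this, of "1/4"] obtain n0 where n0: "\<And>n. n0 \<le> n \<Longrightarrow> N.prob {\<omega> \<in> space N. real n < D r1 \<omega>} < 1 / 4"
    by (auto simp: eventually_sequentially)
  \<comment> \<open>The successor makes \<open>t1\<close> positive even if \<open>n0\<close> is
    0.\<close>
  define t1 where "t1 = real (Suc n0)"
  define r2 where "r2 = max r1 (t1 + 3)"
  show ?thesis
  proof (rule that[of t1 r2])
    show "0 < t1" "r1 \<le> r2" by (auto simp: t1_def r2_def)
    fix t assume t: "t1 \<le> t" "t \<le> t1 + 1"
    have t0: "0 < t" using t by (simp add: t1_def)
    note [measurable] = passage_measurable[OF t0]
    let ?E = "first_passage D t"
    have "N.prob {\<omega> \<in> space N. ?E \<omega> < r1} \<le> N.prob {\<omega> \<in> space N. t < D r1 \<omega>}"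
      by (rule passage_early[OF t0]) (use r1 in simp)
    also have "\<dots> \<le> N.prob {\<omega> \<in> space N. real (Suc n0) < D r1 \<omega>}"
      by (rule N.finite_measure_mono) (use t in \<open>auto simp: t1_def\<close>)
    also have "\<dots> \<le> 1 / 4" using n0[of "Suc n0"] by simp
    finally have early: "N.prob {\<omega> \<in> space N. ?E \<omega> < r1} \<le> 1 / 4" .
    have "t - r2 \<le> - 2" using t by (simp add: r2_def)
    then have "exp (t - r2) \<le> exp (- 2)" by simp
    moreover have "0 \<le> r2" using r1 by (simp add: r2_def)
    ultimately have late: "N.prob {\<omega> \<in> space N. r2 < ?E \<omega>} \<le> 1 / 4"
      using passage_late[OF t0, of r2] exp_minus_2_le by linarith
    have "1 = N.prob (space N)" by (simp add: N.prob_space)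
    also have "space N = {\<omega> \<in> space N. ?E \<omega> \<in> {r1..r2}} \<union> ({\<omega> \<in> space N. ?E \<omega> < r1} \<union> {\<omega> \<in> space N. r2 < ?E \<omega>})" by auto
    also have "N.prob \<dots> \<le> N.prob {\<omega> \<in> space N. ?E \<omega> \<in> {r1..r2}} + N.prob ({\<omega> \<in> space N. ?E \<omega> < r1} \<union> {\<omega> \<in> space N. r2 < ?E \<omega>})"
      by (rule measure_Un_le) measurable
    also have "N.prob ({\<omega> \<in> space N. ?E \<omega> < r1} \<union> {\<omega> \<in> space N. r2 < ?E \<omega>}) \<le> N.prob {\<omega> \<in> space N. ?E \<omega> < r1} + N.prob {\<omega> \<in> space N. r2 < ?E \<omega>}"
      by (rule measure_Un_le) measurable
    finally have "1 / 2 \<le> N.prob {\<omega> \<in> space N. ?E \<omega> \<in> {r1..r2}}" using early late by simp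
    then show "ennreal (1 / 2) \<le> (\<integral>\<^sup>+s\<in>{r1..r2}. ennreal (fE t s) \<partial>lborel)"
      by (subst fE_integral_set[OF t0]) (simp, rule ennreal_leI)
  qed
qed

end

lemma AE_lborel_reflect:
  fixes P :: "'a::euclidean_space \<Rightarrow> bool"
  assumes "AE x in lborel. P x"
  shows "AE x in lborel. P (y - x)"
proof -
  obtain S where S: "S \<in> null_sets lborel" "{x. \<not> P x} \<subseteq> S"
    using assms by (auto simp: eventually_ae_filter)
  have [measurable]: "S \<in> sets borel" using S by auto
  have "(\<integral>\<^sup>+x. indicator S (y - x) \<partial>lborel) = (\<integral>\<^sup>+x. indicator S x \<partial>lborel)"
    by (rule nn_integral_lborel_reflect) simp
  also have "\<dots> = 0" using S by auto
  finally have "AE x in lborel. indicator S (y - x) = (0 :: ennreal)"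
    by (subst (asm) nn_integral_0_iff_AE) auto
  then show ?thesis by eventually_elim (use S in \<open>auto simp: indicator_def split: if_splits\<close>)
qed

section \<open>Mass and lower bounds of the time-changed kernel\<close>

locale kernel = stable_density \<nu> \<alpha> p + inverse_subordinator N \<beta> D fE
  for \<nu> \<alpha> :: real and p :: "real \<Rightarrow> 'a::euclidean_space \<Rightarrow> real"
    and N :: "'v measure" and \<beta> :: real and D :: "real \<Rightarrow> 'v \<Rightarrow> real" and fE :: "real \<Rightarrow> real \<Rightarrow> real"
begin

definition G :: "real \<Rightarrow> 'a \<Rightarrow> real" where
  "G = time_changed_density p fE"

text \<open>The same integral with values in [0, \<infinity>], suited to Tonelli. For positive times
  it can differ from \<open>G\<close> only where it is infinite and the Bochner integral returns 0;
  by \<open>G_AE\<close> such points form a null set.\<close>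

definition nnG :: "real \<Rightarrow> 'a \<Rightarrow> ennreal" where
  "nnG t x = (\<integral>\<^sup>+s\<in>{0<..}. ennreal (p s x * fE t s) \<partial>lborel)"

text \<open>The indicator confines the function to positive times, where \<open>p\<close> is known
  to be continuous.\<close>

lemma p_measurable2: "(\<lambda>(s, x). indicator {0<..} s * p s x) \<in> borel_measurable (borel \<Otimes>\<^sub>M borel)"
proof -
  have "continuous_on ({0<..} \<times> UNIV) (\<lambda>(t, x). p t x)"
    using density by (simp add: stable_transition_density_def)
  then have "(\<lambda>z. indicator ({0<..} \<times> UNIV) z *\<^sub>R (case z of (t, x) \<Rightarrow> p t x)) \<in> borel_measurable borel"
    by (rule borel_measurable_continuous_on_indicator[rotated]) (simp add: open_Times borel_open)
  then show ?thesis unfolding borel_prod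
    by (rule measurable_cong[THEN iffD1, rotated]) (auto simp: indicator_def)
qed

lemma p_measurable2' [measurable (raw)]:
  "h1 \<in> borel_measurable L \<Longrightarrow> h2 \<in> borel_measurable L \<Longrightarrow>
    (\<lambda>x. indicator {0<..} (h1 x) * p (h1 x) (h2 x)) \<in> borel_measurable L"
  using measurable_compose[of "\<lambda>x. (h1 x, h2 x)" L, OF _ p_measurable2] by simp

lemma G_eq: "G t x = (\<integral>s. (indicator {0<..} s * p s x) * fE t s \<partial>lborel)"
  unfolding G_def time_changed_density_def set_lebesgue_integral_def by (simp add: mult.assoc)

lemma nnG_eq: "nnG t x = (\<integral>\<^sup>+s. ennreal ((indicator {0<..} s * p s x) * fE t s) \<partial>lborel)"
  unfolding nnG_def by (intro nn_integral_cong) (auto simp: indicator_def)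

lemma G_measurable: "(\<lambda>(t, x). G t x) \<in> borel_measurable (borel \<Otimes>\<^sub>M borel)"
proof -
  have "(\<lambda>(z, s). (indicator {0<..} s * p s (snd z)) * fE (fst z) s)
      \<in> borel_measurable ((borel \<Otimes>\<^sub>M borel) \<Otimes>\<^sub>M lborel)"
    unfolding case_prod_unfold by measurable
  from lborel.borel_measurable_lebesgue_integral[OF this] show ?thesis
    unfolding G_eq case_prod_unfold .
qed

lemma G_measurable' [measurable (raw)]:
  "h1 \<in> borel_measurable L \<Longrightarrow> h2 \<in> borel_measurable L \<Longrightarrow> (\<lambda>x. G (h1 x) (h2 x)) \<in> borel_measurable L"
  using measurable_compose[of "\<lambda>x. (h1 x, h2 x)" L, OF _ G_measurable] by simp

lemma nnG_measurable [measurable]: "nnG t \<in> borel_measurable borel"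
proof -
  have "(\<lambda>(x, s). ennreal ((indicator {0<..} s * p s x) * fE t s)) \<in> borel_measurable (borel \<Otimes>\<^sub>M lborel)"
    unfolding case_prod_unfold by measurable
  from lborel.borel_measurable_nn_integral[OF this] show ?thesis
    unfolding nnG_eq[abs_def] case_prod_unfold .
qed

lemma G_nonneg: "0 < t \<Longrightarrow> 0 \<le> G t x"
  unfolding G_eq by (intro integral_nonneg_AE AE_I2) (auto simp: indicator_def p_nonneg fE_nonneg)

lemma nnG_integral: "0 < t \<Longrightarrow> (\<integral>\<^sup>+x. nnG t x \<partial>lborel) \<le> 1"
proof -
  assume t: "0 < t"
  have "(\<integral>\<^sup>+x. nnG t x \<partial>lborel) = (\<integral>\<^sup>+x. (\<integral>\<^sup>+s. ennreal ((indicator {0<..} s * p s x) * fE t s) \<partial>lborel) \<partial>lborel)"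
    unfolding nnG_eq ..
  also have "\<dots> = (\<integral>\<^sup>+s. (\<integral>\<^sup>+x. ennreal ((indicator {0<..} s * p s x) * fE t s) \<partial>lborel) \<partial>lborel)"
    by (rule lborel_pair.Fubini'[symmetric]) (unfold case_prod_unfold, measurable)
  also have "\<dots> = (\<integral>\<^sup>+s\<in>{0<..}. ennreal (fE t s) \<partial>lborel)"
  proof (rule nn_integral_cong)
    fix s :: real
    show "(\<integral>\<^sup>+x. ennreal ((indicator {0<..} s * p s x) * fE t s) \<partial>lborel) = ennreal (fE t s) * indicator {0<..} s"
    proof (cases "0 < s")
      case True
      note [measurable] = p_measurable[OF True]
      have "(\<integral>\<^sup>+x. ennreal ((indicator {0<..} s * p s x) * fE t s) \<partial>lborel) = (\<integral>\<^sup>+x. ennreal (p s x) * ennreal (fE t s) \<partial>lborel)"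
        using True by (intro nn_integral_cong) (simp add: ennreal_mult p_nonneg fE_nonneg t)
      also have "\<dots> = ennreal (fE t s)"
        by (subst nn_integral_multc) (auto simp: p_nn_integral True)
      finally show ?thesis using True by simp
    qed simp
  qed
  also have "\<dots> \<le> 1" by (subst fE_integral_set[OF t]) (auto simp: ennreal_le_1)
  finally show ?thesis .
qed

lemma G_AE: "0 < t \<Longrightarrow> AE x in lborel. ennreal (G t x) = nnG t x"
proof -
  assume t: "0 < t"
  have "AE x in lborel. nnG t x \<noteq> \<infinity>"
    by (rule nn_integral_PInf_AE) (use nnG_integral[OF t] in \<open>auto simp: top_unique\<close>)
  then show ?thesis
  proof eventually_elim
    case (elim x)
    have "integrable lborel (\<lambda>s. (indicator {0<..} s * p s x) * fE t s)"
    proof (rule integrableI_nonneg)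
      show "(\<lambda>s. (indicator {0<..} s * p s x) * fE t s) \<in> borel_measurable lborel" by measurable
      show "AE s in lborel. 0 \<le> (indicator {0<..} s * p s x) * fE t s"
        by (auto simp: indicator_def p_nonneg fE_nonneg t)
      show "(\<integral>\<^sup>+s. ennreal ((indicator {0<..} s * p s x) * fE t s) \<partial>lborel) < \<infinity>"
        using elim unfolding nnG_eq by (simp add: less_top)
    qed
    then show ?case unfolding G_eq nnG_eq
      by (intro nn_integral_eq_integral[symmetric]) (auto simp: indicator_def p_nonneg fE_nonneg t)
  qed
qed

lemma G_integrable: "0 < t \<Longrightarrow> integrable lborel (G t)"
proof (rule integrableI_nonneg)
  assume t: "0 < t"
  show "G t \<in> borel_measurable lborel" by measurable
  show "AE x in lborel. 0 \<le> G t x" by (simp add: G_nonneg t)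
  have "(\<integral>\<^sup>+x. ennreal (G t x) \<partial>lborel) = (\<integral>\<^sup>+x. nnG t x \<partial>lborel)"
    by (rule nn_integral_cong_AE[OF G_AE[OF t]])
  also have "\<dots> < \<infinity>" using nnG_integral[OF t] by (rule le_less_trans) simp
  finally show "(\<integral>\<^sup>+x. ennreal (G t x) \<partial>lborel) < \<infinity>" .
qed

text \<open>At least half of the law of the passage time sits in a window on which \<open>p\<close>
  is bounded below on the ball. The unit of time from \<open>t1\<close> on is the period in which
  the blow-up takes place.\<close>

lemma G_lower:
  assumes \<rho>: "0 \<le> \<rho>"
  obtains t1 c where "0 < t1" "0 < c"
    "\<And>t. t1 \<le> t \<Longrightarrow> t \<le> t1 + 1 \<Longrightarrow> AE x in lborel. norm x \<le> \<rho> \<longrightarrow> c \<le> G t x"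
proof -
  obtain r1 where r1: "0 < r1" "\<And>r2. r1 \<le> r2 \<Longrightarrow> \<exists>c>0. \<forall>r\<in>{r1..r2}. \<forall>x. norm (x :: 'a) \<le> \<rho> \<longrightarrow> c \<le> p r x"
    using p_lower_large_time[OF \<rho>] by blast
  obtain t1 r2 where t1: "0 < t1" "r1 \<le> r2"
    "\<And>t. t1 \<le> t \<Longrightarrow> t \<le> t1 + 1 \<Longrightarrow> ennreal (1 / 2) \<le> (\<integral>\<^sup>+s\<in>{r1..r2}. ennreal (fE t s) \<partial>lborel)"
    using fE_mass_window[OF r1(1)] by blast
  obtain c where c: "0 < c" "\<And>r x. r \<in> {r1..r2} \<Longrightarrow> norm (x :: 'a) \<le> \<rho> \<Longrightarrow> c \<le> p r x"
    using r1(2)[OF t1(2)] by blast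
  show ?thesis
  proof (rule that[OF t1(1), of "c / 2"])
    show "0 < c / 2" using c by simp
    fix t assume t: "t1 \<le> t" "t \<le> t1 + 1"
    have t0: "0 < t" using t t1 by simp
    show "AE x in lborel. norm x \<le> \<rho> \<longrightarrow> c / 2 \<le> G t x"
      using G_AE[OF t0]
    proof eventually_elim
      case (elim x)
      show ?case
      proof
        assume x: "norm x \<le> \<rho>"
        have "ennreal (c / 2) = ennreal c * ennreal (1 / 2)" using c by (subst ennreal_mult[symmetric]) auto
        also have "\<dots> \<le> ennreal c * (\<integral>\<^sup>+s\<in>{r1..r2}. ennreal (fE t s) \<partial>lborel)"
          by (intro mult_left_mono t1(3) t) auto
        also have "\<dots> = (\<integral>\<^sup>+s. ennreal c * (ennreal (fE t s) * indicator {r1..r2} s) \<partial>lborel)"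
          by (rule nn_integral_cmult[symmetric]) measurable
        also have "\<dots> \<le> nnG t x"
          unfolding nnG_def
        proof (rule nn_integral_mono)
          fix s :: real
          show "ennreal c * (ennreal (fE t s) * indicator {r1..r2} s) \<le> ennreal (p s x * fE t s) * indicator {0<..} s"
          proof (cases "s \<in> {r1..r2}")
            case True
            have "c * fE t s \<le> p s x * fE t s" using c(2)[OF True x] fE_nonneg[OF t0] by (intro mult_right_mono)
            then show ?thesis using True r1(1) c fE_nonneg[OF t0, of s]
              by (simp add: ennreal_mult[symmetric] ennreal_leI)
          qed simp
        qed
        also have "\<dots> = ennreal (G t x)" using elim by simp
        finally show "c / 2 \<le> G t x" using G_nonneg[OF t0, of x] c by simp
      qed
    qed
  qed
qed

text \<open>For t \<le> 1 half of the passage law lies in (0, 3], and \<open>p_ball_lower\<close> is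
  uniform down to time 0, so the bound does not degenerate as t tends to 0.\<close>

lemma G_ball_lower:
  assumes R: "0 < R"
  obtains c where "0 < c" "\<And>t y. 0 < t \<Longrightarrow> t \<le> 1 \<Longrightarrow> y \<in> ball 0 R \<Longrightarrow>
    ennreal c \<le> (\<integral>\<^sup>+w\<in>ball 0 R. ennreal (G t (y - w)) \<partial>lborel)"
proof -
  obtain c where c: "0 < c" "\<And>r y. 0 < r \<Longrightarrow> r \<le> 3 \<Longrightarrow> y \<in> ball 0 R \<Longrightarrow>
    ennreal c \<le> (\<integral>\<^sup>+w\<in>ball 0 R. ennreal (p r (y - w)) \<partial>lborel)"
    using p_ball_lower[OF R, of 3] by auto
  show ?thesis
  proof (rule that[of "c / 2"])
    show "0 < c / 2" using c by simp
    fix t :: real and y :: 'a assume t: "0 < t" "t \<le> 1" and y: "y \<in> ball 0 R"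
    have [measurable]: "ball (0 :: 'a) R \<in> sets borel" by simp
    have "ennreal (c / 2) = ennreal c * ennreal (1 / 2)" using c by (subst ennreal_mult[symmetric]) auto
    also have "\<dots> \<le> ennreal c * (\<integral>\<^sup>+s\<in>{0<..3}. ennreal (fE t s) \<partial>lborel)"
      by (intro mult_left_mono fE_mass_short_time t) auto
    also have "\<dots> = (\<integral>\<^sup>+s. ennreal c * (ennreal (fE t s) * indicator {0<..3} s) \<partial>lborel)"
      by (rule nn_integral_cmult[symmetric]) measurable
    also have "\<dots> \<le> (\<integral>\<^sup>+s. (\<integral>\<^sup>+w. ennreal ((indicator {0<..} s * p s (y - w)) * fE t s) * indicator (ball 0 R) w \<partial>lborel) \<partial>lborel)"
    proof (rule nn_integral_mono)
      fix s :: real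
      show "ennreal c * (ennreal (fE t s) * indicator {0<..3} s)
        \<le> (\<integral>\<^sup>+w. ennreal ((indicator {0<..} s * p s (y - w)) * fE t s) * indicator (ball 0 R) w \<partial>lborel)"
      proof (cases "s \<in> {0<..3}")
        case True
        then have s: "0 < s" "s \<le> 3" by auto
        note [measurable] = p_measurable[OF s(1)]
        have "ennreal c * ennreal (fE t s) \<le> (\<integral>\<^sup>+w\<in>ball 0 R. ennreal (p s (y - w)) \<partial>lborel) * ennreal (fE t s)"
          by (intro mult_right_mono c(2) s y) auto
        also have "\<dots> = (\<integral>\<^sup>+w. (ennreal (p s (y - w)) * indicator (ball 0 R) w) * ennreal (fE t s) \<partial>lborel)"
          by (rule nn_integral_multc[symmetric]) measurable
        also have "\<dots> = (\<integral>\<^sup>+w. ennreal ((indicator {0<..} s * p s (y - w)) * fE t s) * indicator (ball 0 R) w \<partial>lborel)"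
          using s by (intro nn_integral_cong) (simp add: ennreal_mult p_nonneg fE_nonneg t mult_ac)
        finally show ?thesis using True by simp
      qed simp
    qed
    also have "\<dots> = (\<integral>\<^sup>+w. (\<integral>\<^sup>+s. ennreal ((indicator {0<..} s * p s (y - w)) * fE t s) * indicator (ball 0 R) w \<partial>lborel) \<partial>lborel)"
      by (rule lborel_pair.Fubini') (unfold case_prod_unfold, measurable)
    also have "\<dots> = (\<integral>\<^sup>+w\<in>ball 0 R. nnG t (y - w) \<partial>lborel)"
      unfolding nnG_eq by (intro nn_integral_cong nn_integral_multc) measurable
    also have "\<dots> = (\<integral>\<^sup>+w\<in>ball 0 R. ennreal (G t (y - w)) \<partial>lborel)"
    proof (rule nn_integral_cong_AE)
      have "AE w in lborel. ennreal (G t (y - w)) = nnG t (y - w)"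
        using G_AE[OF t(1)] by (rule AE_lborel_reflect)
      then show "AE w in lborel. nnG t (y - w) * indicator (ball 0 R) w = ennreal (G t (y - w)) * indicator (ball 0 R) w"
        by eventually_elim simp
    qed
    finally show "ennreal (c / 2) \<le> (\<integral>\<^sup>+w\<in>ball 0 R. ennreal (G t (y - w)) \<partial>lborel)" .
  qed
qed

end

section \<open>Blow-up of the second moment\<close>

text \<open>The convex power lies above its tangent at \<open>a\<close>. Working with a lower bound
  \<open>a\<close> of a possibly infinite mean makes the argument independent of
  integrability.\<close>

lemma (in prob_space) powr_jensen:
  fixes X :: "'a \<Rightarrow> real"
  assumes [measurable]: "X \<in> borel_measurable M" and X: "\<And>\<omega>. 0 \<le> X \<omega>" and \<gamma>: "0 < \<gamma>" and a: "0 \<le> a"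
    and le: "ennreal a \<le> (\<integral>\<^sup>+\<omega>. ennreal (X \<omega>) \<partial>M)"
  shows "ennreal (a powr (1 + \<gamma>)) \<le> (\<integral>\<^sup>+\<omega>. ennreal (X \<omega> powr (1 + \<gamma>)) \<partial>M)"
proof (cases "a = 0")
  case False
  then have a: "0 < a" using a by simp
  let ?q = "1 + \<gamma>"
  \<comment> \<open>Young's inequality with exponents \<open>1 + \<gamma>\<close> and
    \<open>(1 + \<gamma>) / \<gamma>\<close>, applied to x and
    \<open>a powr \<gamma>\<close>.\<close>
  have tangent: "?q * a powr \<gamma> * x \<le> x powr ?q + \<gamma> * a powr ?q" if "0 \<le> x" for x
  proof (cases "x = 0")
    case False
    then have x: "0 < x" using that by simp
    have "(x powr ?q) powr (1 / ?q) * (a powr ?q) powr (\<gamma> / ?q) \<le> 1 / ?q * x powr ?q + \<gamma> / ?q * a powr ?q"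
      by (rule Youngs_inequality_0) (use \<gamma> x a in \<open>auto simp: add_divide_distrib[symmetric]\<close>)
    then have "x * a powr \<gamma> \<le> (x powr ?q + \<gamma> * a powr ?q) / ?q"
      using \<gamma> x a by (simp add: powr_powr add_divide_distrib)
    then show ?thesis using \<gamma> by (simp add: field_simps)
  qed (use \<gamma> in simp)
  \<comment> \<open>The term \<open>\<gamma> * a powr ?q\<close> is carried on both sides and
    cancelled at the end, avoiding subtraction in \<open>ennreal\<close>.\<close>
  have "ennreal (\<gamma> * a powr ?q) + ennreal (a powr ?q) = ennreal (?q * a powr \<gamma>) * ennreal a"
    using a \<gamma> by (simp add: ennreal_mult[symmetric] ennreal_plus[symmetric] powr_add del: ennreal_plus)
      (simp add: algebra_simps)
  also have "\<dots> \<le> ennreal (?q * a powr \<gamma>) * (\<integral>\<^sup>+\<omega>. ennreal (X \<omega>) \<partial>M)"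
    by (rule mult_left_mono[OF le]) simp
  also have "\<dots> = (\<integral>\<^sup>+\<omega>. ennreal (?q * a powr \<gamma>) * ennreal (X \<omega>) \<partial>M)"
    by (rule nn_integral_cmult[symmetric]) measurable
  also have "\<dots> \<le> (\<integral>\<^sup>+\<omega>. ennreal (\<gamma> * a powr ?q) + ennreal (X \<omega> powr ?q) \<partial>M)"
    by (rule nn_integral_mono)
      (use tangent[OF X] \<gamma> a X in \<open>simp add: ennreal_mult[symmetric] ennreal_plus[symmetric] ennreal_leI add.commute del: ennreal_plus\<close>)
  also have "\<dots> = ennreal (\<gamma> * a powr ?q) + (\<integral>\<^sup>+\<omega>. ennreal (X \<omega> powr ?q) \<partial>M)"
    by (simp add: nn_integral_add emeasure_space_1)
  finally show ?thesis by (simp add: ennreal_add_left_cancel_le)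
qed simp

section \<open>The equation and the correlations of its solution\<close>

locale fractional_heat =
  colored_noise M f F g \<alpha> + kernel \<nu> \<alpha> p N \<beta> D fE
  for M :: "'w measure" and f :: "'a::euclidean_space \<Rightarrow> 'a \<Rightarrow> ennreal"
    and F :: "real \<Rightarrow> 'a set \<Rightarrow> 'w \<Rightarrow> real" and g :: "'a \<Rightarrow> ennreal" and \<alpha> \<nu> :: real
    and p :: "real \<Rightarrow> 'a \<Rightarrow> real" and N :: "'v measure" and \<beta> :: real
    and D :: "real \<Rightarrow> 'v \<Rightarrow> real" and fE :: "real \<Rightarrow> real \<Rightarrow> real" +
  fixes \<sigma> :: "real \<Rightarrow> real" and \<gamma> R Kf :: real
  assumes \<gamma>: "0 < \<gamma>" and \<sigma>: "\<And>x. \<bar>x\<bar> powr (1 + \<gamma>) \<le> \<sigma> x"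
    and R: "0 < R" and Kf: "0 < Kf" and f_lower: "\<And>x y. x \<in> ball 0 R \<Longrightarrow> y \<in> ball 0 R \<Longrightarrow> ennreal Kf \<le> f x y"
begin

lemma \<sigma>_nonneg: "0 \<le> \<sigma> x"
  by (rule order_trans[OF _ \<sigma>]) simp

end

locale mild = fractional_heat M f F g \<alpha> \<nu> p N \<beta> D fE \<sigma> \<gamma> R Kf
  for M :: "'w measure" and f :: "'a::euclidean_space \<Rightarrow> 'a \<Rightarrow> ennreal"
    and F :: "real \<Rightarrow> 'a set \<Rightarrow> 'w \<Rightarrow> real" and g :: "'a \<Rightarrow> ennreal" and \<alpha> \<nu> :: real
    and p :: "real \<Rightarrow> 'a \<Rightarrow> real" and N :: "'v measure" and \<beta> :: real
    and D :: "real \<Rightarrow> 'v \<Rightarrow> real" and fE :: "real \<Rightarrow> real \<Rightarrow> real"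
    and \<sigma> :: "real \<Rightarrow> real" and \<gamma> R Kf :: real +
  fixes u0 :: "'a \<Rightarrow> real" and T :: ereal and u :: "real \<Rightarrow> 'a \<Rightarrow> 'w \<Rightarrow> real"
  assumes u0 [measurable]: "u0 \<in> borel_measurable borel" and u0_nonneg: "\<And>x. 0 \<le> u0 x"
    and u0_bounded: "bounded (range u0)" and solution: "mild_solution M f F G \<sigma> u0 T u"
begin

definition mean :: "real \<Rightarrow> 'a \<Rightarrow> real" where
  "mean t x = (\<integral>y. G t (x - y) * u0 y \<partial>lborel)"

lemma mean_integrable: "0 < t \<Longrightarrow> integrable lborel (\<lambda>y. G t (x - y) * u0 y)"
proof -
  assume t: "0 < t"
  obtain c where "\<And>y. \<bar>u0 y\<bar> \<le> c" using u0_bounded by (auto simp: bounded_iff)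
  then have "integrable lborel (\<lambda>y. u0 y * G t (x + (-1) *\<^sub>R y))"
    by (intro integrable_bounded_mult lborel_affine_integral(1) G_integrable t) auto
  then show ?thesis by (simp add: mult.commute)
qed

lemma mean_nonneg: "0 < t \<Longrightarrow> 0 \<le> mean t x"
  unfolding mean_def by (intro integral_nonneg_AE) (auto simp: G_nonneg u0_nonneg)

text \<open>The radius R + 1 covers x - y for x in the ball of radius \<open>R\<close> and y in the
  unit ball, where the initial mass is measured.\<close>

lemma mean_lower:
  assumes t: "0 < t" and c: "0 \<le> c" and low: "AE x in lborel. norm x \<le> R + 1 \<longrightarrow> c \<le> G t x" and x: "x \<in> ball 0 R"
  shows "c * (LINT y:ball 0 1|lborel. u0 y) \<le> mean t x"
proof -
  have "AE y in lborel. norm (x - y) \<le> R + 1 \<longrightarrow> c \<le> G t (x - y)"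
    using low by (rule AE_lborel_reflect)
  then have "AE y in lborel. c * (indicator (ball 0 1) y *\<^sub>R u0 y) \<le> G t (x - y) * u0 y"
  proof eventually_elim
    case (elim y)
    show ?case
    proof (cases "y \<in> ball 0 1")
      case True
      then have "norm (x - y) \<le> R + 1" using norm_triangle_ineq4[of x y] x by simp
      then show ?thesis using elim True u0_nonneg[of y] by (simp add: mult_right_mono)
    qed (simp add: G_nonneg t u0_nonneg)
  qed
  moreover have "integrable lborel (\<lambda>y. indicator (ball 0 1) y *\<^sub>R u0 y)"
  proof -
    obtain b where b: "\<And>y. \<bar>u0 y\<bar> \<le> b" using u0_bounded by (auto simp: bounded_iff)
    have "integrable lborel (indicator (ball 0 1) :: 'a \<Rightarrow> real)"
      using emeasure_bounded_finite[of "ball (0::'a) 1"] by simp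
    from integrable_bounded_mult[OF this _ b] show ?thesis by (simp add: mult.commute)
  qed
  ultimately show ?thesis
    unfolding mean_def set_lebesgue_integral_def integral_mult_right_zero[symmetric]
    by (intro integral_mono_AE mean_integrable[OF t] Bochner_Integration.integrable_mult_right) auto
qed

text \<open>The absolute value makes this meaningful before any integrability is known, and it suits
  the bound on \<open>\<sigma>\<close>, which is a power of an absolute value.\<close>

definition J :: "real \<Rightarrow> 'a \<Rightarrow> 'a \<Rightarrow> ennreal" where
  "J t y z = (\<integral>\<^sup>+\<omega>. ennreal \<bar>u t y \<omega> * u t z \<omega>\<bar> \<partial>M)"

lemma u_measurable: "0 \<le> t \<Longrightarrow> ereal t < T \<Longrightarrow> u t x \<in> borel_measurable M"
  using solution measurable_noise_filtration unfolding mild_solution_def by blast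

text \<open>The product of two solution values is the product of the deterministic parts plus two
  centred terms plus \<open>Y * Z\<close>. In the mean the centred terms vanish, the two remaining
  parts are nonnegative so either may be dropped, and \<open>J\<close> dominates the signed mean.
  Finiteness holds because Walsh integrals are square integrable.\<close>

lemma J_lower:
  assumes t: "0 < t" "ereal t < T"
  shows "ennreal (mean t y * mean t z) \<le> J t y z"
    "(\<integral>\<^sup>+\<omega>. (\<integral>\<^sup>+s\<in>{0<..<t}. (\<integral>\<^sup>+v. (\<integral>\<^sup>+w.
        ennreal ((G (t - s) (y - v) * \<sigma> (u s v \<omega>)) * (G (t - s) (z - w) * \<sigma> (u s w \<omega>))) * f v w
          \<partial>lborel) \<partial>lborel) \<partial>lborel) \<partial>M) \<le> J t y z"
    "J t y z < \<infinity>"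
proof -
  have ex: "\<exists>Y. has_walsh_integral M f F t (\<lambda>s v \<omega>. G (t - s) (x - v) * \<sigma> (u s v \<omega>)) Y \<and>
      (AE \<omega> in M. u t x \<omega> = mean t x + Y \<omega>)" for x
    using solution t unfolding mild_solution_def mean_def by blast
  obtain Y where Y: "has_walsh_integral M f F t (\<lambda>s v \<omega>. G (t - s) (y - v) * \<sigma> (u s v \<omega>)) Y"
    "AE \<omega> in M. u t y \<omega> = mean t y + Y \<omega>" using ex by blast
  obtain Z where Z: "has_walsh_integral M f F t (\<lambda>s v \<omega>. G (t - s) (z - v) * \<sigma> (u s v \<omega>)) Z"
    "AE \<omega> in M. u t z \<omega> = mean t z + Z \<omega>" using ex by blast
  have nn: "0 \<le> G (t - s) (x - v) * \<sigma> (u s v \<omega>)" if "0 < s" "s < t" for s x v \<omega>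
    using that(2) by (simp add: G_nonneg \<sigma>_nonneg)
  note YY = walsh_integral_covariance[OF t(1) Y(1) Z(1) nn nn]
  note ZZ = walsh_integral_covariance[OF t(1) Z(1) Z(1) nn nn]
  note [measurable] = YY(1) ZZ(1) u_measurable[OF less_imp_le[OF t(1)] t(2)]
  have i: "integrable M Y" "integrable M Z" "integrable M (\<lambda>\<omega>. Y \<omega> * Z \<omega>)"
    using YY(1,2) ZZ(1,2) square_integrable_imp_integrable integrable_mult_of_squares by blast+
  let ?P = "\<lambda>\<omega>. (mean t y + Y \<omega>) * (mean t z + Z \<omega>)"
  have P: "?P \<omega> = mean t y * mean t z + mean t y * Z \<omega> + mean t z * Y \<omega> + Y \<omega> * Z \<omega>" for \<omega>
    by (simp add: algebra_simps)
  have Pi: "integrable M ?P" unfolding P using i by simp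
  have PE: "(\<integral>\<omega>. ?P \<omega> \<partial>M) = mean t y * mean t z + (\<integral>\<omega>. Y \<omega> * Z \<omega> \<partial>M)"
    unfolding P using i YY(3) ZZ(3) by (simp add: prob_space)
  have J: "J t y z = (\<integral>\<^sup>+\<omega>. ennreal \<bar>?P \<omega>\<bar> \<partial>M)"
    unfolding J_def by (rule nn_integral_cong_AE, use Y(2) Z(2) in eventually_elim) simp
  then show "J t y z < \<infinity>" using Pi by (simp add: integrable_iff_bounded)
  have "ennreal (\<integral>\<omega>. ?P \<omega> \<partial>M) \<le> ennreal (norm (\<integral>\<omega>. ?P \<omega> \<partial>M))" by (rule ennreal_leI) simp
  also have "\<dots> \<le> J t y z" unfolding J using integral_norm_bound_ennreal[OF Pi] by simp
  finally have le: "ennreal (mean t y * mean t z) + ennreal (\<integral>\<omega>. Y \<omega> * Z \<omega> \<partial>M) \<le> J t y z"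
    unfolding PE using YY(4) mean_nonneg[OF t(1)] by simp
  show "ennreal (mean t y * mean t z) \<le> J t y z" by (rule order_trans[OF _ le]) simp
  show "(\<integral>\<^sup>+\<omega>. (\<integral>\<^sup>+s\<in>{0<..<t}. (\<integral>\<^sup>+v. (\<integral>\<^sup>+w.
        ennreal ((G (t - s) (y - v) * \<sigma> (u s v \<omega>)) * (G (t - s) (z - w) * \<sigma> (u s w \<omega>))) * f v w
          \<partial>lborel) \<partial>lborel) \<partial>lborel) \<partial>M) \<le> J t y z"
    (is "?Q \<le> _")
  proof -
    have "?Q = ennreal (\<integral>\<omega>. Y \<omega> * Z \<omega> \<partial>M)" by (rule YY(5)[symmetric]) assumption+
    then show ?thesis by (simp add: order_trans[OF _ le])
  qed
qed

lemma nn_integral_expectation_inside: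
  assumes h: "h \<in> borel_measurable (M \<Otimes>\<^sub>M lborel \<Otimes>\<^sub>M lborel \<Otimes>\<^sub>M lborel)"
  shows "(\<integral>\<^sup>+\<omega>. (\<integral>\<^sup>+s. (\<integral>\<^sup>+v. (\<integral>\<^sup>+w. h (\<omega>, s :: real, v :: 'a, w :: 'a) \<partial>lborel) \<partial>lborel) \<partial>lborel) \<partial>M)
    = (\<integral>\<^sup>+s. (\<integral>\<^sup>+v. (\<integral>\<^sup>+w. (\<integral>\<^sup>+\<omega>. h (\<omega>, s, v, w) \<partial>M) \<partial>lborel) \<partial>lborel) \<partial>lborel)"
proof -
  have sf2: "sigma_finite_measure (lborel \<Otimes>\<^sub>M lborel :: ('a \<times> 'a) measure)"
    unfolding lborel_prod by (rule sigma_finite_lborel)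
  have sf3: "sigma_finite_measure (lborel \<Otimes>\<^sub>M lborel \<Otimes>\<^sub>M lborel :: (real \<times> 'a \<times> 'a) measure)"
    unfolding lborel_prod by (rule sigma_finite_lborel)
  interpret P: pair_sigma_finite M "lborel \<Otimes>\<^sub>M lborel \<Otimes>\<^sub>M lborel :: (real \<times> 'a \<times> 'a) measure"
    using sf3 sigma_finite_measure_axioms by (intro pair_sigma_finite.intro)
  note [measurable] = h
  have inner: "(\<lambda>z. \<integral>\<^sup>+\<omega>. h (\<omega>, z) \<partial>M) \<in> borel_measurable (lborel \<Otimes>\<^sub>M lborel \<Otimes>\<^sub>M lborel)"
    by measurable
  have "(\<integral>\<^sup>+\<omega>. (\<integral>\<^sup>+s. (\<integral>\<^sup>+v. (\<integral>\<^sup>+w. h (\<omega>, s, v, w) \<partial>lborel) \<partial>lborel) \<partial>lborel) \<partial>M)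
    = (\<integral>\<^sup>+\<omega>. (\<integral>\<^sup>+z. h (\<omega>, z) \<partial>(lborel \<Otimes>\<^sub>M lborel \<Otimes>\<^sub>M lborel)) \<partial>M)"
    by (simp add: sigma_finite_measure.nn_integral_fst[OF sf2, symmetric] lborel.nn_integral_fst[symmetric]
        cong: nn_integral_cong)
  also have "\<dots> = (\<integral>\<^sup>+z. (\<integral>\<^sup>+\<omega>. h (\<omega>, z) \<partial>M) \<partial>(lborel \<Otimes>\<^sub>M lborel \<Otimes>\<^sub>M lborel))"
    by (rule P.Fubini'[symmetric]) (use h in simp)
  also have "\<dots> = (\<integral>\<^sup>+s. (\<integral>\<^sup>+v. (\<integral>\<^sup>+w. (\<integral>\<^sup>+\<omega>. h (\<omega>, s, v, w) \<partial>M) \<partial>lborel) \<partial>lborel) \<partial>lborel)"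
    using inner
    by (simp add: sigma_finite_measure.nn_integral_fst[OF sf2, symmetric] lborel.nn_integral_fst[symmetric]
        cong: nn_integral_cong)
  finally show ?thesis .
qed

text \<open>The time integral is cut to (s, s') and both space integrals to the ball, where
  \<open>f\<close> is at least \<open>Kf\<close>; Jensen turns the bound \<open>a\<close> into
  \<open>a powr (1 + \<gamma>)\<close>, and each kernel contributes a factor \<open>c\<close>. The
  condition t \<le> s + 1 keeps the time lags within 1, as the bound by \<open>c\<close>
  demands.\<close>

lemma J_step:
  assumes t: "0 < s" "s < s'" "s' \<le> t" "t \<le> s + 1" "ereal t < T"
    and a: "0 \<le> a" "\<And>r v w. s < r \<Longrightarrow> r < s' \<Longrightarrow> v \<in> ball 0 R \<Longrightarrow> w \<in> ball 0 R \<Longrightarrow> ennreal a \<le> J r v w"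
    and c: "0 \<le> c" "\<And>t y. 0 < t \<Longrightarrow> t \<le> 1 \<Longrightarrow> y \<in> ball 0 R \<Longrightarrow> ennreal c \<le> (\<integral>\<^sup>+w\<in>ball 0 R. ennreal (G t (y - w)) \<partial>lborel)"
    and y: "y \<in> ball 0 R" and z: "z \<in> ball 0 R"
  shows "ennreal (Kf * c\<^sup>2 * (s' - s) * a powr (1 + \<gamma>)) \<le> J t y z"
proof -
  let ?B = "ball (0 :: 'a) R"
  have [measurable]: "?B \<in> sets borel" by simp
  define S where "S = {t. 0 \<le> t \<and> ereal t < T}"
  have S [measurable]: "S \<in> sets borel" unfolding S_def by measurable
  \<comment> \<open>The solution extended by 0 outside its lifetime: measurable on the full product
    space and equal to \<open>u\<close> on (s, s').\<close>
  define U where "U r v \<omega> = indicator S r * u r v \<omega>" for r v \<omega>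
  have "(\<lambda>(t, x, \<omega>). u t x \<omega>) \<in> borel_measurable (restrict_space borel S \<Otimes>\<^sub>M borel \<Otimes>\<^sub>M M)"
    using solution by (simp add: mild_solution_def S_def)
  from borel_measurable_extend_by_zero[OF this S] have U: "random_field U"
    by (simp add: random_field_def U_def case_prod_unfold)
  have SU: "U r v \<omega> = u r v \<omega>" if "s < r" "r < s'" for r v \<omega>
  proof -
    have "ereal r < ereal t" using that t by simp
    then have "ereal r < T" using t(5) by (rule order_less_trans)
    then show ?thesis using that t by (simp add: U_def S_def)
  qed
  \<comment> \<open>The deterministic part of the integrand, which can be pulled out of the
    expectation.\<close>
  define k where "k r v w = ennreal (G (t - r) (y - v)) * ennreal (G (t - r) (z - w)) * ennreal Kf
      * (indicator {s<..<s'} r * indicator ?B v * indicator ?B w)" for r v w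
  define h where "h = (\<lambda>(\<omega>, r, v, w). k r v w * ennreal (\<bar>U r v \<omega> * U r w \<omega>\<bar> powr (1 + \<gamma>)))"
  have km: "(\<lambda>(r, v, w). k r v w) \<in> borel_measurable (borel \<Otimes>\<^sub>M borel \<Otimes>\<^sub>M borel)"
    unfolding k_def case_prod_unfold by measurable
  have um: "(\<lambda>x. U (fst (snd x)) (fst (snd (snd x))) (fst x)) \<in> borel_measurable (M \<Otimes>\<^sub>M lborel \<Otimes>\<^sub>M lborel \<Otimes>\<^sub>M lborel)"
    "(\<lambda>x. U (fst (snd x)) (snd (snd (snd x))) (fst x)) \<in> borel_measurable (M \<Otimes>\<^sub>M lborel \<Otimes>\<^sub>M lborel \<Otimes>\<^sub>M lborel)"
    by (rule random_field_measurable[OF U]; measurable)+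
  have hm: "h \<in> borel_measurable (M \<Otimes>\<^sub>M lborel \<Otimes>\<^sub>M lborel \<Otimes>\<^sub>M lborel)"
    unfolding h_def k_def case_prod_unfold using um by measurable
  have Um: "U r v \<in> borel_measurable M" for r v
    using random_field_measurable[OF U, of "\<lambda>_. r" M "\<lambda>_. v" "\<lambda>\<omega>. \<omega>"] by simp
  have mG: "(\<integral>\<^sup>+v. ennreal (G (t - r) (x - v)) * indicator ?B v \<partial>lborel) \<ge> ennreal c"
    if "s < r" "r < s'" "x \<in> ?B" for r x using c(2)[of "t - r" x] that t by simp
  have "ennreal (Kf * c\<^sup>2 * (s' - s) * a powr (1 + \<gamma>))
    = (\<integral>\<^sup>+r. ennreal (Kf * c\<^sup>2 * a powr (1 + \<gamma>)) * indicator {s<..<s'} r \<partial>lborel)"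
  proof -
    have "(\<integral>\<^sup>+r. ennreal (Kf * c\<^sup>2 * a powr (1 + \<gamma>)) * indicator {s<..<s'} r \<partial>lborel)
      = ennreal (Kf * c\<^sup>2 * a powr (1 + \<gamma>)) * ennreal (s' - s)"
      using t by (subst nn_integral_cmult_indicator) auto
    also have "\<dots> = ennreal (Kf * c\<^sup>2 * a powr (1 + \<gamma>) * (s' - s))"
      using t Kf by (intro ennreal_mult[symmetric]) auto
    finally show ?thesis by (simp add: mult_ac)
  qed
  also have "\<dots> \<le> (\<integral>\<^sup>+r. (\<integral>\<^sup>+v. (\<integral>\<^sup>+w. k r v w * ennreal (a powr (1 + \<gamma>)) \<partial>lborel) \<partial>lborel) \<partial>lborel)"
  proof (rule nn_integral_mono)
    fix r
    show "ennreal (Kf * c\<^sup>2 * a powr (1 + \<gamma>)) * indicator {s<..<s'} r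
      \<le> (\<integral>\<^sup>+v. (\<integral>\<^sup>+w. k r v w * ennreal (a powr (1 + \<gamma>)) \<partial>lborel) \<partial>lborel)"
    proof (cases "r \<in> {s<..<s'}")
      case True
      then have r: "s < r" "r < s'" by auto
      have "ennreal (Kf * c\<^sup>2 * a powr (1 + \<gamma>)) = (ennreal c * ennreal c) * (ennreal Kf * ennreal (a powr (1 + \<gamma>)))"
        using Kf c(1) by (simp add: ennreal_mult[symmetric] power2_eq_square mult_ac)
      also have "\<dots> \<le> ((\<integral>\<^sup>+v. ennreal (G (t - r) (y - v)) * indicator ?B v \<partial>lborel)
         * (\<integral>\<^sup>+w. ennreal (G (t - r) (z - w)) * indicator ?B w \<partial>lborel)) * (ennreal Kf * ennreal (a powr (1 + \<gamma>)))"
        by (intro mult_right_mono mult_mono mG r y z) auto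
      also have "\<dots> = (\<integral>\<^sup>+v. (\<integral>\<^sup>+w. (ennreal (G (t - r) (y - v)) * indicator ?B v)
         * ((ennreal (G (t - r) (z - w)) * indicator ?B w) * (ennreal Kf * ennreal (a powr (1 + \<gamma>)))) \<partial>lborel) \<partial>lborel)"
      proof -
        have "(\<integral>\<^sup>+w. (ennreal (G (t - r) (y - v)) * indicator ?B v)
            * ((ennreal (G (t - r) (z - w)) * indicator ?B w) * (ennreal Kf * ennreal (a powr (1 + \<gamma>)))) \<partial>lborel)
          = (ennreal (G (t - r) (y - v)) * indicator ?B v)
            * ((\<integral>\<^sup>+w. ennreal (G (t - r) (z - w)) * indicator ?B w \<partial>lborel) * (ennreal Kf * ennreal (a powr (1 + \<gamma>))))" for v
          by (subst nn_integral_cmult, measurable, subst nn_integral_multc, measurable)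
        then show ?thesis by (simp only: mult.assoc[of "\<integral>\<^sup>+v. _ v \<partial>lborel"]) (rule nn_integral_multc[symmetric], measurable)
      qed
      also have "\<dots> = (\<integral>\<^sup>+v. (\<integral>\<^sup>+w. k r v w * ennreal (a powr (1 + \<gamma>)) \<partial>lborel) \<partial>lborel)"
        unfolding k_def using True by (intro nn_integral_cong) (simp add: mult_ac)
      finally show ?thesis using True by simp
    qed simp
  qed
  also have "\<dots> \<le> (\<integral>\<^sup>+r. (\<integral>\<^sup>+v. (\<integral>\<^sup>+w. (\<integral>\<^sup>+\<omega>. h (\<omega>, r, v, w) \<partial>M) \<partial>lborel) \<partial>lborel) \<partial>lborel)"
  proof (intro nn_integral_mono)
    fix r v w
    show "k r v w * ennreal (a powr (1 + \<gamma>)) \<le> (\<integral>\<^sup>+\<omega>. h (\<omega>, r, v, w) \<partial>M)"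
    proof (cases "r \<in> {s<..<s'} \<and> v \<in> ?B \<and> w \<in> ?B")
      case True
      note [measurable] = Um
      have "ennreal a \<le> (\<integral>\<^sup>+\<omega>. ennreal \<bar>U r v \<omega> * U r w \<omega>\<bar> \<partial>M)"
        using a(2)[of r v w] True SU[of r] by (simp add: J_def)
      then have "ennreal (a powr (1 + \<gamma>)) \<le> (\<integral>\<^sup>+\<omega>. ennreal (\<bar>U r v \<omega> * U r w \<omega>\<bar> powr (1 + \<gamma>)) \<partial>M)"
        by (intro powr_jensen \<gamma> a(1)) auto
      then have "k r v w * ennreal (a powr (1 + \<gamma>)) \<le> k r v w * (\<integral>\<^sup>+\<omega>. ennreal (\<bar>U r v \<omega> * U r w \<omega>\<bar> powr (1 + \<gamma>)) \<partial>M)"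
        by (rule mult_left_mono) simp
      also have "\<dots> = (\<integral>\<^sup>+\<omega>. h (\<omega>, r, v, w) \<partial>M)"
        unfolding h_def prod.case by (rule nn_integral_cmult[symmetric]) measurable
      finally show ?thesis .
    qed (auto simp: k_def)
  qed
  also have "\<dots> = (\<integral>\<^sup>+\<omega>. (\<integral>\<^sup>+r. (\<integral>\<^sup>+v. (\<integral>\<^sup>+w. h (\<omega>, r, v, w) \<partial>lborel) \<partial>lborel) \<partial>lborel) \<partial>M)"
    by (rule nn_integral_expectation_inside[OF hm, symmetric])
  also have "\<dots> \<le> (\<integral>\<^sup>+\<omega>. (\<integral>\<^sup>+r\<in>{0<..<t}. (\<integral>\<^sup>+v. (\<integral>\<^sup>+w.
        ennreal ((G (t - r) (y - v) * \<sigma> (u r v \<omega>)) * (G (t - r) (z - w) * \<sigma> (u r w \<omega>))) * f v w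
          \<partial>lborel) \<partial>lborel) \<partial>lborel) \<partial>M)"
  proof (intro nn_integral_mono)
    fix \<omega> r
    show "(\<integral>\<^sup>+v. (\<integral>\<^sup>+w. h (\<omega>, r, v, w) \<partial>lborel) \<partial>lborel)
      \<le> (\<integral>\<^sup>+v. (\<integral>\<^sup>+w. ennreal ((G (t - r) (y - v) * \<sigma> (u r v \<omega>)) * (G (t - r) (z - w) * \<sigma> (u r w \<omega>))) * f v w
          \<partial>lborel) \<partial>lborel) * indicator {0<..<t} r"
    proof (cases "r \<in> {s<..<s'}")
      case True
      then have r: "s < r" "r < s'" "0 < r" "r < t" using t by auto
      have "h (\<omega>, r, v, w) \<le> ennreal ((G (t - r) (y - v) * \<sigma> (u r v \<omega>)) * (G (t - r) (z - w) * \<sigma> (u r w \<omega>))) * f v w" for v w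
      proof (cases "v \<in> ?B \<and> w \<in> ?B")
        case True
        have G: "0 \<le> G (t - r) (y - v)" "0 \<le> G (t - r) (z - w)" using r by (auto simp: G_nonneg)
        have "\<bar>u r v \<omega> * u r w \<omega>\<bar> powr (1 + \<gamma>) \<le> \<sigma> (u r v \<omega>) * \<sigma> (u r w \<omega>)"
          unfolding abs_mult by (subst powr_mult) (auto intro!: mult_mono \<sigma> \<sigma>_nonneg)
        then have "(G (t - r) (y - v) * G (t - r) (z - w)) * \<bar>u r v \<omega> * u r w \<omega>\<bar> powr (1 + \<gamma>)
          \<le> (G (t - r) (y - v) * G (t - r) (z - w)) * (\<sigma> (u r v \<omega>) * \<sigma> (u r w \<omega>))"
          using G by (intro mult_left_mono) auto
        then have "ennreal (G (t - r) (y - v)) * ennreal (G (t - r) (z - w)) * ennreal (\<bar>u r v \<omega> * u r w \<omega>\<bar> powr (1 + \<gamma>))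
          \<le> ennreal ((G (t - r) (y - v) * \<sigma> (u r v \<omega>)) * (G (t - r) (z - w) * \<sigma> (u r w \<omega>)))"
          using G by (simp add: ennreal_mult[symmetric] ennreal_leI mult_ac)
        then have "(ennreal (G (t - r) (y - v)) * ennreal (G (t - r) (z - w)) * ennreal (\<bar>u r v \<omega> * u r w \<omega>\<bar> powr (1 + \<gamma>))) * ennreal Kf
          \<le> ennreal ((G (t - r) (y - v) * \<sigma> (u r v \<omega>)) * (G (t - r) (z - w) * \<sigma> (u r w \<omega>))) * f v w"
          using f_lower True by (intro mult_mono) auto
        then show ?thesis using True r unfolding h_def k_def prod.case SU[OF r(1,2)] by (simp add: mult_ac)
      qed (auto simp: h_def k_def)
      then show ?thesis using r by (simp add: nn_integral_mono)
    qed (simp add: h_def k_def)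
  qed
  also have "\<dots> \<le> J t y z" by (rule J_lower(2)) (use t in auto)
  finally show ?thesis .
qed

text \<open>
  On \<open>[s n, t1 + 1]\<close> with \<open>s n = t1 + 1 - 2\<^sup>-\<^sup>n\<close> the correlations are at least \<open>A B\<^sup>n\<close>: each step
  gains the power \<open>1 + \<gamma>\<close> and loses the length \<open>2\<^sup>-\<^sup>n\<^sup>-\<^sup>1\<close> of the time interval.
  With \<open>B\<^sup>\<gamma> = 2\<close> these lengths are absorbed, and \<open>C A\<^sup>\<gamma> = 2 B\<close> closes the recursion.
\<close>

lemma no_late_time:
  assumes t1: "0 < t1" and c1: "0 < c1"
    and low: "\<And>t. t1 \<le> t \<Longrightarrow> t \<le> t1 + 1 \<Longrightarrow> AE x in lborel. norm x \<le> R + 1 \<longrightarrow> c1 \<le> G t x"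
    and c2: "0 < c2" "\<And>t y. 0 < t \<Longrightarrow> t \<le> 1 \<Longrightarrow> y \<in> ball 0 R \<Longrightarrow>
      ennreal c2 \<le> (\<integral>\<^sup>+w\<in>ball 0 R. ennreal (G t (y - w)) \<partial>lborel)"
    and B: "B = 2 powr (1 / \<gamma>)" and A: "A = (2 * B / (Kf * c2\<^sup>2)) powr (1 / \<gamma>)"
    and K: "sqrt A / c1 \<le> (LINT x:ball 0 1|lborel. u0 x)"
    and T: "ereal (t1 + 1) < T"
  shows False
proof -
  define C where "C = Kf * c2\<^sup>2"
  have C: "0 < C" using Kf c2 by (simp add: C_def)
  have B1: "1 < B" unfolding B using powr_less_mono[of 0 "1 / \<gamma>" 2] \<gamma> by simp
  have A0: "0 < A" unfolding A using B1 C by (simp add: C_def[symmetric])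
  have B\<gamma>: "B powr \<gamma> = 2" unfolding B using \<gamma> by (simp add: powr_powr)
  have A\<gamma>: "C * A powr \<gamma> = 2 * B" unfolding A C_def[symmetric] using \<gamma> C B1 by (simp add: powr_powr)
  define s where "s n = t1 + 1 - (1 / 2) ^ n" for n :: nat
  have s: "t1 \<le> s n" "s n < s (Suc n)" "s n < t1 + 1" "s (Suc n) - s n = (1 / 2) ^ Suc n" for n
    by (auto simp: s_def power_le_one)
  have ltT: "ereal t < T" if "t \<le> t1 + 1" for t
    using that T by (metis ereal_less_eq(3) order_le_less_trans)
  \<comment> \<open>The claim covers all later times up to t1 + 1 and all pairs in the ball, because
    the next step integrates over both.\<close>
  have main: "\<forall>t y z. s n \<le> t \<longrightarrow> t \<le> t1 + 1 \<longrightarrow> y \<in> ball 0 R \<longrightarrow> z \<in> ball 0 R \<longrightarrow> ennreal (A * B ^ n) \<le> J t y z" for n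
  proof (induction n)
    case 0
    show ?case
    proof (intro allI impI)
      fix t and y z :: 'a assume t: "s 0 \<le> t" "t \<le> t1 + 1" and y: "y \<in> ball 0 R" and z: "z \<in> ball 0 R"
      have t': "t1 \<le> t" "0 < t" using t t1 by (auto simp: s_def)
      \<comment> \<open>The threshold \<open>sqrt A / c1\<close> on the initial mass is made for
        this: the deterministic parts at two points multiply to at least \<open>A\<close>.\<close>
      have m: "sqrt A \<le> mean t x" if "x \<in> ball 0 R" for x
      proof -
        have "sqrt A = c1 * (sqrt A / c1)" using c1 by simp
        also have "\<dots> \<le> c1 * (LINT x:ball 0 1|lborel. u0 x)" using c1 K by (intro mult_left_mono) auto
        also have "\<dots> \<le> mean t x" by (rule mean_lower[OF t'(2) less_imp_le[OF c1] low[OF t'(1) t(2)] that])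
        finally show ?thesis .
      qed
      have "A = sqrt A * sqrt A" using A0 by simp
      also have "\<dots> \<le> mean t y * mean t z" using m[OF y] m[OF z] A0 by (intro mult_mono) (auto intro: order_trans[OF _ m[OF y]])
      finally have "ennreal A \<le> ennreal (mean t y * mean t z)" by (rule ennreal_leI)
      also have "\<dots> \<le> J t y z" by (rule J_lower(1)[OF t'(2) ltT[OF t(2)]])
      finally show "ennreal (A * B ^ 0) \<le> J t y z" by simp
    qed
  next
    case (Suc n)
    \<comment> \<open>The previous bound contributes 2^n and the time step (1/2)^(n+1); the surplus
      factor 1/2 is why \<open>C * A powr \<gamma>\<close> equals 2 B and not B.\<close>
    have pow: "A * B ^ Suc n = Kf * c2\<^sup>2 * (s (Suc n) - s n) * (A * B ^ n) powr (1 + \<gamma>)"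
    proof -
      have Bn: "(B ^ n) powr \<gamma> = 2 ^ n"
        using B1 B\<gamma> by (metis less_trans powr_powr powr_realpow mult.commute zero_less_one zero_less_numeral)
      have "(A * B ^ n) powr (1 + \<gamma>) = (A * B ^ n) * (A powr \<gamma> * 2 ^ n)"
        using A0 B1 Bn by (simp add: powr_add powr_mult)
      then have "Kf * c2\<^sup>2 * (s (Suc n) - s n) * (A * B ^ n) powr (1 + \<gamma>) = (C * A powr \<gamma>) * ((1/2) ^ Suc n * 2 ^ n) * (A * B ^ n)"
        unfolding s(4) C_def by (simp add: mult_ac)
      also have "(1/2 :: real) ^ Suc n * 2 ^ n = 1 / 2" by (simp add: power_mult_distrib[symmetric])
      finally show ?thesis unfolding A\<gamma> by simp
    qed
    show ?case
    proof (intro allI impI)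
      fix t and y z :: 'a assume t: "s (Suc n) \<le> t" "t \<le> t1 + 1" and y: "y \<in> ball 0 R" and z: "z \<in> ball 0 R"
      show "ennreal (A * B ^ Suc n) \<le> J t y z" unfolding pow
      proof (rule J_step[OF _ s(2) t(1) _ ltT[OF t(2)] _ _ less_imp_le[OF c2(1)] c2(2) y z])
        show "0 < s n" using s(1)[of n] t1 by simp
        show "t \<le> s n + 1" using s(1)[of n] t by simp
        show "0 \<le> A * B ^ n" using A0 B1 by simp
        fix r and v w :: 'a assume "s n < r" "r < s (Suc n)" "v \<in> ball 0 R" "w \<in> ball 0 R"
        then show "ennreal (A * B ^ n) \<le> J r v w" using Suc.IH s(3)[of "Suc n"] by auto
      qed
    qed
  qed
  \<comment> \<open>All the intervals end at t1 + 1, so at this single time every bound of the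
    sequence holds, while the value is finite.\<close>
  have "J (t1 + 1) 0 0 < \<infinity>" by (rule J_lower(3)) (use t1 T in auto)
  then obtain j where j: "J (t1 + 1) 0 0 = ennreal j" "0 \<le> j" by (cases "J (t1 + 1) 0 0") auto
  obtain n where "j / A < B ^ n" using real_arch_pow[OF B1] by blast
  then have "j < A * B ^ n" using A0 by (simp add: field_simps)
  moreover have "ennreal (A * B ^ n) \<le> ennreal j"
    unfolding j(1)[symmetric] using main[of n] s(3)[of n] R by (auto intro: less_imp_le)
  ultimately show False using j by simp
qed

end

theorem theorem1p10:
  fixes \<nu> \<alpha> \<beta> \<gamma> R Kf :: real
    and \<sigma> :: "real \<Rightarrow> real"
    and p :: "real \<Rightarrow> 'a::euclidean_space \<Rightarrow> real"
    and N :: "'v measure" and D :: "real \<Rightarrow> 'v \<Rightarrow> real" and fE :: "real \<Rightarrow> real \<Rightarrow> real"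
    and f :: "'a \<Rightarrow> 'a \<Rightarrow> ennreal" and g :: "'a \<Rightarrow> ennreal"
    and M :: "'w measure" and F :: "real \<Rightarrow> 'a set \<Rightarrow> 'w \<Rightarrow> real"
  assumes "0 < \<nu>" and "0 < \<beta>" "\<beta> < 1" and "0 < \<alpha>" "\<alpha> < 2"
    and "stable_transition_density \<nu> \<alpha> p"
    and "stable_subordinator N \<beta> D"
    and "first_passage_density N D fE"
    and "\<And>x. \<exists>e>0. \<exists>L. L-lipschitz_on (cball x e) \<sigma>"
    and "0 < \<gamma>" and "\<And>x. \<sigma> x \<ge> \<bar>x\<bar> powr (1 + \<gamma>)"
    and "spatial_correlation \<alpha> f g"
    and "white_colored_noise M f F"
    and "0 < R" and "0 < Kf"
    and "(INF x\<in>ball 0 R. INF y\<in>ball 0 R. f x y) \<ge> ennreal Kf"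
  shows "\<exists>t0\<ge>0. \<exists>K>0. \<forall>u0 :: 'a \<Rightarrow> real.
           u0 \<in> borel_measurable borel \<longrightarrow> (\<forall>x. 0 \<le> u0 x) \<longrightarrow> bounded (range u0) \<longrightarrow>
           0 < (LINT x:ball 0 1|lborel. u0 x) \<longrightarrow>
           (\<forall>T u. mild_solution M f F (time_changed_density p fE) \<sigma> u0 T u \<longrightarrow>
              (LINT x:ball 0 1|lborel. u0 x) \<ge> K \<longrightarrow>
              (\<forall>t\<ge>t0. ereal t < T \<longrightarrow> (\<forall>x. (\<integral>\<^sup>+\<omega>. ennreal (\<bar>u t x \<omega>\<bar>\<^sup>2) \<partial>M) = \<infinity>)))"
proof -
  interpret fractional_heat M f F g \<alpha> \<nu> p N \<beta> D fE \<sigma> \<gamma> R Kf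
  proof unfold_locales
    fix x y :: 'a assume xy: "x \<in> ball 0 R" "y \<in> ball 0 R"
    have "ennreal Kf \<le> (INF y\<in>ball 0 R. f x y)" using assms(16) xy(1) by (simp add: le_INF_iff)
    then show "ennreal Kf \<le> f x y" using xy(2) by (simp add: le_INF_iff)
  qed (use assms in auto)
  \<comment> \<open>The constants of the conclusion are fixed from here on, before any initial
    function appears; they depend only on the kernel, \<open>R\<close>, \<open>Kf\<close> and
    \<open>\<gamma>\<close>.\<close>
  obtain t1 c1 where t1: "0 < t1" and c1: "0 < c1"
    and low: "\<And>t. t1 \<le> t \<Longrightarrow> t \<le> t1 + 1 \<Longrightarrow> AE x in lborel. norm (x :: 'a) \<le> R + 1 \<longrightarrow> c1 \<le> G t x"
    using G_lower[of "R + 1"] R by auto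
  obtain c2 where c2: "0 < c2" "\<And>t y. 0 < t \<Longrightarrow> t \<le> 1 \<Longrightarrow> y \<in> ball 0 R \<Longrightarrow>
      ennreal c2 \<le> (\<integral>\<^sup>+w\<in>ball 0 R. ennreal (G t (y - w)) \<partial>lborel)"
    using G_ball_lower[OF R] by blast
  define B where "B = 2 powr (1 / \<gamma>)"
  define A where "A = (2 * B / (Kf * c2\<^sup>2)) powr (1 / \<gamma>)"
  have "0 < A" unfolding A_def B_def using Kf c2 by simp
  then have K: "0 < sqrt A / c1" using c1 by simp
  \<comment> \<open>No solution with large initial mass is alive at time t1 + 1 or later; the
    second-moment claim, conditional on \<open>ereal t < T\<close>, follows from this
    contradiction.\<close>
  have contra: False
    if "u0 \<in> borel_measurable borel" "\<forall>x. 0 \<le> u0 x" "bounded (range u0)"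
      "mild_solution M f F (time_changed_density p fE) \<sigma> u0 T u"
      "sqrt A / c1 \<le> (LINT x:ball 0 1|lborel. u0 x)" "t1 + 1 \<le> t" "ereal t < T"
    for u0 :: "'a \<Rightarrow> real" and T u t
  proof -
    interpret mild M f F g \<alpha> \<nu> p N \<beta> D fE \<sigma> \<gamma> R Kf u0 T u
      by unfold_locales (use that in \<open>auto simp: G_def\<close>)
    have "ereal (t1 + 1) < T" using that(6,7) by (metis ereal_less_eq(3) order_le_less_trans)
    then show False using no_late_time[OF t1 c1 low c2 B_def A_def that(5)] by blast
  qed
  show ?thesis
  proof (rule exI[of _ "t1 + 1"], rule conjI)
    show "0 \<le> t1 + 1" using t1 by simp
    show "\<exists>K>0. \<forall>u0 :: 'a \<Rightarrow> real.
           u0 \<in> borel_measurable borel \<longrightarrow> (\<forall>x. 0 \<le> u0 x) \<longrightarrow> bounded (range u0) \<longrightarrow>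
           0 < (LINT x:ball 0 1|lborel. u0 x) \<longrightarrow>
           (\<forall>T u. mild_solution M f F (time_changed_density p fE) \<sigma> u0 T u \<longrightarrow>
              (LINT x:ball 0 1|lborel. u0 x) \<ge> K \<longrightarrow>
              (\<forall>t\<ge>t1 + 1. ereal t < T \<longrightarrow> (\<forall>x. (\<integral>\<^sup>+\<omega>. ennreal (\<bar>u t x \<omega>\<bar>\<^sup>2) \<partial>M) = \<infinity>)))"
      by (rule exI[of _ "sqrt A / c1"], rule conjI[OF K]) (use contra in blast)
  qed
qed

end
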